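(* Let $R$ be a Tate $\varphi$-algebra over a field $k$. Then the graded $k$-vector space $\mathcal A^\varphi_\bullet(R)$ has a graded Hopf algebra structure, given by the deconcatenation coproduct $\Delta$ and the quasi-shuffle product $m$. It is commutative if and only if $R$ is commutative.
   Context: Tensor products are over $k$. A Tate $\varphi$-algebra over $k$ is a graded $k$-algebra $R=\bigoplus_{n\in\mathbb Z}R_n$ (associative, unital, possibly non-commutative) with an invertible Tate line $k(1)$ in degree $1$: a 1-dimensional $k$-subspace $k(1)\subset R_1$, contained in the center of $R$, whose nonzero elements are invertible in $R$. Put $\overline{R_1}=R_1/k(1)$ and $$\mathcal A^\varphi_\bullet(R)=\bigoplus_{n\ge0}\mathcal A^\varphi_n(R),\qquad\mathcal A^\varphi_0(R)=k,\qquad\mathcal A^\varphi_n(R)=\overline{R_1}\otimes\underbrace{R_1\otimes\cdots\otimes R_1}_{n-1}\quad(n>0).$$ Coproduct: $\Delta(\overline x_1\otimes x_2\otimes\cdots\otimes x_n)=\sum_{j=0}^n(\overline x_1\otimes\cdots\otimes x_j)\bigotimes(\overline x_{j+1}\otimes\cdots\otimes x_n)$, where $\overline x$ is the class of $x\in R_1$ in $\overline{R_1}$ and empty factors equal $1$. Product: fix $0\ne t\in k(1)$. On $\mathrm T_\bullet(R_1)=\bigoplus_nR_1^{\otimes n}$ let $m'$ be the bilinear product with unit $1\in k$ and, for $p,q\ge1$, $$\begin{aligned}m'(x_1\otimes\cdots\otimes x_p,y_1\otimes\cdots\otimes y_q)=\ &x_1\otimes m'(x_2\otimes\cdots\otimes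 x_p,y_1\otimes\cdots\otimes y_q)+y_1\otimes m'(x_1\otimes\cdots\otimes x_p,y_2\otimes\cdots\otimes y_q)\\&-x_1y_1t^{-1}\otimes t\otimes m'(x_2\otimes\cdots\otimes x_p,y_2\otimes\cdots\otimes y_q)\end{aligned}$$ (note $x_1y_1t^{-1}\in R_1$; $m'$ does not depend on $t$). With $\mathrm{pr}:\mathrm T_\bullet(R_1)\to\mathcal A^\varphi_\bullet(R)$ the natural projection, $m(\mathrm{pr}X,\mathrm{pr}Y)=\mathrm{pr}\,m'(X,Y)$, which is independent of the lifts. *)

theory Defs
  imports
    "HOL-Algebra.Algebraic_Closure_Type"
    "HOL-Library.Poly_Mapping"
    "HOL-Library.Set_Algebras"
begin

no_notation Polynomials.var (\<open>X\<index>\<close>)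

section \<open>Vector spaces given by generators and relations\<close>

text \<open>
  The ground field is a type \<open>'k\<close> of class \<^class>\<open>field\<close>. Vector spaces that are constructed
  (quotients, tensor products) are \<open>HOL-Algebra\<close> modules over \<open>ring_of_type_algebra :: 'k ring\<close>.
\<close>

definition free_scale :: "'k::field \<Rightarrow> ('x \<Rightarrow>\<^sub>0 'k) \<Rightarrow> ('x \<Rightarrow>\<^sub>0 'k)"
  where "free_scale c p = Poly_Mapping.map (\<lambda>d. c * d) p"

lemma lookup_free_scale: "Poly_Mapping.lookup (free_scale c p) s = c * Poly_Mapping.lookup p s"
  unfolding free_scale_def by (simp add: Poly_Mapping.map.rep_eq when_def)

interpretation free: vector_space "free_scale :: 'k::field \<Rightarrow> ('x \<Rightarrow>\<^sub>0 'k) \<Rightarrow> _"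
  by unfold_locales
    (rule poly_mapping_eqI; simp add: lookup_free_scale lookup_add algebra_simps)+

text \<open>
  The quotient of the free vector space on \<open>S\<close> by the span of the relations \<open>Q\<close>; its elements are
  cosets. The record type of modules has ring components; they play no role here.
\<close>

definition presented ::
    "'x set \<Rightarrow> ('x \<Rightarrow>\<^sub>0 'k::field) set \<Rightarrow> ('k, ('x \<Rightarrow>\<^sub>0 'k) set) module"
  where "presented S Q =
    \<lparr>carrier = {p +o free.span Q | p. Poly_Mapping.keys p \<subseteq> S},
     monoid.mult = undefined, one = undefined,
     zero = free.span Q,
     add = (\<lambda>X Y. X + Y),
     module.smult = (\<lambda>c X. free_scale c ` X + free.span Q)\<rparr>"

definition gen_class :: "('x \<Rightarrow>\<^sub>0 'k::field) set \<Rightarrow> 'x \<Rightarrow> ('x \<Rightarrow>\<^sub>0 'k) set"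
  where "gen_class Q s = Poly_Mapping.single s 1 +o free.span Q"

text \<open>
  The linear map, from a vector space presented by generators and relations to \<open>P\<close>, that sends the
  generator \<open>s\<close> to \<open>f s\<close>. The choice of the representative is immaterial if \<open>f\<close> respects the
  relations.
\<close>

definition extend ::
    "('k::field, 'p, 'm) module_scheme \<Rightarrow> ('x \<Rightarrow> 'p) \<Rightarrow> ('x \<Rightarrow>\<^sub>0 'k) set \<Rightarrow> 'p"
  where "extend P f X =
    (let p = (SOME p. p \<in> X)
     in \<Oplus>\<^bsub>P\<^esub>s\<in>Poly_Mapping.keys p. Poly_Mapping.lookup p s \<odot>\<^bsub>P\<^esub> f s)"


section \<open>The tensor product of two vector spaces\<close>

definition tensor_rels ::
    "('k::field, 'v, 'm) module_scheme \<Rightarrow> ('k, 'w, 'n) module_scheme \<Rightarrow> ('v \<times> 'w \<Rightarrow>\<^sub>0 'k) set"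
  where "tensor_rels M N =
    {Poly_Mapping.single (x \<oplus>\<^bsub>M\<^esub> x', y) 1 - Poly_Mapping.single (x, y) 1 - Poly_Mapping.single (x', y) 1 |
       x x' y. x \<in> carrier M \<and> x' \<in> carrier M \<and> y \<in> carrier N} \<union>
    {Poly_Mapping.single (x, y \<oplus>\<^bsub>N\<^esub> y') 1 - Poly_Mapping.single (x, y) 1 - Poly_Mapping.single (x, y') 1 |
       x y y'. x \<in> carrier M \<and> y \<in> carrier N \<and> y' \<in> carrier N} \<union>
    {Poly_Mapping.single (c \<odot>\<^bsub>M\<^esub> x, y) 1 - Poly_Mapping.single (x, y) c |
       c x y. x \<in> carrier M \<and> y \<in> carrier N} \<union>
    {Poly_Mapping.single (x, c \<odot>\<^bsub>N\<^esub> y) 1 - Poly_Mapping.single (x, y) c |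
       c x y. x \<in> carrier M \<and> y \<in> carrier N}"

definition tensor ::
    "('k::field, 'v, 'm) module_scheme \<Rightarrow> ('k, 'w, 'n) module_scheme \<Rightarrow>
     ('k, ('v \<times> 'w \<Rightarrow>\<^sub>0 'k) set) module"
  where "tensor M N = presented (carrier M \<times> carrier N) (tensor_rels M N)"

definition pure_tensor ::
    "('k::field, 'v, 'm) module_scheme \<Rightarrow> ('k, 'w, 'n) module_scheme \<Rightarrow>
     'v \<Rightarrow> 'w \<Rightarrow> ('v \<times> 'w \<Rightarrow>\<^sub>0 'k) set"
  where "pure_tensor M N x y = gen_class (tensor_rels M N) (x, y)"

text \<open>\<open>f \<otimes> g\<close>, with values in \<open>tensor M N\<close>.\<close>

definition tensor_map ::
    "('k::field, 'v, 'm) module_scheme \<Rightarrow> ('k, 'w, 'n) module_scheme \<Rightarrow>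
     ('x \<Rightarrow> 'v) \<Rightarrow> ('y \<Rightarrow> 'w) \<Rightarrow> ('x \<times> 'y \<Rightarrow>\<^sub>0 'k) set \<Rightarrow> ('v \<times> 'w \<Rightarrow>\<^sub>0 'k) set"
  where "tensor_map M N f g = extend (tensor M N) (\<lambda>(x, y). pure_tensor M N (f x) (g y))"

text \<open>\<open>(x \<otimes> y) \<otimes> z \<mapsto> x \<otimes> (y \<otimes> z)\<close>\<close>

definition tensor_assoc ::
    "('k::field, 'u, 'm) module_scheme \<Rightarrow> ('k, 'v, 'n) module_scheme \<Rightarrow> ('k, 'w, 'l) module_scheme \<Rightarrow>
     (('u \<times> 'v \<Rightarrow>\<^sub>0 'k) set \<times> 'w \<Rightarrow>\<^sub>0 'k) set \<Rightarrow> ('u \<times> ('v \<times> 'w \<Rightarrow>\<^sub>0 'k) set \<Rightarrow>\<^sub>0 'k) set"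
  where "tensor_assoc M N P =
    extend (tensor M (tensor N P)) (\<lambda>(X, z).
      extend (tensor M (tensor N P)) (\<lambda>(x, y).
        pure_tensor M (tensor N P) x (pure_tensor N P y z)) X)"

text \<open>\<open>(x \<otimes> y) (x' \<otimes> y') = x x' \<otimes> y y'\<close>, without signs.\<close>

definition tensor_mult ::
    "('k::field, 'h, 'm) module_scheme \<Rightarrow>
     ('h \<times> 'h \<Rightarrow>\<^sub>0 'k) set \<Rightarrow> ('h \<times> 'h \<Rightarrow>\<^sub>0 'k) set \<Rightarrow> ('h \<times> 'h \<Rightarrow>\<^sub>0 'k) set"
  where "tensor_mult H X Y =
    extend (tensor H H) (\<lambda>(x, y).
      extend (tensor H H) (\<lambda>(x', y').
        pure_tensor H H (x \<otimes>\<^bsub>H\<^esub> x') (y \<otimes>\<^bsub>H\<^esub> y')) Y) X"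


section \<open>Graded Hopf algebras\<close>

definition lin_map ::
    "('k::field, 'v, 'm) module_scheme \<Rightarrow> ('k, 'w, 'n) module_scheme \<Rightarrow> ('v \<Rightarrow> 'w) \<Rightarrow> bool"
  where "lin_map M N f \<longleftrightarrow>
    f \<in> carrier M \<rightarrow> carrier N \<and>
    (\<forall>x\<in>carrier M. \<forall>y\<in>carrier M. f (x \<oplus>\<^bsub>M\<^esub> y) = f x \<oplus>\<^bsub>N\<^esub> f y) \<and>
    (\<forall>c. \<forall>x\<in>carrier M. f (c \<odot>\<^bsub>M\<^esub> x) = c \<odot>\<^bsub>N\<^esub> f x)"

text \<open>The locale \<^locale>\<open>algebra\<close> of \<open>HOL-Algebra\<close> is about commutative algebras.\<close>

locale k_algebra =
  fixes H :: "('k::field, 'h) module"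
  assumes is_module: "Module.module ring_of_type_algebra H"
    and is_ring: "Ring.ring H"
    and smult_mult_left:
      "\<lbrakk>x \<in> carrier H; y \<in> carrier H\<rbrakk> \<Longrightarrow> (c \<odot>\<^bsub>H\<^esub> x) \<otimes>\<^bsub>H\<^esub> y = c \<odot>\<^bsub>H\<^esub> (x \<otimes>\<^bsub>H\<^esub> y)"
    and smult_mult_right:
      "\<lbrakk>x \<in> carrier H; y \<in> carrier H\<rbrakk> \<Longrightarrow> x \<otimes>\<^bsub>H\<^esub> (c \<odot>\<^bsub>H\<^esub> y) = c \<odot>\<^bsub>H\<^esub> (x \<otimes>\<^bsub>H\<^esub> y)"

locale k_coalgebra =
  fixes H :: "('k::field, 'h) module"
    and \<Delta> :: "'h \<Rightarrow> ('h \<times> 'h \<Rightarrow>\<^sub>0 'k) set"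
    and \<epsilon> :: "'h \<Rightarrow> 'k"
  assumes is_vector_space: "Module.module ring_of_type_algebra H"
    and coproduct_linear: "lin_map H (tensor H H) \<Delta>"
    and counit_add: "\<lbrakk>x \<in> carrier H; y \<in> carrier H\<rbrakk> \<Longrightarrow> \<epsilon> (x \<oplus>\<^bsub>H\<^esub> y) = \<epsilon> x + \<epsilon> y"
    and counit_smult: "x \<in> carrier H \<Longrightarrow> \<epsilon> (c \<odot>\<^bsub>H\<^esub> x) = c * \<epsilon> x"
    and coassociative:
      "x \<in> carrier H \<Longrightarrow>
        tensor_assoc H H H (tensor_map (tensor H H) H \<Delta> (\<lambda>y. y) (\<Delta> x)) =
        tensor_map H (tensor H H) (\<lambda>y. y) \<Delta> (\<Delta> x)"
    and counit_left: "x \<in> carrier H \<Longrightarrow> extend H (\<lambda>(y, z). \<epsilon> y \<odot>\<^bsub>H\<^esub> z) (\<Delta> x) = x"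
    and counit_right: "x \<in> carrier H \<Longrightarrow> extend H (\<lambda>(y, z). \<epsilon> z \<odot>\<^bsub>H\<^esub> y) (\<Delta> x) = x"

locale k_bialgebra = k_algebra H + k_coalgebra H \<Delta> \<epsilon>
  for H :: "('k::field, 'h) module" and \<Delta> and \<epsilon> +
  assumes coproduct_mult:
      "\<lbrakk>x \<in> carrier H; y \<in> carrier H\<rbrakk> \<Longrightarrow> \<Delta> (x \<otimes>\<^bsub>H\<^esub> y) = tensor_mult H (\<Delta> x) (\<Delta> y)"
    and coproduct_one: "\<Delta> \<one>\<^bsub>H\<^esub> = pure_tensor H H \<one>\<^bsub>H\<^esub> \<one>\<^bsub>H\<^esub>"
    and counit_mult: "\<lbrakk>x \<in> carrier H; y \<in> carrier H\<rbrakk> \<Longrightarrow> \<epsilon> (x \<otimes>\<^bsub>H\<^esub> y) = \<epsilon> x * \<epsilon> y"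
    and counit_one: "\<epsilon> \<one>\<^bsub>H\<^esub> = 1"

locale hopf_algebra = k_bialgebra H \<Delta> \<epsilon>
  for H :: "('k::field, 'h) module" and \<Delta> and \<epsilon> +
  fixes S :: "'h \<Rightarrow> 'h"
  assumes antipode_linear: "lin_map H H S"
    and antipode_left:
      "x \<in> carrier H \<Longrightarrow> extend H (\<lambda>(y, z). S y \<otimes>\<^bsub>H\<^esub> z) (\<Delta> x) = \<epsilon> x \<odot>\<^bsub>H\<^esub> \<one>\<^bsub>H\<^esub>"
    and antipode_right:
      "x \<in> carrier H \<Longrightarrow> extend H (\<lambda>(y, z). y \<otimes>\<^bsub>H\<^esub> S z) (\<Delta> x) = \<epsilon> x \<odot>\<^bsub>H\<^esub> \<one>\<^bsub>H\<^esub>"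

text \<open>The subspace \<open>\<Sum>p+q=n. H p \<otimes> H q\<close> of \<open>H \<otimes> H\<close>.\<close>

definition tensor_degree ::
    "('k::field, 'h, 'm) module_scheme \<Rightarrow> (nat \<Rightarrow> 'h set) \<Rightarrow> nat \<Rightarrow> ('h \<times> 'h \<Rightarrow>\<^sub>0 'k) set set"
  where "tensor_degree H Hn n =
    {f +o free.span (tensor_rels H H) | f.
       Poly_Mapping.keys f \<subseteq> (\<Union>p\<in>{..n}. Hn p \<times> Hn (n - p))}"

locale graded_hopf_algebra = hopf_algebra H \<Delta> \<epsilon> S
  for H :: "('k::field, 'h) module" and \<Delta> and \<epsilon> and S +
  fixes Hn :: "nat \<Rightarrow> 'h set"
  assumes degree_submodule: "submodule (Hn n) ring_of_type_algebra H"
    and direct_sum: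
      "x \<in> carrier H \<Longrightarrow>
        \<exists>!f. (\<forall>n. f n \<in> Hn n) \<and> finite {n. f n \<noteq> \<zero>\<^bsub>H\<^esub>} \<and>
             x = (\<Oplus>\<^bsub>H\<^esub>n\<in>{n. f n \<noteq> \<zero>\<^bsub>H\<^esub>}. f n)"
    and mult_degree: "\<lbrakk>x \<in> Hn p; y \<in> Hn q\<rbrakk> \<Longrightarrow> x \<otimes>\<^bsub>H\<^esub> y \<in> Hn (p + q)"
    and one_degree: "\<one>\<^bsub>H\<^esub> \<in> Hn 0"
    and coproduct_degree: "x \<in> Hn n \<Longrightarrow> \<Delta> x \<in> tensor_degree H Hn n"
    and counit_degree: "\<lbrakk>x \<in> Hn n; n > 0\<rbrakk> \<Longrightarrow> \<epsilon> x = 0"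
    and antipode_degree: "x \<in> Hn n \<Longrightarrow> S x \<in> Hn n"


section \<open>Tate \<open>\<phi>\<close>-algebras\<close>

locale graded_k_algebra = vector_space sc
  for sc :: "'k::field \<Rightarrow> 'a::ring_1 \<Rightarrow> 'a" +
  fixes R :: "int \<Rightarrow> 'a set"
  assumes scale_mult_left: "sc c x * y = sc c (x * y)"
    and scale_mult_right: "x * sc c y = sc c (x * y)"
    and homogeneous_subspace: "subspace (R n)"
    and homogeneous_direct_sum:
      "\<exists>!f. (\<forall>n. f n \<in> R n) \<and> finite {n. f n \<noteq> 0} \<and> x = (\<Sum>n | f n \<noteq> 0. f n)"
    and homogeneous_mult: "\<lbrakk>x \<in> R p; y \<in> R q\<rbrakk> \<Longrightarrow> x * y \<in> R (p + q)"
    and homogeneous_one: "1 \<in> R 0"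

text \<open>\<open>L\<close> is the Tate line \<open>k(1)\<close>.\<close>

locale tate_phi_algebra = graded_k_algebra sc R
  for sc :: "'k::field \<Rightarrow> 'a::ring_1 \<Rightarrow> 'a" and R +
  fixes L :: "'a set"
  assumes line_subspace: "subspace L"
    and line_dim: "dim L = 1"
    and line_degree: "L \<subseteq> R 1"
    and line_central: "l \<in> L \<Longrightarrow> l * x = x * l"
    and line_invertible: "\<lbrakk>l \<in> L; l \<noteq> 0\<rbrakk> \<Longrightarrow> \<exists>s. l * s = 1 \<and> s * l = 1"

definition ring_inverse :: "'a::ring_1 \<Rightarrow> 'a"
  where "ring_inverse x = (THE s. x * s = 1 \<and> s * x = 1)"


section \<open>The graded vector spaces \<open>T(R\<^sub>1)\<close> and \<open>A(R)\<close>\<close>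

text \<open>
  Relations saying that the generator \<open>b w\<close> depends multilinearly on the letters of the word \<open>w\<close>
  over \<open>V\<close>. They only relate words of equal length, so the space that they present is the direct sum
  of its homogeneous parts.
\<close>

definition multilinear_rels ::
    "('k::field \<Rightarrow> 'a::ring_1 \<Rightarrow> 'a) \<Rightarrow> 'a set \<Rightarrow> ('a list \<Rightarrow> 'x) \<Rightarrow> ('x \<Rightarrow>\<^sub>0 'k) set"
  where "multilinear_rels sc V b =
    {Poly_Mapping.single (b (u @ (x + y) # v)) 1
       - Poly_Mapping.single (b (u @ x # v)) 1 - Poly_Mapping.single (b (u @ y # v)) 1 |
       u v x y. u \<in> lists V \<and> v \<in> lists V \<and> x \<in> V \<and> y \<in> V} \<union>
    {Poly_Mapping.single (b (u @ sc c x # v)) 1 - Poly_Mapping.single (b (u @ x # v)) c |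
       u v c x. u \<in> lists V \<and> v \<in> lists V \<and> x \<in> V}"

text \<open>\<open>T(V)\<close>, the direct sum of all tensor powers of \<open>V\<close>. The word \<open>[x\<^sub>1, \<dots>, x\<^sub>n]\<close> stands for
  \<open>x\<^sub>1 \<otimes> \<dots> \<otimes> x\<^sub>n\<close>, the empty word for \<open>1 \<in> k\<close>.\<close>

abbreviation T_rels :: "('k::field \<Rightarrow> 'a::ring_1 \<Rightarrow> 'a) \<Rightarrow> 'a set \<Rightarrow> ('a list \<Rightarrow>\<^sub>0 'k) set"
  where "T_rels sc V \<equiv> multilinear_rels sc V (\<lambda>w. w)"

definition T_space ::
    "('k::field \<Rightarrow> 'a::ring_1 \<Rightarrow> 'a) \<Rightarrow> 'a set \<Rightarrow> ('k, ('a list \<Rightarrow>\<^sub>0 'k) set) module"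
  where "T_space sc V = presented (lists V) (T_rels sc V)"

text \<open>
  The generators of \<open>A(R)\<close>: \<open>Bar \<xi> [x\<^sub>2, \<dots>, x\<^sub>n]\<close> stands for \<open>\<xi> \<otimes> x\<^sub>2 \<otimes> \<dots> \<otimes> x\<^sub>n\<close>, where \<open>\<xi>\<close> is an
  element of \<open>R\<^sub>1/k(1)\<close>, that is, a coset; \<open>Empty\<close> stands for \<open>1 \<in> k\<close>. In the relations for
  \<open>b = bar L\<close>, the case \<open>u = []\<close> is linearity in the first factor, since addition and scalar
  multiplication of cosets are given by those of representatives.
\<close>

datatype 'a bar_word = Empty | Bar "'a set" "'a list"

fun bar :: "'a::ring_1 set \<Rightarrow> 'a list \<Rightarrow> 'a bar_word"
  where
    "bar L [] = Empty"
  | "bar L (x # u) = Bar (x +o L) u"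

abbreviation A_rels ::
    "('k::field \<Rightarrow> 'a::ring_1 \<Rightarrow> 'a) \<Rightarrow> (int \<Rightarrow> 'a set) \<Rightarrow> 'a set \<Rightarrow> ('a bar_word \<Rightarrow>\<^sub>0 'k) set"
  where "A_rels sc R L \<equiv> multilinear_rels sc (R 1) (bar L)"

definition A_space ::
    "('k::field \<Rightarrow> 'a::ring_1 \<Rightarrow> 'a) \<Rightarrow> (int \<Rightarrow> 'a set) \<Rightarrow> 'a set \<Rightarrow>
     ('k, ('a bar_word \<Rightarrow>\<^sub>0 'k) set) module"
  where "A_space sc R L = presented (bar L ` lists (R 1)) (A_rels sc R L)"

definition A_degree ::
    "('k::field \<Rightarrow> 'a::ring_1 \<Rightarrow> 'a) \<Rightarrow> (int \<Rightarrow> 'a set) \<Rightarrow> 'a set \<Rightarrow> nat \<Rightarrow>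
     ('a bar_word \<Rightarrow>\<^sub>0 'k) set set"
  where "A_degree sc R L n =
    {p +o free.span (A_rels sc R L) | p.
       Poly_Mapping.keys p \<subseteq> bar L ` {w \<in> lists (R 1). length w = n}}"

definition proj ::
    "('k::field \<Rightarrow> 'a::ring_1 \<Rightarrow> 'a) \<Rightarrow> (int \<Rightarrow> 'a set) \<Rightarrow> 'a set \<Rightarrow>
     ('a list \<Rightarrow>\<^sub>0 'k) set \<Rightarrow> ('a bar_word \<Rightarrow>\<^sub>0 'k) set"
  where "proj sc R L = extend (A_space sc R L) (\<lambda>w. gen_class (A_rels sc R L) (bar L w))"


section \<open>Coproduct and product\<close>

text \<open>Deconcatenation of a pure tensor; the first summand for \<open>Bar \<xi> u\<close> is the one with \<open>j = 0\<close>.\<close>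

fun deconcat ::
    "('k::field \<Rightarrow> 'a::ring_1 \<Rightarrow> 'a) \<Rightarrow> (int \<Rightarrow> 'a set) \<Rightarrow> 'a set \<Rightarrow> 'a bar_word \<Rightarrow>
     (('a bar_word \<Rightarrow>\<^sub>0 'k) set \<times> ('a bar_word \<Rightarrow>\<^sub>0 'k) set \<Rightarrow>\<^sub>0 'k) set"
  where
    "deconcat sc R L Empty =
      (let A = A_space sc R L; g = gen_class (A_rels sc R L)
       in pure_tensor A A (g Empty) (g Empty))"
  | "deconcat sc R L (Bar \<xi> u) =
      (let A = A_space sc R L; g = gen_class (A_rels sc R L)
       in pure_tensor A A (g Empty) (g (Bar \<xi> u)) \<oplus>\<^bsub>tensor A A\<^esub>
          (\<Oplus>\<^bsub>tensor A A\<^esub>i\<in>{..length u}.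
             pure_tensor A A (g (Bar \<xi> (take i u))) (g (bar L (drop i u)))))"

definition A_coproduct ::
    "('k::field \<Rightarrow> 'a::ring_1 \<Rightarrow> 'a) \<Rightarrow> (int \<Rightarrow> 'a set) \<Rightarrow> 'a set \<Rightarrow> ('a bar_word \<Rightarrow>\<^sub>0 'k) set \<Rightarrow>
     (('a bar_word \<Rightarrow>\<^sub>0 'k) set \<times> ('a bar_word \<Rightarrow>\<^sub>0 'k) set \<Rightarrow>\<^sub>0 'k) set"
  where "A_coproduct sc R L =
    extend (tensor (A_space sc R L) (A_space sc R L)) (deconcat sc R L)"

text \<open>\<open>X \<mapsto> x \<otimes> X\<close> on linear combinations of words.\<close>

definition prepend :: "'a \<Rightarrow> ('a list \<Rightarrow>\<^sub>0 'k::field) \<Rightarrow> ('a list \<Rightarrow>\<^sub>0 'k)"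
  where "prepend x p =
    (\<Sum>w\<in>Poly_Mapping.keys p. Poly_Mapping.single (x # w) (Poly_Mapping.lookup p w))"

text \<open>The product \<open>m'\<close> of two words, as a linear combination of words.\<close>

fun quasi_shuffle :: "'a::ring_1 \<Rightarrow> 'a list \<Rightarrow> 'a list \<Rightarrow> ('a list \<Rightarrow>\<^sub>0 'k::field)"
  where
    "quasi_shuffle t [] v = Poly_Mapping.single v 1"
  | "quasi_shuffle t (x # u) [] = Poly_Mapping.single (x # u) 1"
  | "quasi_shuffle t (x # u) (y # v) =
      prepend x (quasi_shuffle t u (y # v)) + prepend y (quasi_shuffle t (x # u) v)
        - prepend (x * y * ring_inverse t) (prepend t (quasi_shuffle t u v))"

definition T_product ::
    "('k::field \<Rightarrow> 'a::ring_1 \<Rightarrow> 'a) \<Rightarrow> (int \<Rightarrow> 'a set) \<Rightarrow> 'a \<Rightarrow>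
     ('a list \<Rightarrow>\<^sub>0 'k) set \<Rightarrow> ('a list \<Rightarrow>\<^sub>0 'k) set \<Rightarrow> ('a list \<Rightarrow>\<^sub>0 'k) set"
  where "T_product sc R t X Y =
    (let T = T_space sc (R 1)
     in extend T (\<lambda>u. extend T (\<lambda>v. quasi_shuffle t u v +o free.span (T_rels sc (R 1))) Y) X)"

definition A_product ::
    "('k::field \<Rightarrow> 'a::ring_1 \<Rightarrow> 'a) \<Rightarrow> (int \<Rightarrow> 'a set) \<Rightarrow> 'a set \<Rightarrow> 'a \<Rightarrow>
     ('a bar_word \<Rightarrow>\<^sub>0 'k) set \<Rightarrow> ('a bar_word \<Rightarrow>\<^sub>0 'k) set \<Rightarrow> ('a bar_word \<Rightarrow>\<^sub>0 'k) set"
  where "A_product sc R L t a b =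
    (THE c. \<forall>X\<in>carrier (T_space sc (R 1)). \<forall>Y\<in>carrier (T_space sc (R 1)).
       proj sc R L X = a \<longrightarrow> proj sc R L Y = b \<longrightarrow> c = proj sc R L (T_product sc R t X Y))"

definition A_algebra ::
    "('k::field \<Rightarrow> 'a::ring_1 \<Rightarrow> 'a) \<Rightarrow> (int \<Rightarrow> 'a set) \<Rightarrow> 'a set \<Rightarrow> 'a \<Rightarrow>
     ('k, ('a bar_word \<Rightarrow>\<^sub>0 'k) set) module"
  where "A_algebra sc R L t =
    (A_space sc R L)\<lparr>monoid.mult := A_product sc R L t, one := gen_class (A_rels sc R L) Empty\<rparr>"

end

theory Submission
  imports Defs
begin

text \<open>
  The construction only depends on the vector space \<open>R\<^sub>1\<close> with the product \<open>m x y = x y t\<^sup>-\<^sup>1\<close>, which is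
  associative with unit \<open>t\<close>, and on the line \<open>k t\<close>. The recursion for the product of words is then that
  of a quasi-shuffle product whose third term is \<open>- m x y \<otimes> t \<otimes> \<dots>\<close>.

  The key identity is \<open>(t \<otimes> X) \<star> Y = t \<otimes> (X \<star> Y) = X \<star> (t \<otimes> Y)\<close> (\<open>pre_unit_qmul\<close>, \<open>qmul_pre_unit\<close>). It
  holds because \<open>t\<close> is the unit of \<open>m\<close>: the last two terms of the recursion cancel. It has three
  consequences. Words that begin with \<open>t\<close> span an ideal, so the product descends from \<open>T(R\<^sub>1)\<close> to
  \<open>A(R)\<close> (\<open>KR_qmul_left\<close>, \<open>A_product_\<gamma>\<close>). The letters \<open>t\<close> produced by the recursion can be collected in
  front of the words, after which associativity is a comparison of terms by induction (\<open>qs_assoc\<close>). And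
  deconcatenation is multiplicative up to tensors whose second factor begins with \<open>t\<close>, which are zero
  in \<open>A(R) \<otimes> A(R)\<close> (\<open>splits_qs\<close>).

  All these identities are proved for formal linear combinations of words, without any relations.
  Besides, the product respects multilinearity (\<open>mrel_qmul\<close>), and \<open>A(R)\<close> is the quotient of the space of
  words by the multilinearity relations and the words that begin with an element of the line
  (\<open>\<gamma>_eq_iff\<close>). The Hopf algebra axioms then follow by linear extension from words. The bialgebra is
  connected and graded, so the antipode is given by a recursion on the length of words; it is
  well-defined on \<open>A(R)\<close> because the recursion respects the relations (\<open>aw_mrel\<close>, \<open>aw_line\<close>), and a
  left inverse for the convolution product is also a right inverse (\<open>antipode_word_eq\<close>).

  If \<open>R\<close> is commutative, the recursion for the product is symmetric. If conversely \<open>A(R)\<close> is commutative,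
  comparing \<open>[x] \<star> [y]\<close> with \<open>[y] \<star> [x]\<close> only shows that the commutators of \<open>m\<close> lie on the line \<open>k t\<close>
  (\<open>commutator_in_line\<close>). They vanish nevertheless: if \<open>[x, y] = c t\<close>, then \<open>[x, m y x] = c x\<close> also lies
  on the line, and for \<open>c \<noteq> 0\<close> this would make \<open>x\<close> central (\<open>commutative_letters\<close>). Since every
  homogeneous element of \<open>R\<close> is an element of \<open>R\<^sub>1\<close> times a power of \<open>t\<close>, all of \<open>R\<close> is commutative.
\<close>

section \<open>Linear maps and linear combinations\<close>

notation free_scale (infixr \<open>*\<^sub>F\<close> 75)

abbreviation gen :: "'x \<Rightarrow> ('x \<Rightarrow>\<^sub>0 'k::field)"
  where "gen s \<equiv> Poly_Mapping.single s 1"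

lemma single_eq_scale_gen: "Poly_Mapping.single s c = c *\<^sub>F gen s"
  by (rule poly_mapping_eqI) (simp add: lookup_free_scale lookup_single when_def)

lemma free_scale_single: "c *\<^sub>F Poly_Mapping.single s d = Poly_Mapping.single s (c * d)"
  by (rule poly_mapping_eqI) (simp add: lookup_free_scale lookup_single when_def)

lemma sum_gens: "p = (\<Sum>s\<in>Poly_Mapping.keys p. Poly_Mapping.lookup p s *\<^sub>F gen s)"
  by (rule poly_mapping_eqI)
    (auto simp: lookup_sum free_scale_single lookup_single when_def not_in_keys_iff_lookup_eq_zero)

text \<open>Packaged as a module, so that maps out of a free space and maps out of its quotients are both
  instances of \<^const>\<open>lin_map\<close>.\<close>

definition Free :: "'x set \<Rightarrow> ('k::field, 'x \<Rightarrow>\<^sub>0 'k) module"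
  where "Free S =
    \<lparr>carrier = {p. Poly_Mapping.keys p \<subseteq> S}, monoid.mult = undefined, one = undefined,
     zero = 0, add = (+), module.smult = free_scale\<rparr>"

lemma Free_simps [simp]:
  "\<zero>\<^bsub>Free S\<^esub> = 0" "p \<oplus>\<^bsub>Free S\<^esub> q = p + q" "c \<odot>\<^bsub>Free S\<^esub> p = c *\<^sub>F p"
  by (simp_all add: Free_def)

lemma carrier_Free: "p \<in> carrier (Free S) \<longleftrightarrow> Poly_Mapping.keys p \<subseteq> S"
  by (simp add: Free_def)

lemma Free_mono: "\<lbrakk>p \<in> carrier (Free S); S \<subseteq> S'\<rbrakk> \<Longrightarrow> p \<in> carrier (Free S')"
  by (auto simp: carrier_Free)

lemma Free_UNIV [simp]: "p \<in> carrier (Free UNIV)"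
  by (simp add: carrier_Free)

lemma Free_0 [simp]: "0 \<in> carrier (Free S)"
  by (simp add: carrier_Free)

lemma Free_add [simp]: "\<lbrakk>p \<in> carrier (Free S); q \<in> carrier (Free S)\<rbrakk> \<Longrightarrow> p + q \<in> carrier (Free S)"
  using Poly_Mapping.keys_add[of p q] by (auto simp: carrier_Free)

lemma Free_scale [simp]: "p \<in> carrier (Free S) \<Longrightarrow> c *\<^sub>F p \<in> carrier (Free S)"
  by (auto simp: carrier_Free in_keys_iff lookup_free_scale subset_iff)

lemma Free_diff [simp]: "\<lbrakk>p \<in> carrier (Free S); q \<in> carrier (Free S)\<rbrakk> \<Longrightarrow> p - q \<in> carrier (Free S)"
  using keys_diff[of p q] by (auto simp: carrier_Free)

lemma Free_uminus [simp]: "p \<in> carrier (Free S) \<Longrightarrow> - p \<in> carrier (Free S)"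
  using Free_diff[of 0 S p] by simp

lemma Free_single [simp]: "s \<in> S \<Longrightarrow> Poly_Mapping.single s c \<in> carrier (Free S)"
  by (simp add: carrier_Free)

lemma Free_sum [intro]: "(\<And>i. i \<in> I \<Longrightarrow> f i \<in> carrier (Free S)) \<Longrightarrow> sum f I \<in> carrier (Free S)"
  by (induction I rule: infinite_finite_induct) auto

lemma subspace_Free: "free.subspace (carrier (Free S))"
  by (rule free.subspaceI) auto

lemma span_Free: "Q \<subseteq> carrier (Free S) \<Longrightarrow> free.span Q \<subseteq> carrier (Free S)"
  by (rule free.span_minimal[OF _ subspace_Free])

lemma free_induct [consumes 1, case_names zero step]:
  assumes "p \<in> carrier (Free S)"
    and "P 0"
    and "\<And>c s q. \<lbrakk>s \<in> S; q \<in> carrier (Free S); P q\<rbrakk> \<Longrightarrow> P (c *\<^sub>F gen s + q)"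
  shows "P p"
proof -
  have "P (\<Sum>s\<in>K. Poly_Mapping.lookup p s *\<^sub>F gen s)" if "finite K" "K \<subseteq> S" for K
    using that
  proof (induction K rule: finite_induct)
    case empty
    show ?case using assms(2) by simp
  next
    case (insert s K)
    then show ?case by (auto intro!: assms(3) Free_sum)
  qed
  from this[of "Poly_Mapping.keys p"] show ?thesis
    using assms(1) by (subst sum_gens) (simp add: carrier_Free)
qed

locale vspace = Module.module ring_of_type_algebra P
  for P :: "('k::field, 'v) module" (structure)
begin

lemma scale_closed [simp]: "x \<in> carrier P \<Longrightarrow> c \<odot> x \<in> carrier P"
  and scale_add_left: "x \<in> carrier P \<Longrightarrow> (c + d) \<odot> x = c \<odot> x \<oplus> d \<odot> x"
  and scale_add_right: "\<lbrakk>x \<in> carrier P; y \<in> carrier P\<rbrakk> \<Longrightarrow> c \<odot> (x \<oplus> y) = c \<odot> x \<oplus> c \<odot> y"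
  and scale_scale: "x \<in> carrier P \<Longrightarrow> c \<odot> (d \<odot> x) = (c * d) \<odot> x"
  and scale_one: "x \<in> carrier P \<Longrightarrow> 1 \<odot> x = x"
  and scale_zero_left: "x \<in> carrier P \<Longrightarrow> 0 \<odot> x = \<zero>"
  and scale_zero_right: "c \<odot> \<zero> = \<zero>"
  using smult_closed[of c x] smult_l_distr[of c d x] smult_r_distr[of c x y] smult_assoc1[of c d x]
    smult_one[of x] smult_l_null[of x] smult_r_null[of c]
  by (simp_all add: ring_of_type_algebra_def)

end

lemma vspaceI:
  fixes P :: "('k::field, 'v) module" (structure)
  assumes "\<And>x y. \<lbrakk>x \<in> carrier P; y \<in> carrier P\<rbrakk> \<Longrightarrow> x \<oplus> y \<in> carrier P"
    and "\<zero> \<in> carrier P"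
    and "\<And>c x. x \<in> carrier P \<Longrightarrow> c \<odot> x \<in> carrier P"
    and "\<And>x y z. \<lbrakk>x \<in> carrier P; y \<in> carrier P; z \<in> carrier P\<rbrakk> \<Longrightarrow> x \<oplus> y \<oplus> z = x \<oplus> (y \<oplus> z)"
    and "\<And>x y. \<lbrakk>x \<in> carrier P; y \<in> carrier P\<rbrakk> \<Longrightarrow> x \<oplus> y = y \<oplus> x"
    and "\<And>x. x \<in> carrier P \<Longrightarrow> \<zero> \<oplus> x = x"
    and "\<And>c d x. x \<in> carrier P \<Longrightarrow> (c + d) \<odot> x = c \<odot> x \<oplus> d \<odot> x"
    and "\<And>c x y. \<lbrakk>x \<in> carrier P; y \<in> carrier P\<rbrakk> \<Longrightarrow> c \<odot> (x \<oplus> y) = c \<odot> x \<oplus> c \<odot> y"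
    and "\<And>c d x. x \<in> carrier P \<Longrightarrow> (c * d) \<odot> x = c \<odot> (d \<odot> x)"
    and "\<And>x. x \<in> carrier P \<Longrightarrow> 1 \<odot> x = x"
    and "\<And>x. x \<in> carrier P \<Longrightarrow> 0 \<odot> x = \<zero>"
  shows "vspace P"
proof -
  have "\<exists>y\<in>carrier P. y \<oplus> x = \<zero>" if "x \<in> carrier P" for x
    using assms(7)[of x "-1" 1] assms(10,11)[of x] assms(3)[of x "-1"] that by auto
  then have "abelian_group P"
    by (intro abelian_groupI) (use assms in auto)
  moreover have "cring (ring_of_type_algebra :: 'k ring)"
    by (rule cring_from_type_algebra)
  ultimately show ?thesis
    unfolding vspace_def
    by (intro moduleI) (use assms in \<open>auto simp: ring_of_type_algebra_def\<close>)
qed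

lemma vspace_Free [simp]: "vspace (Free S)"
  by (rule vspaceI) (auto simp: algebra_simps free.scale_left_distrib free.scale_right_distrib)

lemma lin_mapD:
  assumes "lin_map M N f"
  shows "x \<in> carrier M \<Longrightarrow> f x \<in> carrier N"
    and "\<lbrakk>x \<in> carrier M; y \<in> carrier M\<rbrakk> \<Longrightarrow> f (x \<oplus>\<^bsub>M\<^esub> y) = f x \<oplus>\<^bsub>N\<^esub> f y"
    and "x \<in> carrier M \<Longrightarrow> f (c \<odot>\<^bsub>M\<^esub> x) = c \<odot>\<^bsub>N\<^esub> f x"
  using assms unfolding lin_map_def by auto

lemma lin_mapI:
  assumes "\<And>x. x \<in> carrier M \<Longrightarrow> f x \<in> carrier N"
    and "\<And>x y. \<lbrakk>x \<in> carrier M; y \<in> carrier M\<rbrakk> \<Longrightarrow> f (x \<oplus>\<^bsub>M\<^esub> y) = f x \<oplus>\<^bsub>N\<^esub> f y"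
    and "\<And>c x. x \<in> carrier M \<Longrightarrow> f (c \<odot>\<^bsub>M\<^esub> x) = c \<odot>\<^bsub>N\<^esub> f x"
  shows "lin_map M N f"
  using assms unfolding lin_map_def by auto

lemma lin_map_comp: "\<lbrakk>lin_map M N f; lin_map N P g\<rbrakk> \<Longrightarrow> lin_map M P (\<lambda>x. g (f x))"
  by (rule lin_mapI) (simp_all add: lin_mapD)

lemma lin_map_id: "lin_map M M (\<lambda>x. x)"
  by (rule lin_mapI) simp_all

lemma lin_map_zero:
  assumes "vspace M" "vspace N" "lin_map M N f"
  shows "f \<zero>\<^bsub>M\<^esub> = \<zero>\<^bsub>N\<^esub>"
proof -
  interpret M: vspace M by fact
  interpret N: vspace N by fact
  have "f (0 \<odot>\<^bsub>M\<^esub> \<zero>\<^bsub>M\<^esub>) = 0 \<odot>\<^bsub>N\<^esub> f \<zero>\<^bsub>M\<^esub>"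
    using assms(3) by (rule lin_mapD) simp
  then show ?thesis
    using lin_mapD(1)[OF assms(3)] by (simp add: M.scale_zero_left N.scale_zero_left)
qed

lemma lin_map_Free_0: "\<lbrakk>vspace P; lin_map (Free S) P f\<rbrakk> \<Longrightarrow> f 0 = \<zero>\<^bsub>P\<^esub>"
  using lin_map_zero[OF vspace_Free] by fastforce

lemma lin_map_finsum:
  assumes "vspace M" "vspace N" "lin_map M N f" and g: "g \<in> I \<rightarrow> carrier M"
  shows "f (\<Oplus>\<^bsub>M\<^esub>i\<in>I. g i) = (\<Oplus>\<^bsub>N\<^esub>i\<in>I. f (g i))"
proof -
  interpret M: vspace M by fact
  interpret N: vspace N by fact
  note f = lin_mapD[OF assms(3)]
  from g show ?thesis
  proof (induction I rule: infinite_finite_induct)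
    case (insert i I)
    then show ?case by (simp add: f Pi_iff)
  qed (use lin_map_zero[OF assms(1-3)] in auto)
qed

lemma finsum_Free: "g \<in> I \<rightarrow> carrier (Free S) \<Longrightarrow> (\<Oplus>\<^bsub>Free S\<^esub>i\<in>I. g i) = sum g I"
proof -
  interpret F: vspace "Free S" by simp
  show "g \<in> I \<rightarrow> carrier (Free S) \<Longrightarrow> (\<Oplus>\<^bsub>Free S\<^esub>i\<in>I. g i) = sum g I"
    by (induction I rule: infinite_finite_induct) auto
qed

lemma lin_map_sum:
  assumes "vspace P" "lin_map (Free S) P f" "\<And>i. i \<in> I \<Longrightarrow> g i \<in> carrier (Free S)"
  shows "f (\<Sum>i\<in>I. g i) = (\<Oplus>\<^bsub>P\<^esub>i\<in>I. f (g i))"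
proof -
  have g: "g \<in> I \<rightarrow> carrier (Free S)" using assms(3) by blast
  show ?thesis
    using lin_map_finsum[OF vspace_Free assms(1,2) g] finsum_Free[OF g] by simp
qed

text \<open>Almost every identity between linear maps is reduced to generators by this lemma and its analogues
  for quotients and tensor products.\<close>

lemma lin_map_Free_ext:
  assumes "vspace P" "lin_map (Free S) P f" "lin_map (Free S) P g"
    and "\<And>s. s \<in> S \<Longrightarrow> f (gen s) = g (gen s)"
    and "p \<in> carrier (Free S)"
  shows "f p = g p"
  using assms(5)
proof (induction p rule: free_induct)
  case zero
  show ?case using lin_map_Free_0[OF assms(1)] assms(2,3) by metis
next
  case (step c s q)
  then show ?case
    using lin_mapD(2,3)[OF assms(2), unfolded Free_simps] lin_mapD(2,3)[OF assms(3), unfolded Free_simps]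
      assms(4)
    by simp
qed

text \<open>The universal property of \<open>Free\<close>: the linear map that extends \<open>f\<close>. The map
  \<^const>\<open>extend\<close> is this one, applied to a representative of a coset.\<close>

definition lincomb :: "('k::field, 'p, 'm) module_scheme \<Rightarrow> ('x \<Rightarrow> 'p) \<Rightarrow> ('x \<Rightarrow>\<^sub>0 'k) \<Rightarrow> 'p"
  where "lincomb P f p = (\<Oplus>\<^bsub>P\<^esub>s\<in>Poly_Mapping.keys p. Poly_Mapping.lookup p s \<odot>\<^bsub>P\<^esub> f s)"

lemma extend_lincomb: "extend P f X = lincomb P f (SOME p. p \<in> X)"
  by (simp add: extend_def lincomb_def Let_def)

context vspace
begin

lemma lincomb_superset:
  assumes "f \<in> S \<rightarrow> carrier P" "finite K" "Poly_Mapping.keys p \<subseteq> K" "K \<subseteq> S"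
  shows "lincomb P f p = (\<Oplus>s\<in>K. Poly_Mapping.lookup p s \<odot> f s)"
  unfolding lincomb_def
  by (rule add.finprod_mono_neutral_cong_left)
    (use assms in \<open>auto simp: Pi_iff not_in_keys_iff_lookup_eq_zero scale_zero_left subset_iff\<close>)

lemma lin_map_lincomb:
    fixes f :: "'b \<Rightarrow> 'v"
  assumes f: "f \<in> S \<rightarrow> carrier P"
  shows "lin_map (Free S) P (lincomb P f)"
proof (rule lin_mapI)
  fix p q :: "'b \<Rightarrow>\<^sub>0 'k" and c
  assume p: "p \<in> carrier (Free S)"
  show "lincomb P f p \<in> carrier P"
    unfolding lincomb_def using p f by (intro finsum_closed) (auto simp: carrier_Free Pi_iff)
  let ?K = "Poly_Mapping.keys p"
  have "lincomb P f (c *\<^sub>F p) = (\<Oplus>s\<in>?K. c \<odot> (Poly_Mapping.lookup p s \<odot> f s))"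
    by (subst lincomb_superset[OF f, of ?K], use p f in \<open>auto simp: carrier_Free in_keys_iff lookup_free_scale Pi_iff\<close>)
      (intro finsum_cong', auto simp: scale_scale carrier_Free subset_iff in_keys_iff Pi_iff)
  also have "\<dots> = c \<odot> lincomb P f p"
    unfolding lincomb_def
    by (rule lin_map_finsum[symmetric, of P P "(\<odot>) c"])
      (use p f in \<open>auto intro!: vspace_axioms lin_mapI simp: scale_add_right scale_scale mult.commute carrier_Free Pi_iff\<close>)
  finally show "lincomb P f (c \<odot>\<^bsub>Free S\<^esub> p) = c \<odot> lincomb P f p" by simp
  assume q: "q \<in> carrier (Free S)"
  let ?L = "Poly_Mapping.keys p \<union> Poly_Mapping.keys q"
  have L: "?L \<subseteq> S" using p q by (simp add: carrier_Free)
  have "lincomb P f (p + q) = (\<Oplus>s\<in>?L. Poly_Mapping.lookup p s \<odot> f s \<oplus> Poly_Mapping.lookup q s \<odot> f s)"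
    by (subst lincomb_superset[OF f, of ?L], use L Poly_Mapping.keys_add[of p q] in auto)
      (intro finsum_cong', use f L in \<open>auto simp: lookup_add scale_add_left Pi_iff subset_iff\<close>)
  also have "\<dots> = lincomb P f p \<oplus> lincomb P f q"
    by (subst finsum_addf, use f L in \<open>auto simp: Pi_iff subset_iff\<close>)
      (subst (1 2) lincomb_superset[OF f, of ?L], use L in auto)
  finally show "lincomb P f (p \<oplus>\<^bsub>Free S\<^esub> q) = lincomb P f p \<oplus> lincomb P f q" by simp
qed

lemma lincomb_single: "f s \<in> carrier P \<Longrightarrow> lincomb P f (Poly_Mapping.single s c) = c \<odot> f s"
  by (subst lincomb_superset[of f "{s}" "{s}"]) auto

lemma lincomb_gen [simp]: "f s \<in> carrier P \<Longrightarrow> lincomb P f (gen s) = f s"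
  by (simp add: lincomb_single scale_one)

end

lemma lin_map_lincomb':
  "\<lbrakk>vspace P; \<And>s. s \<in> S \<Longrightarrow> f s \<in> carrier P\<rbrakk> \<Longrightarrow> lin_map (Free S) P (lincomb P f)"
  by (rule vspace.lin_map_lincomb) auto

lemma lincomb_cong:
  "\<lbrakk>vspace P; \<And>s. s \<in> S \<Longrightarrow> f s = g s\<rbrakk> \<Longrightarrow>
     \<lbrakk>\<And>s. s \<in> S \<Longrightarrow> g s \<in> carrier P\<rbrakk> \<Longrightarrow> p \<in> carrier (Free S) \<Longrightarrow> lincomb P f p = lincomb P g p"
  by (rule lin_map_Free_ext) (auto intro!: lin_map_lincomb' simp: vspace.lincomb_gen)

lemma lin_map_comp_lincomb:
  assumes "vspace M" "vspace P" "lin_map M P \<phi>" "\<And>s. s \<in> S \<Longrightarrow> f s \<in> carrier M" "p \<in> carrier (Free S)"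
  shows "\<phi> (lincomb M f p) = lincomb P (\<lambda>s. \<phi> (f s)) p"
  by (rule lin_map_Free_ext[OF assms(2) lin_map_comp[OF lin_map_lincomb' assms(3)] lin_map_lincomb' _ assms(5)])
    (use assms in \<open>auto simp: lin_mapD[OF assms(3)] vspace.lincomb_gen\<close>)

section \<open>Linear extension between spaces of formal linear combinations\<close>

text \<open>The case of \<^const>\<open>lincomb\<close> in which the target is itself free. Addition in the target is then
  that of a type class, and the linearity laws hold without side conditions.\<close>

definition lin :: "('x \<Rightarrow> ('y \<Rightarrow>\<^sub>0 'k::field)) \<Rightarrow> ('x \<Rightarrow>\<^sub>0 'k) \<Rightarrow> ('y \<Rightarrow>\<^sub>0 'k)"
  where "lin F = lincomb (Free UNIV) F"

lemma lin_map_lin: "lin_map (Free UNIV) (Free UNIV) (lin F)"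
  unfolding lin_def by (rule lin_map_lincomb') auto

lemma lin_add [simp]: "lin F (p + q) = lin F p + lin F q"
  and lin_scale [simp]: "lin F (c *\<^sub>F p) = c *\<^sub>F lin F p"
  and lin_zero [simp]: "lin F 0 = 0"
  and lin_gen [simp]: "lin F (gen s) = F s"
  using lin_mapD[OF lin_map_lin[of F]] lin_map_Free_0[OF _ lin_map_lin[of F]]
    vspace.lincomb_gen[of "Free UNIV" F s]
  by (auto simp: lin_def)

lemma lin_uminus [simp]: "lin F (- p) = - lin F p"
  using lin_scale[of F "-1" p] by simp

lemma lin_diff [simp]: "lin F (p - q) = lin F p - lin F q"
  using lin_add[of F p "- q"] by simp

lemma lin_sum [simp]: "lin F (\<Sum>i\<in>I. g i) = (\<Sum>i\<in>I. lin F (g i))"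
  by (induction I rule: infinite_finite_induct) simp_all

lemma lin_single: "lin F (Poly_Mapping.single s c) = c *\<^sub>F F s"
  by (subst single_eq_scale_gen) simp

lemma lin_closed: "\<lbrakk>\<And>s. s \<in> S \<Longrightarrow> F s \<in> carrier (Free S'); p \<in> carrier (Free S)\<rbrakk> \<Longrightarrow> lin F p \<in> carrier (Free S')"
  by (erule free_induct) simp_all

lemma lin_map_lin_Free: "(\<And>s. s \<in> S \<Longrightarrow> F s \<in> carrier (Free S')) \<Longrightarrow> lin_map (Free S) (Free S') (lin F)"
  by (rule lin_mapI) (simp_all add: lin_closed[of S F S'])

lemma lin_cong: "\<lbrakk>\<And>s. s \<in> S \<Longrightarrow> F s = G s; p \<in> carrier (Free S)\<rbrakk> \<Longrightarrow> lin F p = lin G p"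
  by (erule free_induct) simp_all

lemma lin_in_subspace:
  "\<lbrakk>free.subspace U; \<And>s. s \<in> S \<Longrightarrow> F s \<in> U; p \<in> carrier (Free S)\<rbrakk> \<Longrightarrow> lin F p \<in> U"
  by (erule free_induct) (auto simp: free.subspace_0 free.subspace_add free.subspace_scale)

lemma lin_lin: "lin F (lin G p) = lin (\<lambda>s. lin F (G s)) p"
  by (induction p rule: free_induct[OF Free_UNIV]) simp_all

lemma lin_gen_id [simp]: "lin gen p = p"
  by (induction p rule: free_induct[OF Free_UNIV]) simp_all

lemma lin_fun_add: "lin (\<lambda>s. F s + G s) p = lin F p + lin G p"
  by (induction p rule: free_induct[OF Free_UNIV]) (simp_all add: free.scale_right_distrib)

lemma lin_fun_diff: "lin (\<lambda>s. F s - G s) p = lin F p - lin G p"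
  by (induction p rule: free_induct[OF Free_UNIV]) (simp_all add: free.scale_right_diff_distrib)

lemma lin_fun_scale: "lin (\<lambda>s. c *\<^sub>F F s) p = c *\<^sub>F lin F p"
  by (induction p rule: free_induct[OF Free_UNIV])
    (simp_all add: free.scale_right_distrib mult.commute)

lemma lin_fun_zero [simp]: "lin (\<lambda>s. 0) p = 0"
  by (induction p rule: free_induct[OF Free_UNIV]) simp_all

lemma span_lin_image:
  assumes "\<And>q. q \<in> Q \<Longrightarrow> lin F q \<in> free.span Q'" "p \<in> free.span Q"
  shows "lin F p \<in> free.span Q'"
  using assms(2)
  by (induction p rule: free.span_induct_alt)
    (auto intro: free.span_add free.span_scale free.span_zero assms(1))

lemma lincomb_lin:
  assumes "vspace P" "\<And>s. s \<in> S' \<Longrightarrow> f s \<in> carrier P" "\<And>s. s \<in> S \<Longrightarrow> F s \<in> carrier (Free S')"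
    "p \<in> carrier (Free S)"
  shows "lincomb P f (lin F p) = lincomb P (\<lambda>s. lincomb P f (F s)) p"
proof -
  note f = lin_map_lincomb'[OF assms(1,2)]
  have F: "lincomb P f (F s) \<in> carrier P" if "s \<in> S" for s
    by (rule lin_mapD(1)[OF f assms(3)[OF that]])
  show ?thesis
    by (rule lin_map_Free_ext[OF assms(1) lin_map_comp[OF lin_map_lin_Free f] lin_map_lincomb' _ assms(4)])
      (use assms(1,3) F in \<open>auto simp: vspace.lincomb_gen\<close>)
qed

lemma lincomb_lin_map:
  assumes "vspace P" "lin_map (Free S') P \<phi>" "\<And>s. s \<in> S \<Longrightarrow> F s \<in> carrier (Free S')"
    "p \<in> carrier (Free S)"
  shows "lincomb P (\<lambda>s. \<phi> (F s)) p = \<phi> (lin F p)"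
proof -
  have F: "\<phi> (F s) \<in> carrier P" if "s \<in> S" for s
    by (rule lin_mapD(1)[OF assms(2) assms(3)[OF that]])
  show ?thesis
    by (rule lin_map_Free_ext[OF assms(1) lin_map_lincomb' lin_map_comp[OF lin_map_lin_Free assms(2)] _ assms(4)])
      (use assms(1,3) F in \<open>auto simp: vspace.lincomb_gen\<close>)
qed

text \<open>The tensor \<open>p \<otimes> q\<close>, for the tensor product of two free spaces realized as the free space on
  pairs of generators.\<close>

definition pt :: "('x \<Rightarrow>\<^sub>0 'k::field) \<Rightarrow> ('y \<Rightarrow>\<^sub>0 'k) \<Rightarrow> ('x \<times> 'y \<Rightarrow>\<^sub>0 'k)"
  where "pt p q = lin (\<lambda>u. lin (\<lambda>v. gen (u, v)) q) p"

lemma pt_simps [simp]: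
  "pt (p + p') q = pt p q + pt p' q" "pt p (q + q') = pt p q + pt p q'"
  "pt (p - p') q = pt p q - pt p' q" "pt p (q - q') = pt p q - pt p q'"
  "pt (- p) q = - pt p q" "pt p (- q) = - pt p q"
  "pt (c *\<^sub>F p) q = c *\<^sub>F pt p q" "pt p (c *\<^sub>F q) = c *\<^sub>F pt p q"
  "pt 0 q = 0" "pt p 0 = 0" "pt (gen u) (gen v) = gen (u, v)"
  "pt (sum f I) q = (\<Sum>i\<in>I. pt (f i) q)"
proof -
  show "pt p (- q) = - pt p q"
    using lin_fun_diff[of "\<lambda>_. 0" "\<lambda>u. lin (\<lambda>v. gen (u, v)) q" p] by (simp add: pt_def)
qed (simp_all add: pt_def lin_fun_add lin_fun_diff lin_fun_scale)

lemma pt_closed: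
  "\<lbrakk>p \<in> carrier (Free S); q \<in> carrier (Free S')\<rbrakk> \<Longrightarrow> pt p q \<in> carrier (Free (S \<times> S'))"
  unfolding pt_def by (intro lin_closed[of S]) (auto intro: lin_closed[of S'])

section \<open>Spaces given by generators and relations\<close>

lemma mem_coset: "q \<in> p +o free.span Q \<longleftrightarrow> q - p \<in> free.span Q"
  by (auto simp: elt_set_plus_def algebra_simps intro!: bexI[of _ "q - p"])

lemma coset_eq_iff: "p +o free.span Q = q +o free.span Q \<longleftrightarrow> p - q \<in> free.span Q"
proof
  assume "p +o free.span Q = q +o free.span Q"
  moreover have "p \<in> p +o free.span Q" by (simp add: mem_coset free.span_zero)
  ultimately show "p - q \<in> free.span Q" by (simp add: mem_coset)
next
  assume *: "p - q \<in> free.span Q"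
  have "x - p \<in> free.span Q \<longleftrightarrow> x - q \<in> free.span Q" for x
    using free.span_add_eq[OF *, of "x - p"] by (simp add: algebra_simps)
  then show "p +o free.span Q = q +o free.span Q" by (auto simp: mem_coset)
qed

lemma coset_add: "(p +o free.span Q) + (q +o free.span Q) = (p + q) +o free.span Q"
proof (rule Set.set_eqI)
  fix x
  show "x \<in> (p +o free.span Q) + (q +o free.span Q) \<longleftrightarrow> x \<in> (p + q) +o free.span Q"
  proof
    assume "x \<in> (p +o free.span Q) + (q +o free.span Q)"
    then obtain a b where "x = (p + a) + (q + b)" "a \<in> free.span Q" "b \<in> free.span Q"
      by (auto simp: set_plus_def elt_set_plus_def)
    then show "x \<in> (p + q) +o free.span Q"
      by (auto simp: mem_coset algebra_simps free.span_add)
  next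
    assume "x \<in> (p + q) +o free.span Q"
    then have "x - q \<in> p +o free.span Q" by (simp add: mem_coset algebra_simps)
    moreover have "q \<in> q +o free.span Q" by (simp add: mem_coset free.span_zero)
    ultimately have "(x - q) + q \<in> (p +o free.span Q) + (q +o free.span Q)"
      by (rule set_plus_intro)
    then show "x \<in> (p +o free.span Q) + (q +o free.span Q)" by simp
  qed
qed

lemma coset_scale: "free_scale c ` (p +o free.span Q) + free.span Q = (c *\<^sub>F p) +o free.span Q"
proof (rule Set.set_eqI)
  fix x
  show "x \<in> free_scale c ` (p +o free.span Q) + free.span Q \<longleftrightarrow> x \<in> (c *\<^sub>F p) +o free.span Q"
  proof
    assume "x \<in> free_scale c ` (p +o free.span Q) + free.span Q"
    then obtain a b where "x = c *\<^sub>F (p + a) + b" "a \<in> free.span Q" "b \<in> free.span Q"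
      by (auto simp: set_plus_def elt_set_plus_def)
    then show "x \<in> (c *\<^sub>F p) +o free.span Q"
      by (auto simp: mem_coset free.scale_right_distrib free.span_add free.span_scale)
  next
    assume "x \<in> (c *\<^sub>F p) +o free.span Q"
    then have "c *\<^sub>F p + (x - c *\<^sub>F p) \<in> free_scale c ` (p +o free.span Q) + free.span Q"
      by (intro set_plus_intro imageI) (auto simp: mem_coset free.span_zero)
    then show "x \<in> free_scale c ` (p +o free.span Q) + free.span Q" by simp
  qed
qed

lemma carrier_presented:
  "X \<in> carrier (presented S Q) \<longleftrightarrow> (\<exists>p\<in>carrier (Free S). X = p +o free.span Q)"
  by (auto simp: presented_def carrier_Free)

lemma presented_simps:
  "\<zero>\<^bsub>presented S Q\<^esub> = 0 +o free.span Q"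
  "(p +o free.span Q) \<oplus>\<^bsub>presented S Q\<^esub> (q +o free.span Q) = (p + q) +o free.span Q"
  "c \<odot>\<^bsub>presented S Q\<^esub> (p +o free.span Q) = (c *\<^sub>F p) +o free.span Q"
  by (simp_all add: presented_def coset_add coset_scale)

lemma lin_map_coset: "lin_map (Free S) (presented S Q) (\<lambda>p. p +o free.span Q)"
  by (rule lin_mapI) (auto simp: presented_simps carrier_presented)

lemma vspace_presented [simp]: "vspace (presented S Q)"
  by (rule vspaceI)
    (auto simp: carrier_presented presented_simps algebra_simps
      free.scale_left_distrib free.scale_right_distrib simp del: set_zero_plus)

lemma gen_class_closed: "s \<in> S \<Longrightarrow> gen_class Q s \<in> carrier (presented S Q)"
  by (auto simp: gen_class_def carrier_presented)

lemma lin_map_vanishes_on_span: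
  assumes "vspace P" "lin_map (Free S) P \<phi>" "Q \<subseteq> carrier (Free S)"
    and "\<And>q. q \<in> Q \<Longrightarrow> \<phi> q = \<zero>\<^bsub>P\<^esub>" and "q \<in> free.span Q"
  shows "\<phi> q = \<zero>\<^bsub>P\<^esub>"
proof -
  interpret P: vspace P by fact
  note phi = lin_mapD[OF assms(2), unfolded Free_simps]
  have "q \<in> carrier (Free S) \<and> \<phi> q = \<zero>\<^bsub>P\<^esub>"
    using assms(5)
  proof (induction q rule: free.span_induct_alt)
    case base
    show ?case using lin_map_Free_0[OF assms(1,2)] by simp
  next
    case (step c x y)
    then show ?case using assms(3,4) phi by (auto simp: P.scale_zero_right)
  qed
  then show ?thesis ..
qed

lemma lin_map_eq_mod_span:
  assumes "vspace P" "lin_map (Free S) P \<phi>" "Q \<subseteq> carrier (Free S)"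
    and "\<And>q. q \<in> Q \<Longrightarrow> \<phi> q = \<zero>\<^bsub>P\<^esub>"
    and "p - q \<in> free.span Q" "q \<in> carrier (Free S)"
  shows "\<phi> p = \<phi> q"
proof -
  interpret P: vspace P by fact
  note phi = lin_mapD[OF assms(2), unfolded Free_simps]
  have "p - q \<in> carrier (Free S)" using assms(3,5) span_Free by blast
  then have "\<phi> (q + (p - q)) = \<phi> q \<oplus>\<^bsub>P\<^esub> \<phi> (p - q)" using assms(6) by (intro phi)
  also have "\<phi> (p - q) = \<zero>\<^bsub>P\<^esub>" by (rule lin_map_vanishes_on_span[OF assms(1-5)])
  finally show ?thesis using assms(6) phi by simp
qed

text \<open>Two representatives of a coset differ by an element of the span of \<open>Q\<close>, which the linear extension
  of \<open>f\<close> kills; so the choice made by \<^const>\<open>extend\<close> is immaterial.\<close>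

lemma extend_coset:
  assumes "vspace P" "\<And>s. s \<in> S \<Longrightarrow> f s \<in> carrier P" "Q \<subseteq> carrier (Free S)"
    and "\<And>q. q \<in> Q \<Longrightarrow> lincomb P f q = \<zero>\<^bsub>P\<^esub>" and "p \<in> carrier (Free S)"
  shows "extend P f (p +o free.span Q) = lincomb P f p"
proof -
  have "(SOME q. q \<in> p +o free.span Q) \<in> p +o free.span Q"
    by (rule someI[of _ p]) (simp add: mem_coset free.span_zero)
  then show ?thesis
    unfolding extend_lincomb mem_coset
    by (intro lin_map_eq_mod_span[OF assms(1) lin_map_lincomb' assms(3)])
      (use assms in auto)
qed

lemma lin_map_extend:
  assumes "vspace P" "\<And>s. s \<in> S \<Longrightarrow> f s \<in> carrier P" "Q \<subseteq> carrier (Free S)"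
    and "\<And>q. q \<in> Q \<Longrightarrow> lincomb P f q = \<zero>\<^bsub>P\<^esub>"
  shows "lin_map (presented S Q) P (extend P f)"
proof (rule lin_mapI)
  note L = lin_mapD[OF lin_map_lincomb'[OF assms(1,2)], unfolded Free_simps]
  note E = extend_coset[OF assms]
  fix X c
  assume "X \<in> carrier (presented S Q)"
  then obtain p where p: "X = p +o free.span Q" "p \<in> carrier (Free S)"
    by (auto simp: carrier_presented)
  show "extend P f X \<in> carrier P" using p by (simp add: E L)
  show "extend P f (c \<odot>\<^bsub>presented S Q\<^esub> X) = c \<odot>\<^bsub>P\<^esub> extend P f X"
    using p by (simp add: E L presented_simps)
  fix Y
  assume "Y \<in> carrier (presented S Q)"
  then obtain q where q: "Y = q +o free.span Q" "q \<in> carrier (Free S)"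
    by (auto simp: carrier_presented)
  show "extend P f (X \<oplus>\<^bsub>presented S Q\<^esub> Y) = extend P f X \<oplus>\<^bsub>P\<^esub> extend P f Y"
    using p q by (simp add: E L presented_simps)
qed

lemma extend_gen_class:
  assumes "vspace P" "\<And>s. s \<in> S \<Longrightarrow> f s \<in> carrier P" "Q \<subseteq> carrier (Free S)"
    and "\<And>q. q \<in> Q \<Longrightarrow> lincomb P f q = \<zero>\<^bsub>P\<^esub>" and "s \<in> S"
  shows "extend P f (gen_class Q s) = f s"
  unfolding gen_class_def
  by (subst extend_coset[OF assms(1-4)]) (use assms in \<open>auto simp: vspace.lincomb_gen\<close>)

lemma lin_map_presented_ext:
  assumes "vspace P" "lin_map (presented S Q) P \<phi>" "lin_map (presented S Q) P \<psi>"
    and "\<And>s. s \<in> S \<Longrightarrow> \<phi> (gen_class Q s) = \<psi> (gen_class Q s)"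
    and "X \<in> carrier (presented S Q)"
  shows "\<phi> X = \<psi> X"
proof -
  obtain p where p: "X = p +o free.span Q" "p \<in> carrier (Free S)"
    using assms(5) by (auto simp: carrier_presented)
  show ?thesis
    unfolding p(1)
    by (rule lin_map_Free_ext[OF assms(1) lin_map_comp[OF lin_map_coset assms(2)]
          lin_map_comp[OF lin_map_coset assms(3)] _ p(2)])
      (use assms(4) in \<open>simp add: gen_class_def\<close>)
qed

section \<open>Tensor products and bilinear maps\<close>

definition bilin_map ::
    "('k::field, 'v) module \<Rightarrow> ('k, 'w) module \<Rightarrow> ('k, 'p) module \<Rightarrow> ('v \<Rightarrow> 'w \<Rightarrow> 'p) \<Rightarrow> bool"
  where "bilin_map M N P b \<longleftrightarrow>
    (\<forall>y\<in>carrier N. lin_map M P (\<lambda>x. b x y)) \<and> (\<forall>x\<in>carrier M. lin_map N P (b x))"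

lemma bilin_mapD:
  assumes "bilin_map M N P b"
  shows "y \<in> carrier N \<Longrightarrow> lin_map M P (\<lambda>x. b x y)" and "x \<in> carrier M \<Longrightarrow> lin_map N P (b x)"
    and "\<lbrakk>x \<in> carrier M; y \<in> carrier N\<rbrakk> \<Longrightarrow> b x y \<in> carrier P"
  using assms unfolding bilin_map_def lin_map_def by auto

lemma bilin_map_comp:
  assumes "bilin_map M N P b" "lin_map M' M f" "lin_map N' N g"
  shows "bilin_map M' N' P (\<lambda>x y. b (f x) (g y))"
  unfolding bilin_map_def
proof (intro conjI ballI)
  show "lin_map M' P (\<lambda>x. b (f x) (g y))" if "y \<in> carrier N'" for y
    using that by (intro lin_map_comp[OF assms(2) bilin_mapD(1)[OF assms(1)]] lin_mapD(1)[OF assms(3)])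
  show "lin_map N' P (\<lambda>y. b (f x) (g y))" if "x \<in> carrier M'" for x
    using that by (intro lin_map_comp[OF assms(3) bilin_mapD(2)[OF assms(1)]] lin_mapD(1)[OF assms(2)])
qed

lemma tensor_rels_Free: "tensor_rels M N \<subseteq> carrier (Free (carrier M \<times> carrier N))"
  if "vspace M" "vspace N" for M :: "('k::field, 'v) module" and N :: "('k, 'w) module"
proof -
  interpret M: vspace M by fact
  interpret N: vspace N by fact
  show ?thesis unfolding tensor_rels_def by (intro Un_least subsetI) auto
qed

lemma vspace_tensor [simp]: "vspace (tensor M N)"
  by (simp add: tensor_def)

lemma bilin_pure_tensor:
  fixes M :: "('k::field, 'v) module" and N :: "('k, 'w) module"
  assumes "vspace M" "vspace N"
  shows "bilin_map M N (tensor M N) (pure_tensor M N)"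
proof -
  let ?Q = "tensor_rels M N"
  interpret M: vspace M by fact
  interpret N: vspace N by fact
  show ?thesis
    unfolding bilin_map_def
  proof (intro conjI ballI lin_mapI)
    fix x y assume xy: "x \<in> carrier M" "y \<in> carrier N"
    show c: "pure_tensor M N x y \<in> carrier (tensor M N)"
      unfolding pure_tensor_def tensor_def using xy by (intro gen_class_closed) simp
    show "pure_tensor M N x y \<in> carrier (tensor M N)" by (rule c)
    fix c
    show "pure_tensor M N (c \<odot>\<^bsub>M\<^esub> x) y = c \<odot>\<^bsub>tensor M N\<^esub> pure_tensor M N x y"
      "pure_tensor M N x (c \<odot>\<^bsub>N\<^esub> y) = c \<odot>\<^bsub>tensor M N\<^esub> pure_tensor M N x y"
      unfolding pure_tensor_def tensor_def gen_class_def presented_simps coset_eq_iff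
      by (rule free.span_base; use xy in \<open>auto simp: tensor_rels_def free_scale_single\<close>)+
  next
    fix x x' y assume xy: "x \<in> carrier M" "x' \<in> carrier M" "y \<in> carrier N"
    show "pure_tensor M N (x \<oplus>\<^bsub>M\<^esub> x') y = pure_tensor M N x y \<oplus>\<^bsub>tensor M N\<^esub> pure_tensor M N x' y"
      unfolding pure_tensor_def tensor_def gen_class_def presented_simps coset_eq_iff
      by (rule free.span_base) (use xy in \<open>auto simp: tensor_rels_def diff_diff_eq[symmetric]\<close>)
  next
    fix x y y' assume xy: "x \<in> carrier M" "y \<in> carrier N" "y' \<in> carrier N"
    show "pure_tensor M N x (y \<oplus>\<^bsub>N\<^esub> y') = pure_tensor M N x y \<oplus>\<^bsub>tensor M N\<^esub> pure_tensor M N x y'"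
      unfolding pure_tensor_def tensor_def gen_class_def presented_simps coset_eq_iff
      by (rule free.span_base) (use xy in \<open>auto simp: tensor_rels_def diff_diff_eq[symmetric]\<close>)
  qed
qed

text \<open>Bilinearity of \<open>f\<close> says that its linear extension kills \<^const>\<open>tensor_rels\<close>, so that it factors
  through the tensor product.\<close>

lemma extend_tensor:
  fixes M :: "('k::field, 'v) module" and N :: "('k, 'w) module"
  assumes M: "vspace M" and N: "vspace N" and P: "vspace P" and b: "bilin_map M N P (\<lambda>x y. f (x, y))"
  shows lin_map_extend_tensor: "lin_map (tensor M N) P (extend P f)"
    and extend_pure: "\<lbrakk>x \<in> carrier M; y \<in> carrier N\<rbrakk> \<Longrightarrow> extend P f (pure_tensor M N x y) = f (x, y)"
proof -
  interpret M: vspace M by fact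
  interpret N: vspace N by fact
  interpret P: vspace P by fact
  let ?S = "carrier M \<times> carrier N"
  have closed: "f s \<in> carrier P" if "s \<in> ?S" for s
    using that bilin_mapD(3)[OF b] by auto
  note b1 = bilin_mapD(1)[OF b] and b2 = bilin_mapD(2)[OF b]
  have F: "lin_map (Free ?S) P (lincomb P f)" by (rule lin_map_lincomb'[OF P closed])
  have diff: "lincomb P f (p - q) = \<zero>\<^bsub>P\<^esub>" if "lincomb P f p = lincomb P f q"
    "p \<in> carrier (Free ?S)" "q \<in> carrier (Free ?S)" for p q
  proof -
    have "lincomb P f (p + - 1 *\<^sub>F q) = lincomb P f q \<oplus>\<^bsub>P\<^esub> (- 1) \<odot>\<^bsub>P\<^esub> lincomb P f q"
      using that by (simp only: lin_mapD(2,3)[OF F, unfolded Free_simps] Free_scale)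
    also have "\<dots> = (1 + - 1) \<odot>\<^bsub>P\<^esub> lincomb P f q"
      using that lin_mapD(1)[OF F] by (simp only: P.scale_add_left P.scale_one)
    also have "\<dots> = \<zero>\<^bsub>P\<^esub>"
      using that lin_mapD(1)[OF F] by (simp add: P.scale_zero_left)
    finally show ?thesis by simp
  qed
  have rel: "lincomb P f q = \<zero>\<^bsub>P\<^esub>" if "q \<in> tensor_rels M N" for q
    using that unfolding tensor_rels_def
    by (elim UnE CollectE exE conjE; hypsubst; unfold diff_diff_eq; intro diff)
      (auto simp: lin_mapD(2)[OF F, unfolded Free_simps] P.lincomb_single P.scale_one closed
         lin_mapD[OF b1] lin_mapD[OF b2])
  show "lin_map (tensor M N) P (extend P f)"
    unfolding tensor_def by (rule lin_map_extend[OF P closed tensor_rels_Free[OF M N] rel])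
  show "\<lbrakk>x \<in> carrier M; y \<in> carrier N\<rbrakk> \<Longrightarrow> extend P f (pure_tensor M N x y) = f (x, y)"
    unfolding pure_tensor_def
    by (rule extend_gen_class[OF P closed tensor_rels_Free[OF M N] rel]) auto
qed

lemma lin_map_tensor_ext:
  fixes M :: "('k::field, 'v) module" and N :: "('k, 'w) module"
  assumes "vspace P" "lin_map (tensor M N) P \<phi>" "lin_map (tensor M N) P \<psi>"
    and "\<And>x y. \<lbrakk>x \<in> carrier M; y \<in> carrier N\<rbrakk> \<Longrightarrow> \<phi> (pure_tensor M N x y) = \<psi> (pure_tensor M N x y)"
    and "X \<in> carrier (tensor M N)"
  shows "\<phi> X = \<psi> X"
  by (rule lin_map_presented_ext[OF assms(1-3)[unfolded tensor_def] _ assms(5)[unfolded tensor_def]])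
    (use assms(4) in \<open>auto simp: pure_tensor_def\<close>)

text \<open>Moves a computation with a bilinear map from the modules, where every step needs membership in a
  carrier, to formal linear combinations of pairs.\<close>

lemma bilin_lincomb:
  assumes V: "vspace M" "vspace N" "vspace P" and b: "bilin_map M N P b"
    and f: "\<And>s. s \<in> S \<Longrightarrow> f s \<in> carrier M" and g: "\<And>s. s \<in> S' \<Longrightarrow> g s \<in> carrier N"
    and p: "p \<in> carrier (Free S)" and q: "q \<in> carrier (Free S')"
  shows "b (lincomb M f p) (lincomb N g q) = lincomb P (\<lambda>(u, v). b (f u) (g v)) (pt p q)"
proof -
  have L: "lin_map (Free (S \<times> S')) P (lincomb P (\<lambda>(u, v). b (f u) (g v)))"
    using f g bilin_mapD(3)[OF b] by (intro lin_map_lincomb' V) auto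
  have gq: "lincomb N g q \<in> carrier N"
    by (rule lin_mapD(1)[OF lin_map_lincomb' q]) (use V g in auto)
  show ?thesis
  proof (rule lin_map_Free_ext[OF V(3) lin_map_comp[OF lin_map_lincomb' bilin_mapD(1)[OF b gq]] _ _ p])
    show "lin_map (Free S) P (\<lambda>p. lincomb P (\<lambda>(u, v). b (f u) (g v)) (pt p q))"
      by (rule lin_map_comp[OF _ L]) (auto intro!: lin_mapI pt_closed q)
    fix s assume s: "s \<in> S"
    show "b (lincomb M f (gen s)) (lincomb N g q) = lincomb P (\<lambda>(u, v). b (f u) (g v)) (pt (gen s) q)"
    proof (rule lin_map_Free_ext[OF V(3) _ _ _ q])
      show "lin_map (Free S') P (\<lambda>q. b (lincomb M f (gen s)) (lincomb N g q))"
        using s f V g by (intro lin_map_comp[OF lin_map_lincomb' bilin_mapD(2)[OF b]]) (auto simp: vspace.lincomb_gen)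
      show "lin_map (Free S') P (\<lambda>q. lincomb P (\<lambda>(u, v). b (f u) (g v)) (pt (gen s) q))"
        using s by (intro lin_map_comp[OF _ L]) (auto intro!: lin_mapI pt_closed)
      show "b (lincomb M f (gen s)) (lincomb N g (gen s')) =
        lincomb P (\<lambda>(u, v). b (f u) (g v)) (pt (gen s) (gen s'))" if "s' \<in> S'" for s'
        using s f g V b that by (simp add: vspace.lincomb_gen bilin_mapD)
    qed
  qed (use V f in auto)
qed

lemma bilin_map_swap: "bilin_map M N P b \<Longrightarrow> bilin_map N M P (\<lambda>x y. b y x)"
  by (simp add: bilin_map_def)

lemma lin_map_pointwise_add:
  assumes "vspace N" "lin_map M N f" "lin_map M N g"
  shows "lin_map M N (\<lambda>x. f x \<oplus>\<^bsub>N\<^esub> g x)"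
proof -
  interpret N: vspace N by fact
  note f = lin_mapD[OF assms(2)] and g = lin_mapD[OF assms(3)]
  show ?thesis by (rule lin_mapI) (simp_all add: f g N.scale_add_right N.a_ac)
qed

lemma lin_map_pointwise_scale:
  assumes "vspace N" "lin_map M N f"
  shows "lin_map M N (\<lambda>x. c \<odot>\<^bsub>N\<^esub> f x)"
proof -
  interpret N: vspace N by fact
  note f = lin_mapD[OF assms(2)]
  show ?thesis
    by (rule lin_mapI) (simp_all add: f N.scale_add_right N.scale_scale mult.commute)
qed

text \<open>Both sides of the linearity laws in the parameter \<open>z\<close> are linear in the tensor, so they only need
  to be compared on pure tensors. This settles the nested extensions in \<^const>\<open>tensor_assoc\<close> and
  \<^const>\<open>tensor_mult\<close>.\<close>

lemma bilin_extend:
  fixes M :: "('k::field, 'v) module" and M' :: "('k, 'w) module" and N :: "('k, 'n) module"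
  assumes V: "vspace M" "vspace M'" "vspace N" "vspace P"
    and b: "\<And>z. z \<in> carrier N \<Longrightarrow> bilin_map M M' P (\<lambda>x y. f z (x, y))"
    and l: "\<And>x y. \<lbrakk>x \<in> carrier M; y \<in> carrier M'\<rbrakk> \<Longrightarrow> lin_map N P (\<lambda>z. f z (x, y))"
  shows "bilin_map N (tensor M M') P (\<lambda>z. extend P (f z))"
proof -
  interpret N: vspace N by fact
  note lin = lin_map_extend_tensor[OF V(1,2,4) b]
  note val = extend_pure[OF V(1,2,4) b]
  show ?thesis
    unfolding bilin_map_def
  proof (intro conjI ballI lin)
    fix X assume X: "X \<in> carrier (tensor M M')"
    show "lin_map N P (\<lambda>z. extend P (f z) X)"
    proof (rule lin_mapI)
      fix z c assume z: "z \<in> carrier N"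
      show "extend P (f z) X \<in> carrier P" by (rule lin_mapD(1)[OF lin[OF z] X])
      show "extend P (f (c \<odot>\<^bsub>N\<^esub> z)) X = c \<odot>\<^bsub>P\<^esub> extend P (f z) X"
        by (rule lin_map_tensor_ext[OF V(4) _ lin_map_pointwise_scale[OF V(4)] _ X])
          (use z in \<open>auto simp: val lin_mapD[OF l] intro: lin\<close>)
      fix z' assume z': "z' \<in> carrier N"
      show "extend P (f (z \<oplus>\<^bsub>N\<^esub> z')) X = extend P (f z) X \<oplus>\<^bsub>P\<^esub> extend P (f z') X"
        by (rule lin_map_tensor_ext[OF V(4) _ lin_map_pointwise_add[OF V(4)] _ X])
          (use z z' in \<open>auto simp: val lin_mapD[OF l] intro: lin\<close>)
    qed
  qed
qed

lemma tensor_map_lin: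
  fixes M :: "('k::field, 'v) module" and N :: "('k, 'w) module"
    and M' :: "('k, 'v2) module" and N' :: "('k, 'w2) module"
  assumes V: "vspace M" "vspace N" "vspace M'" "vspace N'"
    and f: "lin_map M M' f" and g: "lin_map N N' g"
  shows lin_map_tensor_map: "lin_map (tensor M N) (tensor M' N') (tensor_map M' N' f g)"
    and tensor_map_pure: "\<lbrakk>x \<in> carrier M; y \<in> carrier N\<rbrakk> \<Longrightarrow>
      tensor_map M' N' f g (pure_tensor M N x y) = pure_tensor M' N' (f x) (g y)"
  using extend_tensor[OF V(1,2) vspace_tensor, of M' N' "\<lambda>(x, y). pure_tensor M' N' (f x) (g y)"]
    bilin_map_comp[OF bilin_pure_tensor[OF V(3,4)] f g]
  by (simp_all add: tensor_map_def)

lemma tensor_assoc_lin: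
  fixes M :: "('k::field, 'u) module" and N :: "('k, 'v) module" and P :: "('k, 'w) module"
  assumes V: "vspace M" "vspace N" "vspace P"
  shows lin_map_tensor_assoc:
      "lin_map (tensor (tensor M N) P) (tensor M (tensor N P)) (tensor_assoc M N P)"
    and tensor_assoc_pure: "\<lbrakk>x \<in> carrier M; y \<in> carrier N; z \<in> carrier P\<rbrakk> \<Longrightarrow>
      tensor_assoc M N P (pure_tensor (tensor M N) P (pure_tensor M N x y) z) =
      pure_tensor M (tensor N P) x (pure_tensor N P y z)"
proof -
  let ?T = "tensor M (tensor N P)"
  let ?f = "\<lambda>z (x, y). pure_tensor M (tensor N P) x (pure_tensor N P y z)"
  note p = bilin_pure_tensor[OF V(1) vspace_tensor, of N P] and q = bilin_pure_tensor[OF V(2,3)]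
  have f: "bilin_map M N ?T (\<lambda>x y. ?f z (x, y))" if "z \<in> carrier P" for z
    using bilin_map_comp[OF p lin_map_id bilin_mapD(1)[OF q that]] by simp
  have l: "lin_map P ?T (\<lambda>z. ?f z (x, y))" if "x \<in> carrier M" "y \<in> carrier N" for x y
    using lin_map_comp[OF bilin_mapD(2)[OF q that(2)] bilin_mapD(2)[OF p that(1)]] by simp
  note b = bilin_map_swap[OF bilin_extend[OF V vspace_tensor f l]]
  have b': "bilin_map (tensor M N) P ?T (\<lambda>X z. (\<lambda>(X, z). extend ?T (?f z) X) (X, z))"
    using b by simp
  note e = extend_tensor[OF vspace_tensor V(3) vspace_tensor b']
  show "lin_map (tensor (tensor M N) P) ?T (tensor_assoc M N P)"
    unfolding tensor_assoc_def by (rule e)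
  assume xyz: "x \<in> carrier M" "y \<in> carrier N" "z \<in> carrier P"
  then show "tensor_assoc M N P (pure_tensor (tensor M N) P (pure_tensor M N x y) z) =
      pure_tensor M (tensor N P) x (pure_tensor N P y z)"
    unfolding tensor_assoc_def
    using extend_pure[OF V(1,2) vspace_tensor f[OF xyz(3)]] bilin_mapD(3)[OF bilin_pure_tensor[OF V(1,2)]]
    by (subst e(2)) auto
qed

lemma tensor_mult_bilin:
  fixes H :: "('k::field, 'h) module"
  assumes V: "vspace H" and m: "bilin_map H H H (\<lambda>x y. x \<otimes>\<^bsub>H\<^esub> y)"
  shows bilin_tensor_mult: "bilin_map (tensor H H) (tensor H H) (tensor H H) (tensor_mult H)"
    and tensor_mult_pure:
      "\<lbrakk>x \<in> carrier H; y \<in> carrier H; x' \<in> carrier H; y' \<in> carrier H\<rbrakk> \<Longrightarrow>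
        tensor_mult H (pure_tensor H H x y) (pure_tensor H H x' y') =
        pure_tensor H H (x \<otimes>\<^bsub>H\<^esub> x') (y \<otimes>\<^bsub>H\<^esub> y')"
proof -
  let ?T = "tensor H H" and ?p = "pure_tensor H H"
  note p = bilin_pure_tensor[OF V V]
  let ?f = "\<lambda>(x, y) (x', y'). ?p (x \<otimes>\<^bsub>H\<^esub> x') (y \<otimes>\<^bsub>H\<^esub> y')"
  let ?g = "\<lambda>Y (x, y). extend ?T (?f (x, y)) Y"
  have f: "bilin_map H H ?T (\<lambda>x' y'. ?f (x, y) (x', y'))" if "x \<in> carrier H" "y \<in> carrier H" for x y
    using bilin_map_comp[OF p bilin_mapD(2)[OF m that(1)] bilin_mapD(2)[OF m that(2)]] by simp
  have l1: "lin_map H ?T (\<lambda>x. ?f (x, y) (x', y'))"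
    and l2: "lin_map H ?T (\<lambda>x. ?f (y, x) (x', y'))"
    if "y \<in> carrier H" "x' \<in> carrier H" "y' \<in> carrier H" for y x' y'
    using that bilin_mapD[OF m] lin_map_comp[OF bilin_mapD(1)[OF m] bilin_mapD(1)[OF p]]
      lin_map_comp[OF bilin_mapD(1)[OF m] bilin_mapD(2)[OF p]] by simp_all
  have e1: "bilin_map H ?T ?T (\<lambda>x. extend ?T (?f (x, y)))" if "y \<in> carrier H" for y
    by (rule bilin_extend[OF V V V vspace_tensor f l1]) (use that in auto)
  have e2: "bilin_map H ?T ?T (\<lambda>x. extend ?T (?f (y, x)))" if "y \<in> carrier H" for y
    by (rule bilin_extend[OF V V V vspace_tensor f l2]) (use that in auto)
  have g: "bilin_map H H ?T (\<lambda>x y. ?g Y (x, y))" if "Y \<in> carrier ?T" for Y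
    using bilin_mapD(1)[OF e1 that] bilin_mapD(1)[OF e2 that] by (simp add: bilin_map_def)
  have gl: "lin_map ?T ?T (\<lambda>Y. ?g Y (x, y))" if "x \<in> carrier H" "y \<in> carrier H" for x y
    using bilin_mapD(2)[OF e1 that(1)] that by simp
  have eq: "tensor_mult H X Y = extend ?T (?g Y) X" for X Y
    by (simp add: tensor_mult_def case_prod_beta')
  have "tensor_mult H = (\<lambda>X Y. extend ?T (?g Y) X)" by (intro ext eq)
  then show "bilin_map ?T ?T ?T (tensor_mult H)"
    using bilin_map_swap[OF bilin_extend[OF V V vspace_tensor vspace_tensor g gl]] by (simp only:)
  assume xy: "x \<in> carrier H" "y \<in> carrier H" "x' \<in> carrier H" "y' \<in> carrier H"
  have "?p x' y' \<in> carrier ?T" using xy by (intro bilin_mapD(3)[OF p])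
  from extend_pure[OF V V vspace_tensor g[OF this] xy(1,2)]
  show "tensor_mult H (?p x y) (?p x' y') = ?p (x \<otimes>\<^bsub>H\<^esub> x') (y \<otimes>\<^bsub>H\<^esub> y')"
    using extend_pure[OF V V vspace_tensor f[OF xy(1,2)] xy(3,4)] by (simp add: eq)
qed

section \<open>The quasi-shuffle product on linear combinations of words\<close>

abbreviation pre :: "'a \<Rightarrow> ('a list \<Rightarrow>\<^sub>0 'k::field) \<Rightarrow> ('a list \<Rightarrow>\<^sub>0 'k)"
  where "pre x \<equiv> lin (\<lambda>w. gen (x # w))"

lemma prepend_eq_pre: "prepend x p = pre x p"
proof -
  have "pre x p = pre x (\<Sum>w\<in>Poly_Mapping.keys p. Poly_Mapping.lookup p w *\<^sub>F gen w)"
    using sum_gens[of p] by simp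
  also have "\<dots> = prepend x p"
    unfolding prepend_def by (simp add: free_scale_single lin_single)
  finally show ?thesis by simp
qed

text \<open>The recursion of \<^const>\<open>quasi_shuffle\<close> with \<open>x y t\<^sup>-\<^sup>1\<close> replaced by an arbitrary product \<open>m\<close> of
  letters. Only this product and its unit \<open>t\<close> matter, and the generality makes it possible to pass to
  the opposite product.\<close>

fun qs :: "('a \<Rightarrow> 'a \<Rightarrow> 'a) \<Rightarrow> 'a \<Rightarrow> 'a list \<Rightarrow> 'a list \<Rightarrow> ('a list \<Rightarrow>\<^sub>0 'k::field)"
  where
    "qs m t [] v = gen v"
  | "qs m t (x # u) [] = gen (x # u)"
  | "qs m t (x # u) (y # v) =
      pre x (qs m t u (y # v)) + pre y (qs m t (x # u) v) - pre (m x y) (pre t (qs m t u v))"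

lemma quasi_shuffle_eq_qs: "quasi_shuffle t u v = qs (\<lambda>x y. x * y * ring_inverse t) t u v"
  by (induction t u v rule: quasi_shuffle.induct) (simp_all add: prepend_eq_pre)

lemma qs_Nil_right [simp]: "qs m t u [] = gen u"
  by (cases u) simp_all

text \<open>Statements about right multiplication follow from those about left multiplication, applied to the
  opposite product of letters.\<close>

lemma qs_opposite: "qs (\<lambda>x y. m y x) t u v = qs m t v u"
  by (induction m t v u rule: qs.induct) simp_all

definition qmul :: "('a \<Rightarrow> 'a \<Rightarrow> 'a) \<Rightarrow> 'a \<Rightarrow> ('a list \<Rightarrow>\<^sub>0 'k::field) \<Rightarrow> ('a list \<Rightarrow>\<^sub>0 'k) \<Rightarrow> ('a list \<Rightarrow>\<^sub>0 'k)"
  where "qmul m t p q = lin (\<lambda>u. lin (qs m t u) q) p"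

lemma qmul_simps [simp]:
  "qmul m t (p + p') q = qmul m t p q + qmul m t p' q"
  "qmul m t p (q + q') = qmul m t p q + qmul m t p q'"
  "qmul m t (p - p') q = qmul m t p q - qmul m t p' q"
  "qmul m t p (q - q') = qmul m t p q - qmul m t p q'"
  "qmul m t (- p) q = - qmul m t p q" "qmul m t p (- q) = - qmul m t p q"
  "qmul m t (c *\<^sub>F p) q = c *\<^sub>F qmul m t p q" "qmul m t p (c *\<^sub>F q) = c *\<^sub>F qmul m t p q"
  "qmul m t 0 q = 0" "qmul m t p 0 = 0" "qmul m t (gen u) (gen v) = qs m t u v"
  "qmul m t (sum f I) q = (\<Sum>i\<in>I. qmul m t (f i) q)"
proof -
  show "qmul m t p (- q) = - qmul m t p q"
    using lin_fun_diff[of "\<lambda>_. 0" "\<lambda>u. lin (qs m t u) q" p] by (simp add: qmul_def)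
qed (simp_all add: qmul_def lin_fun_add lin_fun_diff lin_fun_scale)

lemma qmul_sum_right [simp]: "qmul m t p (sum f I) = (\<Sum>i\<in>I. qmul m t p (f i))"
  by (induction I rule: infinite_finite_induct) simp_all

lemma qmul_opposite: "qmul (\<lambda>x y. m y x) t p q = qmul m t q p"
proof (induction p rule: free_induct[OF Free_UNIV])
  case (2 c u p)
  have "qmul (\<lambda>x y. m y x) t (gen u) q = qmul m t q (gen u)"
    by (induction q rule: free_induct[OF Free_UNIV]) (simp_all add: qs_opposite[of m])
  with 2 show ?case by simp
qed simp

lemma qmul_unit [simp]: "qmul m t (gen []) q = q" "qmul m t p (gen []) = p"
  by (induction q rule: free_induct[OF Free_UNIV], simp_all)
    (induction p rule: free_induct[OF Free_UNIV], simp_all)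

lemma qmul_pre:
  "qmul m t (pre x p) (pre y q) =
    pre x (qmul m t p (pre y q)) + pre y (qmul m t (pre x p) q) - pre (m x y) (pre t (qmul m t p q))"
proof (induction p rule: free_induct[OF Free_UNIV])
  case (2 c u p)
  have "qmul m t (pre x (gen u)) (pre y q) = pre x (qmul m t (gen u) (pre y q))
    + pre y (qmul m t (pre x (gen u)) q) - pre (m x y) (pre t (qmul m t (gen u) q))"
    by (induction q rule: free_induct[OF Free_UNIV])
      (simp_all add: free.scale_right_distrib free.scale_right_diff_distrib)
  with 2 show ?case
    by (simp add: free.scale_right_distrib free.scale_right_diff_distrib)
qed simp

lemma qs_degree:
  assumes "\<And>x y. \<lbrakk>x \<in> V; y \<in> V\<rbrakk> \<Longrightarrow> m x y \<in> V" "t \<in> V" "u \<in> lists V" "v \<in> lists V"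
  shows "(qs m t u v :: 'a list \<Rightarrow>\<^sub>0 'k::field) \<in> carrier (Free {w \<in> lists V. length w = length u + length v})"
  using assms
proof (induction m t u v rule: qs.induct)
  case (3 m t x u y v)
  let ?W = "\<lambda>n. {w \<in> lists V. length w = n}"
  have pre: "pre z p \<in> carrier (Free (?W (Suc n)))" if "z \<in> V" "p \<in> carrier (Free (?W n))"
    for z n and p :: "'a list \<Rightarrow>\<^sub>0 'k"
    using that by (intro lin_closed[of "?W n"]) auto
  let ?q = "qs m t :: 'a list \<Rightarrow> 'a list \<Rightarrow> ('a list \<Rightarrow>\<^sub>0 'k)"
  have "pre x (?q u (y # v)) \<in> carrier (Free (?W (Suc (length u + Suc (length v)))))"
    "pre y (?q (x # u) v) \<in> carrier (Free (?W (Suc (Suc (length u) + length v))))"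
    "pre (m x y) (pre t (?q u v)) \<in> carrier (Free (?W (Suc (Suc (length u + length v)))))"
    using 3 by (auto intro!: pre)
  then show ?case by simp
qed auto

lemma qmul_closed:
  assumes "\<And>x y. \<lbrakk>x \<in> V; y \<in> V\<rbrakk> \<Longrightarrow> m x y \<in> V" "t \<in> V"
    "(p :: 'a list \<Rightarrow>\<^sub>0 'b::field) \<in> carrier (Free (lists V))" "q \<in> carrier (Free (lists V))"
  shows "qmul m t p q \<in> carrier (Free (lists V))"
  unfolding qmul_def
proof (intro lin_closed[OF lin_closed])
  fix u v assume "u \<in> lists V" "v \<in> lists V"
  show "qs m t u v \<in> carrier (Free (lists V))"
    by (rule Free_mono[OF qs_degree[of V]]) (use assms \<open>u \<in> lists V\<close> \<open>v \<in> lists V\<close> in auto)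
qed (use assms in auto)

text \<open>The product \<open>m x y = x y t\<^sup>-\<^sup>1\<close> is associative and has the unit \<open>t\<close>, since \<open>t\<close> is central.\<close>

locale letter_monoid =
  fixes m :: "'a \<Rightarrow> 'a \<Rightarrow> 'a" and t :: 'a
  assumes assoc: "m (m x y) z = m x (m y z)"
    and unit [simp]: "m t x = x" "m x t = x"

text \<open>Since \<open>t\<close> is the unit of \<open>m\<close>, the last two terms in the recursion for \<open>qs m t (t # u) (y # v)\<close> cancel
  by induction.\<close>

lemma (in letter_monoid) pre_unit_qmul: "qmul m t (pre t p) q = pre t (qmul m t p q)"
proof -
  have *: "qs m t (t # u) v = pre t (qs m t u v)" for u v
    by (induction v) simp_all
  show ?thesis
  proof (induction p rule: free_induct[OF Free_UNIV])
    case (2 c u p)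
    have "qmul m t (pre t (gen u)) q = pre t (qmul m t (gen u) q)"
      by (induction q rule: free_induct[OF Free_UNIV]) (simp_all add: *)
    with 2 show ?case by simp
  qed simp
qed

lemma (in letter_monoid) opposite: "letter_monoid (\<lambda>x y. m y x) t"
  by unfold_locales (simp_all add: assoc)

lemma (in letter_monoid) qmul_pre_unit: "qmul m t p (pre t q) = pre t (qmul m t p q)"
  using letter_monoid.pre_unit_qmul[OF opposite, of q p] by (simp add: qmul_opposite[of m])

text \<open>Let \<open>x\<close>, \<open>y\<close>, \<open>z\<close> be the first letters. Expand both sides by the recursion and move all prepended
  letters \<open>t\<close> to the front. On either side there is one term for every non-empty subset of
  \<open>{x, y, z}\<close>: the product of these letters, followed by one \<open>t\<close> less than there are letters, followed
  by the triple product of the words that remain. The terms agree by induction and by associativity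
  of \<open>m\<close>.\<close>

lemma (in letter_monoid) qs_assoc:
  "qmul m t (qs m t u v) (gen w) = (qmul m t (gen u) (qs m t v w) :: 'a list \<Rightarrow>\<^sub>0 'k::field)"
proof (induction "length u + length v + length w" arbitrary: u v w rule: less_induct)
  case less
  let ?M = "qmul m t :: _ \<Rightarrow> _ \<Rightarrow> ('a list \<Rightarrow>\<^sub>0 'k)"
  show ?case
  proof (cases "u = [] \<or> v = [] \<or> w = []")
    case False
    then obtain x u' y v' z w' where uvw: "u = x # u'" "v = y # v'" "w = z # w'"
      by (auto simp: neq_Nil_conv)
    have g: "gen (z # w') = pre z (gen w')" "gen (x # u') = pre x (gen u')" by simp_all
    note IH = less[unfolded uvw]
    have IHs:
      "?M (qs m t u' (y # v')) (gen (z # w')) = ?M (gen u') (qs m t (y # v') (z # w'))"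
      "?M (qs m t (x # u') v') (gen (z # w')) = ?M (gen (x # u')) (qs m t v' (z # w'))"
      "?M (qs m t (x # u') (y # v')) (gen w') = ?M (gen (x # u')) (qs m t (y # v') w')"
      "?M (qs m t u' v') (gen (z # w')) = ?M (gen u') (qs m t v' (z # w'))"
      "?M (qs m t u' (y # v')) (gen w') = ?M (gen u') (qs m t (y # v') w')"
      "?M (qs m t (x # u') v') (gen w') = ?M (gen (x # u')) (qs m t v' w')"
      "?M (qs m t u' v') (gen w') = ?M (gen u') (qs m t v' w')"
      by (rule IH; simp)+
    let ?a = "qs m t u' (y # v')" and ?b = "qs m t (x # u') v'" and ?c = "qs m t u' v'"
    have L: "?M (qs m t u v) (gen w) =
        pre x (?M ?a (gen (z # w'))) + pre y (?M ?b (gen (z # w')))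
      - pre (m x y) (pre t (?M ?c (gen (z # w'))))
      + pre z (?M (qs m t u v) (gen w'))
      - pre (m x z) (pre t (?M ?a (gen w'))) - pre (m y z) (pre t (?M ?b (gen w')))
      + pre (m (m x y) z) (pre t (pre t (?M ?c (gen w'))))"
      unfolding uvw qs.simps(3) g(1) qmul_simps qmul_pre pre_unit_qmul lin_add lin_diff
      by (simp add: algebra_simps)
    let ?A = "qs m t (y # v') w'" and ?B = "qs m t v' (z # w')" and ?C = "qs m t v' w'"
    have R: "?M (gen u) (qs m t v w) =
        pre x (?M (gen u') (qs m t v w)) + pre y (?M (gen (x # u')) ?B)
      + pre z (?M (gen (x # u')) ?A)
      - pre (m y z) (pre t (?M (gen (x # u')) ?C))
      - pre (m x y) (pre t (?M (gen u') ?B)) - pre (m x z) (pre t (?M (gen u') ?A))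
      + pre (m x (m y z)) (pre t (pre t (?M (gen u') ?C)))"
      unfolding uvw qs.simps(3) g(2) qmul_simps qmul_pre qmul_pre_unit lin_add lin_diff
      by (simp add: algebra_simps)
    show ?thesis
      unfolding L R by (simp add: uvw IHs assoc del: qs.simps)
  qed auto
qed

lemma (in letter_monoid) qmul_assoc: "qmul m t (qmul m t p q) r = qmul m t p ((qmul m t q r :: 'a list \<Rightarrow>\<^sub>0 'k::field))"
proof (induction p rule: free_induct[OF Free_UNIV])
  case (2 c u p)
  have "qmul m t (qmul m t (gen u) q) r = qmul m t (gen u) (qmul m t q r)"
  proof (induction q rule: free_induct[OF Free_UNIV])
    case (2 d v q)
    have "qmul m t (qs m t u v) r = qmul m t (gen u) (qmul m t (gen v) r)"
      by (induction r rule: free_induct[OF Free_UNIV]) (simp_all add: qs_assoc)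
    with 2 show ?case by simp
  qed simp
  with 2 show ?case by simp
qed simp

section \<open>Deconcatenation of words\<close>

text \<open>The analogue of Sweedler notation for deconcatenation.\<close>

definition split_sum :: "('a list \<Rightarrow> 'a list \<Rightarrow> 'b::comm_monoid_add) \<Rightarrow> 'a list \<Rightarrow> 'b"
  where "split_sum F w = (\<Sum>i\<le>length w. F (take i w) (drop i w))"

lemma split_sum_simps [simp]:
  "split_sum F [] = F [] []"
  "split_sum F (x # w) = F [] (x # w) + split_sum (\<lambda>a b. F (x # a) b) w"
  by (simp_all add: split_sum_def sum.atMost_Suc_shift del: sum.atMost_Suc)

lemma split_sum_add: "split_sum (\<lambda>a b. F a b + G a b) w = split_sum F w + split_sum G w"
  by (simp add: split_sum_def sum.distrib)

text \<open>Both sides sum over all ways to cut \<open>w\<close> into three parts.\<close>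

lemma split_sum_coassoc:
  "split_sum (\<lambda>a b. split_sum (\<lambda>c d. F c d b) a) w = split_sum (\<lambda>a b. split_sum (\<lambda>c d. F a c d) b) w"
proof (induction w arbitrary: F)
  case (Cons x w)
  show ?case
    using Cons[of "\<lambda>a. F (x # a)"] by (simp add: split_sum_add ac_simps)
qed simp

lemma split_sum_counit [simp]:
  "split_sum (\<lambda>a b. if a = [] then G b else 0) w = G w"
  "split_sum (\<lambda>a b. if b = [] then G a else 0) w = G w"
proof -
  show "split_sum (\<lambda>a b. if a = [] then G b else 0) w = G w"
    by (cases w) (simp_all add: split_sum_def)
  show "split_sum (\<lambda>a b. if b = [] then G a else 0) w = G w"
    by (induction w arbitrary: G) simp_all
qed

definition splits :: "'a list \<Rightarrow> ('a list \<times> 'a list \<Rightarrow>\<^sub>0 'k::field)"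
  where "splits w = split_sum (\<lambda>a b. gen (a, b)) w"

abbreviation pre_left ::
    "'a \<Rightarrow> ('a list \<times> 'a list \<Rightarrow>\<^sub>0 'k::field) \<Rightarrow> ('a list \<times> 'a list \<Rightarrow>\<^sub>0 'k)"
  where "pre_left x \<equiv> lin (\<lambda>(a, b). gen (x # a, b))"

lemma lin_splits: "lin F (splits w) = split_sum (\<lambda>a b. F (a, b)) w"
  by (simp add: splits_def split_sum_def)

lemma splits_simps:
  "splits [] = gen ([], [])"
  "splits (x # w) = gen ([], x # w) + pre_left x (splits w)"
  by (simp_all add: splits_def) (simp add: split_sum_def)

lemma splits_closed: "w \<in> lists V \<Longrightarrow> splits w \<in> carrier (Free (lists V \<times> lists V))"
  unfolding splits_def split_sum_def by (rule Free_sum) (auto intro!: Free_single dest: in_set_takeD in_set_dropD)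

definition qmul2 ::
    "('a \<Rightarrow> 'a \<Rightarrow> 'a) \<Rightarrow> 'a \<Rightarrow> ('a list \<times> 'a list \<Rightarrow>\<^sub>0 'k::field) \<Rightarrow> ('a list \<times> 'a list \<Rightarrow>\<^sub>0 'k)
      \<Rightarrow> ('a list \<times> 'a list \<Rightarrow>\<^sub>0 'k)"
  where "qmul2 m t P Q = lin (\<lambda>(a, b). lin (\<lambda>(c, d). pt (qs m t a c) (qs m t b d)) Q) P"

lemma qmul2_simps [simp]:
  "qmul2 m t (p + p') q = qmul2 m t p q + qmul2 m t p' q"
  "qmul2 m t p (q + q') = qmul2 m t p q + qmul2 m t p q'"
  "qmul2 m t (r *\<^sub>F p) q = r *\<^sub>F qmul2 m t p q" "qmul2 m t p (r *\<^sub>F q) = r *\<^sub>F qmul2 m t p q"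
  "qmul2 m t 0 q = 0" "qmul2 m t p 0 = 0"
  "qmul2 m t (gen (a, b)) (gen (c, d)) = pt (qs m t a c) (qs m t b d)"
  by (simp_all add: qmul2_def case_prod_beta' lin_fun_add lin_fun_scale)

lemma pre_left_pt [simp]: "pre_left x (pt p q) = pt (pre x p) q"
proof (induction p rule: free_induct[OF Free_UNIV])
  case (2 c u p)
  have "pre_left x (pt (gen u) q) = pt (gen (x # u)) q"
    by (induction q rule: free_induct[OF Free_UNIV]) simp_all
  with 2 show ?case by simp
qed simp

lemma qmul2_pre_left:
  "qmul2 m t (pre_left x P) (pre_left y Q) = pre_left x (qmul2 m t P (pre_left y Q))
     + pre_left y (qmul2 m t (pre_left x P) Q) - pre_left (m x y) (pre_left t (qmul2 m t P Q))"
proof (induction P rule: free_induct[OF Free_UNIV])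
  case (2 r ab P)
  obtain a b where ab: "ab = (a, b)" by force
  have "qmul2 m t (pre_left x (gen (a, b))) (pre_left y Q) =
     pre_left x (qmul2 m t (gen (a, b)) (pre_left y Q))
     + pre_left y (qmul2 m t (pre_left x (gen (a, b))) Q)
     - pre_left (m x y) (pre_left t (qmul2 m t (gen (a, b)) Q))"
  proof (induction Q rule: free_induct[OF Free_UNIV])
    case (2 r cd Q)
    then show ?case
      by (cases cd) (simp add: free.scale_right_distrib free.scale_right_diff_distrib)
  qed simp
  with 2 show ?case
    by (simp add: ab free.scale_right_distrib free.scale_right_diff_distrib)
qed simp

lemma qmul2_pre_left_Nil:
  "qmul2 m t (gen ([], b)) (pre_left y Q) = pre_left y (qmul2 m t (gen ([], b)) Q)"
  "qmul2 m t (pre_left y Q) (gen ([], b)) = pre_left y (qmul2 m t Q (gen ([], b)))"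
proof -
  show "qmul2 m t (gen ([], b)) (pre_left y Q) = pre_left y (qmul2 m t (gen ([], b)) Q)"
  proof (induction Q rule: free_induct[OF Free_UNIV])
    case (2 r cd Q)
    then show ?case by (cases cd) simp
  qed simp
  show "qmul2 m t (pre_left y Q) (gen ([], b)) = pre_left y (qmul2 m t Q (gen ([], b)))"
  proof (induction Q rule: free_induct[OF Free_UNIV])
    case (2 r cd Q)
    then show ?case by (cases cd) simp
  qed simp
qed

text \<open>A word that begins with \<open>t\<close> has class zero in \<open>A(R)\<close>. Killing such second factors already at the
  level of words turns multiplicativity of the coproduct into an equation between linear combinations
  of pairs of words.\<close>

abbreviation drop_unit ::
    "'a \<Rightarrow> ('a list \<times> 'a list \<Rightarrow>\<^sub>0 'k::field) \<Rightarrow> ('a list \<times> 'a list \<Rightarrow>\<^sub>0 'k)"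
  where "drop_unit t \<equiv> lin (\<lambda>(a, b). if b \<noteq> [] \<and> hd b = t then 0 else gen (a, b))"

lemma drop_unit_pre_left: "drop_unit t (pre_left x P) = pre_left x (drop_unit t P)"
proof (induction P rule: free_induct[OF Free_UNIV])
  case (2 c ab P)
  then show ?case by (cases ab) simp
qed simp

lemma drop_unit_pt: "drop_unit t (pt (gen a) (pre t q)) = 0"
  by (induction q rule: free_induct[OF Free_UNIV]) simp_all

lemma lin_splits_pre:
  "lin splits (pre x p) = pt (gen []) (pre x p) + pre_left x (lin splits p)"
  by (induction p rule: free_induct[OF Free_UNIV])
    (simp_all add: splits_simps free.scale_right_distrib)

lemma qmul2_unit [simp]:
  "qmul2 m t (gen ([], [])) Q = Q" "qmul2 m t Q (gen ([], [])) = Q"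
proof -
  show "qmul2 m t (gen ([], [])) Q = Q"
  proof (induction Q rule: free_induct[OF Free_UNIV])
    case (2 r cd Q)
    then show ?case by (cases cd) simp
  qed simp
  show "qmul2 m t Q (gen ([], [])) = Q"
  proof (induction Q rule: free_induct[OF Free_UNIV])
    case (2 r cd Q)
    then show ?case by (cases cd) simp
  qed simp
qed

text \<open>Apply the recursion on both sides. The only cut without a counterpart in the product of the two
  deconcatenations is the one between \<open>m x y\<close> and \<open>t\<close> in the third term, and its second part begins
  with \<open>t\<close>.\<close>

lemma splits_qs:
  "drop_unit t (lin splits (qs m t u v)) = drop_unit t (qmul2 m t (splits u) (splits v) :: _ \<Rightarrow>\<^sub>0 'k::field)"
proof (induction m t u v rule: qs.induct)
  case (1 m t v)
  show ?case by (simp add: splits_simps)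
next
  case (2 m t x u)
  show ?case by (simp add: splits_simps)
next
  case (3 m t x u y v)
  let ?M = "qs m t (x # u) (y # v) :: 'a list \<Rightarrow>\<^sub>0 'k"
  have "drop_unit t (lin splits ?M) = drop_unit t (pt (gen []) ?M)
    + pre_left x (drop_unit t (lin splits (qs m t u (y # v))))
    + pre_left y (drop_unit t (lin splits (qs m t (x # u) v)))
    - pre_left (m x y) (pre_left t (drop_unit t (lin splits (qs m t u v))))"
    by (simp add: lin_splits_pre drop_unit_pre_left drop_unit_pt algebra_simps)
  also have "\<dots> = drop_unit t (pt (gen []) ?M)
    + drop_unit t (pre_left x (qmul2 m t (splits u) (splits (y # v))))
    + drop_unit t (pre_left y (qmul2 m t (splits (x # u)) (splits v)))
    - drop_unit t (pre_left (m x y) (pre_left t (qmul2 m t (splits u) (splits v))))"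
    by (simp only: 3 drop_unit_pre_left)
  also have "\<dots> = drop_unit t (qmul2 m t (splits (x # u)) (splits (y # v)))"
    by (simp add: splits_simps(2) qmul2_pre_left qmul2_pre_left_Nil del: qs.simps)
  finally show ?case .
qed

section \<open>The antipode on words\<close>

text \<open>In a connected graded bialgebra the identity \<open>S * id = \<epsilon>\<close> determines \<open>S\<close> recursively, since the
  summand \<open>S w * 1\<close> is the only one that applies \<open>S\<close> to a word as long as \<open>w\<close>. In the same way
  \<open>id * S = \<epsilon>\<close> determines \<open>right_antipode_word\<close>.\<close>

function antipode_word :: "('a \<Rightarrow> 'a \<Rightarrow> 'a) \<Rightarrow> 'a \<Rightarrow> 'a list \<Rightarrow> ('a list \<Rightarrow>\<^sub>0 'k::field)"
  where "antipode_word m t w = (if w = [] then gen [] else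
    - (\<Sum>i<length w. qmul m t (antipode_word m t (take i w)) (gen (drop i w))))"
  by auto
termination by (relation "measure (\<lambda>(m, t, w). length w)") auto

function right_antipode_word :: "('a \<Rightarrow> 'a \<Rightarrow> 'a) \<Rightarrow> 'a \<Rightarrow> 'a list \<Rightarrow> ('a list \<Rightarrow>\<^sub>0 'k::field)"
  where "right_antipode_word m t w = (if w = [] then gen [] else
    - (\<Sum>i<length w. qmul m t (gen (take (Suc i) w)) (right_antipode_word m t (drop (Suc i) w))))"
  by auto
termination by (relation "measure (\<lambda>(m, t, w). length w)") auto

declare antipode_word.simps [simp del] right_antipode_word.simps [simp del]

lemma antipode_word_left:
  "split_sum (\<lambda>a b. qmul m t (antipode_word m t a) (gen b)) w = (if w = [] then gen [] else 0)"
proof (cases "w = []")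
  case False
  then show ?thesis
    by (simp add: split_sum_def flip: lessThan_Suc_atMost) (subst (2) antipode_word.simps, simp)
qed (simp add: antipode_word.simps)

lemma right_antipode_word_right:
  "split_sum (\<lambda>a b. qmul m t (gen a) (right_antipode_word m t b)) w = (if w = [] then gen [] else 0)"
proof (cases "w = []")
  case False
  then show ?thesis
    by (simp add: split_sum_def sum.atMost_shift) (subst right_antipode_word.simps, simp)
qed (simp add: right_antipode_word.simps)

text \<open>Convolution is associative, so a left inverse and a right inverse of the identity coincide.\<close>

lemma (in letter_monoid) antipode_word_eq:
  "antipode_word m t w = (right_antipode_word m t w :: 'a list \<Rightarrow>\<^sub>0 'k::field)"
proof -
  let ?S = "antipode_word m t :: 'a list \<Rightarrow> ('a list \<Rightarrow>\<^sub>0 'k)" and ?S' = "right_antipode_word m t"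
  have "?S w = split_sum (\<lambda>a b. qmul m t (?S a) (if b = [] then gen [] else 0)) w"
    by (simp add: if_distrib[of "qmul m t _"] cong: if_cong)
  also have "\<dots> = split_sum (\<lambda>a b. split_sum (\<lambda>c d. qmul m t (qmul m t (?S a) (gen c)) (?S' d)) b) w"
    unfolding right_antipode_word_right[symmetric, of _ m t]
    by (simp add: split_sum_def qmul_assoc)
  also have "\<dots> = split_sum (\<lambda>a b. qmul m t (split_sum (\<lambda>c d. qmul m t (?S c) (gen d)) a) (?S' b)) w"
    unfolding split_sum_coassoc[symmetric] by (simp add: split_sum_def)
  also have "\<dots> = split_sum (\<lambda>a b. if a = [] then ?S' b else 0) w"
    unfolding antipode_word_left by (rule arg_cong2[where f = split_sum]) (auto intro!: ext)
  also have "\<dots> = ?S' w" by simp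
  finally show ?thesis .
qed

lemma (in letter_monoid) antipode_word_right:
  "split_sum (\<lambda>a b. qmul m t (gen a) (antipode_word m t b)) w = (if w = [] then gen [] else 0)"
  unfolding antipode_word_eq by (rule right_antipode_word_right)

lemma antipode_word_degree:
  assumes V: "\<And>x y. \<lbrakk>x \<in> V; y \<in> V\<rbrakk> \<Longrightarrow> m x y \<in> V" "t \<in> V" and "w \<in> lists V"
  shows "(antipode_word m t w :: 'a list \<Rightarrow>\<^sub>0 'k::field) \<in> carrier (Free {u \<in> lists V. length u = length w})"
  using assms(3)
proof (induction "length w" arbitrary: w rule: less_induct)
  case less
  show ?case
  proof (cases "w = []")
    case False
    have "(qmul m t (antipode_word m t (take i w)) (gen (drop i w)) :: 'a list \<Rightarrow>\<^sub>0 'k)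
        \<in> carrier (Free {u \<in> lists V. length u = length w})" if "i < length w" for i
    proof -
      have "(antipode_word m t (take i w) :: 'a list \<Rightarrow>\<^sub>0 'k) \<in> carrier (Free {u \<in> lists V. length u = i})"
        using less(1)[of "take i w"] less(2) that by (auto dest: in_set_takeD)
      then show ?thesis
        unfolding qmul_def lin_gen
      proof (rule lin_closed[rotated])
        fix u assume u: "u \<in> {u \<in> lists V. length u = i}"
        have "drop i w \<in> lists V" using less by (auto dest: in_set_dropD)
        with u that show "(qs m t u (drop i w) :: 'a list \<Rightarrow>\<^sub>0 'k) \<in> carrier (Free {u \<in> lists V. length u = length w})"
          using qs_degree[of V m t u "drop i w", OF V] by simp
      qed
    qed
    then show ?thesis
      using False by (subst antipode_word.simps) (auto intro!: Free_uminus Free_sum)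
  qed (simp add: antipode_word.simps)
qed

section \<open>The quasi-shuffle product respects the relations\<close>

text \<open>The algebra \<open>R\<^sub>1\<close> with the product \<open>m x y = x y t\<^sup>-\<^sup>1\<close> and the unit \<open>t\<close>; division by \<open>t\<close> identifies it
  with \<open>R\<^sub>0\<close>. The product is left abstract here because the opposite product is needed, too.\<close>

locale letter_algebra = vector_space sc + letter_monoid m t
  for sc :: "'k::field \<Rightarrow> 'a::ring_1 \<Rightarrow> 'a" and m :: "'a \<Rightarrow> 'a \<Rightarrow> 'a" and t :: 'a +
  fixes R :: "int \<Rightarrow> 'a set" and L :: "'a set"
  assumes letters_subspace: "subspace (R 1)"
    and m_add: "m (x + y) z = m x z + m y z" "m z (x + y) = m z x + m z y"
    and m_scale: "m (sc c x) y = sc c (m x y)" "m x (sc c y) = sc c (m x y)"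
    and m_closed: "\<lbrakk>x \<in> R 1; y \<in> R 1\<rbrakk> \<Longrightarrow> m x y \<in> R 1"
    and t_letter: "t \<in> R 1"
    and line_eq: "L = range (\<lambda>c. sc c t)"
begin

abbreviation V :: "'a set" where "V \<equiv> R 1"
abbreviation W :: "'a list set" where "W \<equiv> lists V"

abbreviation mult (infixl \<open>\<star>\<close> 70) where "p \<star> q \<equiv> qmul m t p q"

abbreviation TR :: "('a list \<Rightarrow>\<^sub>0 'k) set" where "TR \<equiv> T_rels sc V"

lemma opposite_letter_algebra: "letter_algebra sc (\<lambda>x y. m y x) t R L"
proof -
  interpret op: letter_monoid "\<lambda>x y. m y x" t by (rule opposite)
  show ?thesis
    by unfold_locales (simp_all add: letters_subspace m_add m_scale m_closed t_letter line_eq)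
qed

lemma line_sub_V: "L \<subseteq> V"
  using t_letter letters_subspace by (auto simp: line_eq subspace_scale)

lemma line_subspace: "subspace L"
proof -
  have "L = span {t}" by (simp add: line_eq span_singleton)
  then show ?thesis by simp
qed

text \<open>Additivity in a letter is the case \<open>c = d = 1\<close> and homogeneity the case \<open>d = 0\<close>, so that both kinds
  of multilinearity relations are treated at once.\<close>

definition mrel :: "'a list \<Rightarrow> 'a list \<Rightarrow> 'k \<Rightarrow> 'a \<Rightarrow> 'k \<Rightarrow> 'a \<Rightarrow> ('a list \<Rightarrow>\<^sub>0 'k)"
  where "mrel u v c x d y =
    gen (u @ (sc c x + sc d y) # v) - c *\<^sub>F gen (u @ x # v) - d *\<^sub>F gen (u @ y # v)"

lemma TR_Free: "TR \<subseteq> carrier (Free W)"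
proof -
  have "x + y \<in> V" "sc c x \<in> V" if "x \<in> V" "y \<in> V" for x y c
    using that letters_subspace by (auto simp: subspace_add subspace_scale)
  then show ?thesis
    unfolding multilinear_rels_def by (intro Un_least subsetI) (auto intro!: Free_diff Free_single)
qed

lemma TR_E:
  assumes "q \<in> TR"
  obtains u v c x d y where "u \<in> W" "v \<in> W" "x \<in> V" "y \<in> V" "q = mrel u v c x d y"
  using assms unfolding multilinear_rels_def
proof (elim UnE CollectE exE conjE)
  fix u v x y
  assume *: "u \<in> W" "v \<in> W" "x \<in> V" "y \<in> V"
    and "q = gen (u @ (x + y) # v) - gen (u @ x # v) - gen (u @ y # v)"
  then have "q = mrel u v 1 x 1 y" by (simp add: mrel_def)
  with * show thesis by (rule that)
next
  fix u v c x
  assume *: "u \<in> W" "v \<in> W" "x \<in> V"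
    and "q = gen (u @ sc c x # v) - Poly_Mapping.single (u @ x # v) c"
  then have "q = mrel u v c x 0 x" by (simp add: mrel_def free_scale_single)
  with * show thesis by (intro that[of u v x x c 0])
qed

lemma mrel_in_span:
  assumes "u \<in> W" "v \<in> W" "x \<in> V" "y \<in> V"
  shows "mrel u v c x d y \<in> free.span TR"
proof -
  have add: "gen (u @ (a + b) # v) - gen (u @ a # v) - gen (u @ b # v) \<in> free.span TR"
    if "a \<in> V" "b \<in> V" for a b
    by (intro free.span_base, unfold multilinear_rels_def, rule UnI1) (use assms that in blast)
  have scale: "gen (u @ sc e a # v) - e *\<^sub>F gen (u @ a # v) \<in> free.span TR" if "a \<in> V" for e a
    by (simp only: free_scale_single mult_1_right, intro free.span_base, unfold multilinear_rels_def, rule UnI2)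
      (use assms that in blast)
  have "sc c x \<in> V" "sc d y \<in> V"
    using assms letters_subspace by (auto simp: subspace_scale)
  from free.span_add[OF free.span_add[OF add[OF this] scale[OF assms(3), of c]] scale[OF assms(4), of d]]
  show ?thesis by (simp add: mrel_def algebra_simps)
qed

lemma span_TR_Free: "q \<in> free.span TR \<Longrightarrow> q \<in> carrier (Free W)"
  using span_Free[OF TR_Free] by blast

lemma pre_Free: "\<lbrakk>a \<in> V; p \<in> carrier (Free W)\<rbrakk> \<Longrightarrow> pre a p \<in> carrier (Free W)"
  by (rule lin_closed[of W]) auto

lemma pre_mrel: "pre a (mrel u v c x d y) = mrel (a # u) v c x d y"
  by (simp add: mrel_def)

lemma pre_span:
  assumes "a \<in> V" "q \<in> free.span TR"
  shows "pre a q \<in> free.span TR"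
proof (rule span_lin_image[OF _ assms(2)])
  fix q assume "q \<in> TR"
  then show "pre a q \<in> free.span TR"
    by (rule TR_E) (use assms(1) in \<open>auto simp: pre_mrel intro!: mrel_in_span\<close>)
qed

lemma pre_comb:
  assumes "x \<in> V" "y \<in> V" "p \<in> carrier (Free W)"
  shows "pre (sc c x + sc d y) p - c *\<^sub>F pre x p - d *\<^sub>F pre y p \<in> free.span TR"
proof -
  have "lin (\<lambda>w. mrel [] w c x d y) p \<in> free.span TR"
    by (rule lin_in_subspace[OF _ _ assms(3)]) (use assms in \<open>auto intro: mrel_in_span\<close>)
  then show ?thesis
    by (simp add: mrel_def lin_fun_diff lin_fun_scale)
qed

lemma qs_words: "\<lbrakk>u \<in> W; v \<in> W\<rbrakk> \<Longrightarrow> qs m t u v \<in> carrier (Free W)"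
  using qmul_closed[of V m t "gen u" "gen v"] by (simp add: m_closed t_letter)

lemma qmul_words: "\<lbrakk>p \<in> carrier (Free W); q \<in> carrier (Free W)\<rbrakk> \<Longrightarrow> p \<star> q \<in> carrier (Free W)"
  by (rule qmul_closed) (auto simp: m_closed t_letter)

text \<open>In every term of the recursion the relation is inherited by a shorter word, or it is a relation in
  the letter that is taken off. In the latter case it remains one, since \<open>m\<close> is linear in its first
  argument.\<close>

lemma mrel_qmul:
  assumes "u \<in> W" "v \<in> W" "x \<in> V" "y \<in> V" "w \<in> W"
  shows "mrel u v c x d y \<star> gen w \<in> free.span TR"
  using assms(1,5)
proof (induction u arbitrary: w)
  case Nil
  from Nil show ?case
  proof (induction w)
    case Nil
    show ?case using assms by (simp add: mrel_in_span)
  next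
    case (Cons b w)
    let ?z = "sc c x + sc d y"
    have z: "m ?z b = sc c (m x b) + sc d (m y b)" by (simp add: m_add m_scale)
    have mem: "pre t (qs m t v w) \<in> carrier (Free W)" "qs m t v (b # w) \<in> carrier (Free W)"
      using assms Cons t_letter by (auto intro!: pre_Free qs_words)
    have IH: "mrel [] v c x d y \<star> gen w \<in> free.span TR" using Cons by simp
    have "mrel [] v c x d y \<star> gen (b # w) =
      (pre ?z (qs m t v (b # w)) - c *\<^sub>F pre x (qs m t v (b # w)) - d *\<^sub>F pre y (qs m t v (b # w)))
      + pre b (mrel [] v c x d y \<star> gen w)
      - (pre (m ?z b) (pre t (qs m t v w)) - c *\<^sub>F pre (m x b) (pre t (qs m t v w))
          - d *\<^sub>F pre (m y b) (pre t (qs m t v w)))"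
      by (simp add: mrel_def algebra_simps free.scale_right_distrib free.scale_right_diff_distrib)
    also have "\<dots> \<in> free.span TR"
      unfolding z
      by (intro free.span_add free.span_diff pre_comb pre_span IH mem)
        (use Cons assms m_closed in auto)
    finally show ?case .
  qed
next
  case (Cons a u)
  note outer = this
  have au: "a \<in> V" "u \<in> W" and w: "w \<in> W" using outer by auto
  from w show ?case
  proof (induction w)
    case Nil
    show ?case using assms au by (simp add: mrel_in_span)
  next
    case (Cons b w)
    have "mrel (a # u) v c x d y \<star> gen (b # w) =
      pre a (mrel u v c x d y \<star> gen (b # w)) + pre b (mrel (a # u) v c x d y \<star> gen w)
      - pre (m a b) (pre t (mrel u v c x d y \<star> gen w))"
      by (simp add: mrel_def algebra_simps free.scale_right_distrib free.scale_right_diff_distrib)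
    also have "\<dots> \<in> free.span TR"
      using Cons au outer
      by (intro free.span_add free.span_diff pre_span) (auto simp: m_closed t_letter)
    finally show ?case .
  qed
qed

lemma span_qmul_left:
  assumes "q \<in> free.span TR" "p \<in> carrier (Free W)"
  shows "q \<star> p \<in> free.span TR"
proof -
  have *: "lin (\<lambda>u. qs m t u w) q \<in> free.span TR" if "w \<in> W" for w
    by (rule span_lin_image[OF _ assms(1)])
      (elim TR_E, use mrel_qmul that in \<open>simp add: qmul_def\<close>)
  have "q \<star> p = lin (\<lambda>w. q \<star> gen w) p"
    by (induction p rule: free_induct[OF Free_UNIV]) simp_all
  also have "\<dots> \<in> free.span TR"
    by (rule lin_in_subspace[OF _ _ assms(2)]) (use * in \<open>auto simp: qmul_def\<close>)
  finally show ?thesis .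
qed

lemma span_qmul_right:
  assumes "q \<in> free.span TR" "p \<in> carrier (Free W)"
  shows "p \<star> q \<in> free.span TR"
  using letter_algebra.span_qmul_left[OF opposite_letter_algebra assms] unfolding qmul_opposite[of m] .

section \<open>The space \<open>A(R)\<close> as a quotient of the space of words\<close>

text \<open>Generators of the kernel of the map from words to \<open>A(R)\<close>; see \<open>\<gamma>_eq_iff\<close>.\<close>

definition KR :: "('a list \<Rightarrow>\<^sub>0 'k) set"
  where "KR = TR \<union> {gen (l # w) | l w. l \<in> L \<and> w \<in> W}"

lemma KR_Free: "KR \<subseteq> carrier (Free W)"
  using TR_Free line_sub_V by (auto simp: KR_def intro!: Free_single)

lemma span_TR_KR: "q \<in> free.span TR \<Longrightarrow> q \<in> free.span KR"
  using free.span_mono[of TR KR] by (auto simp: KR_def)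

lemma span_KR_Free: "q \<in> free.span KR \<Longrightarrow> q \<in> carrier (Free W)"
  using span_Free[OF KR_Free] by blast

lemma gen_line: "\<lbrakk>l \<in> L; w \<in> W\<rbrakk> \<Longrightarrow> gen (l # w) \<in> free.span KR"
  by (rule free.span_base) (auto simp: KR_def)

lemma pre_t_KR: "p \<in> carrier (Free W) \<Longrightarrow> pre t p \<in> free.span KR"
proof (rule lin_in_subspace[of _ W])
  have "t \<in> L" using rangeI[of "\<lambda>c. sc c t" 1] by (simp add: line_eq)
  then show "gen (t # w) \<in> free.span KR" if "w \<in> W" for w
    using that by (rule gen_line)
qed auto

text \<open>Up to multilinearity a word that begins with \<open>c t\<close> is \<open>c\<close> times a word that begins with \<open>t\<close>, and a
  product with a factor that begins with \<open>t\<close> begins with \<open>t\<close>.\<close>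

lemma KR_qmul_left:
  assumes "q \<in> free.span KR" "p \<in> carrier (Free W)"
  shows "q \<star> p \<in> free.span KR"
proof -
  have "gen (l # w) \<star> p \<in> free.span KR" if lw: "l \<in> L" "w \<in> W" for l w
  proof -
    obtain c where l: "l = sc c t" using lw by (auto simp: line_eq)
    have "mrel [] w c t 0 t \<star> p \<in> free.span KR"
      using lw assms t_letter by (intro span_TR_KR span_qmul_left mrel_in_span) auto
    moreover have "c *\<^sub>F (pre t (gen w) \<star> p) \<in> free.span KR"
      unfolding pre_unit_qmul using lw assms by (intro free.span_scale pre_t_KR qmul_words) auto
    ultimately have "mrel [] w c t 0 t \<star> p + c *\<^sub>F (pre t (gen w) \<star> p) \<in> free.span KR"
      by (rule free.span_add)
    then show ?thesis by (simp add: mrel_def l)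
  qed
  moreover have "q \<star> p \<in> free.span KR" if "q \<in> TR" for q
    using that assms(2) by (intro span_TR_KR span_qmul_left free.span_base)
  ultimately have gens: "q \<star> p \<in> free.span KR" if "q \<in> KR" for q
    using that unfolding KR_def by blast
  show ?thesis
    using assms(1)
  proof (induction q rule: free.span_induct_alt)
    case (step c q r)
    then show ?case by (simp add: gens free.span_add free.span_scale)
  qed (simp add: free.span_zero)
qed

lemma KR_qmul_right:
  assumes "q \<in> free.span KR" "p \<in> carrier (Free W)"
  shows "p \<star> q \<in> free.span KR"
proof -
  interpret op: letter_algebra sc "\<lambda>x y. m y x" t R L by (rule opposite_letter_algebra)
  show ?thesis using op.KR_qmul_left[OF assms] unfolding qmul_opposite[of m] .
qed

abbreviation barred :: "('a list \<Rightarrow>\<^sub>0 'k) \<Rightarrow> ('a bar_word \<Rightarrow>\<^sub>0 'k)"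
  where "barred \<equiv> lin (\<lambda>w. gen (bar L w))"

abbreviation AR :: "('a bar_word \<Rightarrow>\<^sub>0 'k) set" where "AR \<equiv> A_rels sc R L"

lemma AR_eq: "AR = barred ` TR"
  unfolding multilinear_rels_def image_Un
  by (intro arg_cong2[where f = "(\<union>)"])
    (force simp: image_def lin_single free_scale_single)+

lemma AR_Free: "AR \<subseteq> carrier (Free (bar L ` W))"
  using TR_Free by (auto simp: AR_eq intro!: lin_closed[of W] Free_single)

lemma coset_line_eq: "x +o L = y +o L \<longleftrightarrow> x - y \<in> L"
proof
  assume "x +o L = y +o L"
  moreover have "x \<in> x +o L"
    using subspace_0[OF line_subspace] by (auto simp: elt_set_plus_def intro!: bexI[of _ 0])
  ultimately show "x - y \<in> L" by (auto simp: elt_set_plus_def)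
next
  assume *: "x - y \<in> L"
  have "z \<in> x +o L \<longleftrightarrow> z \<in> y +o L" for z
  proof -
    have mem: "z \<in> a +o L \<longleftrightarrow> z - a \<in> L" for a
      by (auto simp: elt_set_plus_def algebra_simps intro!: bexI[of _ "z - a"])
    show ?thesis
      using subspace_add[OF line_subspace *, of "z - x"] subspace_diff[OF line_subspace _ *, of "z - y"]
      by (auto simp: mem algebra_simps)
  qed
  then show "x +o L = y +o L" by blast
qed

lemma bar_eq_KR:
  assumes "bar L u = bar L w" "u \<in> W" "w \<in> W"
  shows "gen u - gen w \<in> free.span KR"
proof (cases u)
  case Nil
  then show ?thesis using assms(1) by (cases w) (auto simp: free.span_zero)
next
  case (Cons x u')
  then obtain y where w: "w = y # u'" "x - y \<in> L"
    using assms(1) by (cases w) (auto simp: coset_line_eq)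
  have "mrel [] u' 1 y 1 (x - y) \<in> free.span KR" "gen ((x - y) # u') \<in> free.span KR"
    using assms w Cons line_sub_V by (auto intro!: span_TR_KR[OF mrel_in_span] gen_line)
  then have "mrel [] u' 1 y 1 (x - y) + gen ((x - y) # u') \<in> free.span KR"
    by (rule free.span_add)
  then show ?thesis by (simp add: mrel_def Cons w)
qed

lemma barred_KR: "q \<in> free.span KR \<Longrightarrow> barred q \<in> free.span AR"
proof (rule span_lin_image)
  fix q assume "q \<in> KR"
  then show "barred q \<in> free.span AR"
    unfolding KR_def
  proof (elim UnE CollectE exE conjE)
    fix l w assume lw: "l \<in> L" "w \<in> W" and q: "q = gen (l # w)"
    \<comment> \<open>The coset of \<open>l\<close> is the zero coset, so this is homogeneity in the first letter for the
      scalar \<open>0\<close>.\<close>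
    have "barred (Poly_Mapping.single ([] @ sc 0 t # w) 1 - Poly_Mapping.single ([] @ t # w) 0) \<in> AR"
      unfolding AR_eq by (rule imageI, unfold multilinear_rels_def, rule UnI2) (use lw t_letter in blast)
    moreover have "l +o L = 0 +o L" using lw by (subst coset_line_eq) simp
    ultimately show ?thesis
      by (simp add: q free.span_base del: set_zero_plus)
  qed (auto simp: AR_eq intro: free.span_base)
qed

text \<open>A section of \<^const>\<open>bar\<close> induces an inverse of \<open>barred\<close> up to the relations in \<open>KR\<close>.\<close>

lemma barred_in_span_iff:
  assumes "p \<in> carrier (Free W)"
  shows "barred p \<in> free.span AR \<longleftrightarrow> p \<in> free.span KR"
proof
  define \<sigma> where "\<sigma> b = (SOME w. w \<in> W \<and> bar L w = b)" for b
  have \<sigma>: "\<sigma> (bar L w) \<in> W" "bar L (\<sigma> (bar L w)) = bar L w" if "w \<in> W" for w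
    using someI[of "\<lambda>u. u \<in> W \<and> bar L u = bar L w" w] that by (auto simp: \<sigma>_def)
  have section_inv: "lin (\<lambda>b. gen (\<sigma> b)) (barred q) - q \<in> free.span KR" if "q \<in> carrier (Free W)" for q
  proof -
    have "lin (\<lambda>w. gen (\<sigma> (bar L w)) - gen w) q \<in> free.span KR"
      by (rule lin_in_subspace[OF _ _ that]) (auto intro!: bar_eq_KR \<sigma>)
    then show ?thesis by (simp add: lin_lin lin_fun_diff)
  qed
  assume "barred p \<in> free.span AR"
  then have "lin (\<lambda>b. gen (\<sigma> b)) (barred p) \<in> free.span KR"
  proof (rule span_lin_image[rotated])
    fix r assume "r \<in> AR"
    then obtain q where q: "r = barred q" "q \<in> TR" by (auto simp: AR_eq)
    have "lin (\<lambda>b. gen (\<sigma> b)) r - q \<in> free.span KR" "q \<in> free.span KR"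
      using q TR_Free section_inv[of q] span_TR_KR[OF free.span_base, of q] by auto
    from free.span_add[OF this] show "lin (\<lambda>b. gen (\<sigma> b)) r \<in> free.span KR" by simp
  qed
  from free.span_diff[OF this section_inv[OF assms]] show "p \<in> free.span KR" by simp
qed (rule barred_KR)

text \<open>The composite of \<open>\<tau>\<close> below and \<^const>\<open>proj\<close>. Every element of \<open>A(R)\<close> is of the form \<open>\<gamma> p\<close>, and all
  operations on \<open>A(R)\<close> are computed by operations on \<open>p\<close>.\<close>

definition \<gamma> :: "('a list \<Rightarrow>\<^sub>0 'k) \<Rightarrow> ('a bar_word \<Rightarrow>\<^sub>0 'k) set"
  where "\<gamma> p = barred p +o free.span AR"

lemma \<gamma>_eq_iff:
  "\<lbrakk>p \<in> carrier (Free W); q \<in> carrier (Free W)\<rbrakk> \<Longrightarrow> \<gamma> p = \<gamma> q \<longleftrightarrow> p - q \<in> free.span KR"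
  using barred_in_span_iff[of "p - q"] by (simp add: \<gamma>_def coset_eq_iff)

lemma \<gamma>_gen: "\<gamma> (gen w) = gen_class AR (bar L w)"
  by (simp add: \<gamma>_def gen_class_def)

lemma Free_image_lin:
  "p \<in> carrier (Free (f ` S)) \<Longrightarrow> \<exists>q\<in>carrier (Free S). p = lin (\<lambda>s. gen (f s)) q"
proof (induction p rule: free_induct)
  case zero
  show ?case by (rule bexI[of _ 0]) simp_all
next
  case (step c s p)
  then obtain s' q where *: "s = f s'" "s' \<in> S" "q \<in> carrier (Free S)" "p = lin (\<lambda>s. gen (f s)) q"
    by blast
  then show ?case by (intro bexI[of _ "c *\<^sub>F gen s' + q"]) simp_all
qed

lemma lin_map_\<gamma>: "lin_map (Free W) (A_space sc R L) \<gamma>"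
  unfolding A_space_def \<gamma>_def
  by (rule lin_map_comp[OF lin_map_lin_Free lin_map_coset]) auto

lemma A_space_E:
  assumes "a \<in> carrier (A_space sc R L)"
  obtains p where "p \<in> carrier (Free W)" "a = \<gamma> p"
  using assms Free_image_lin[of _ "bar L" W] by (auto simp: A_space_def carrier_presented \<gamma>_def)

section \<open>The product on \<open>A(R)\<close>\<close>

definition \<tau> :: "('a list \<Rightarrow>\<^sub>0 'k) \<Rightarrow> ('a list \<Rightarrow>\<^sub>0 'k) set"
  where "\<tau> p = p +o free.span TR"

lemma lin_map_\<tau>: "lin_map (Free W) (T_space sc V) \<tau>"
  unfolding T_space_def \<tau>_def by (rule lin_map_coset)

lemma vspace_T [simp]: "vspace (T_space sc V)"
  by (simp add: T_space_def)

lemma vspace_A [simp]: "vspace (A_space sc R L)"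
  by (simp add: A_space_def)

lemma \<gamma>_closed: "p \<in> carrier (Free W) \<Longrightarrow> \<gamma> p \<in> carrier (A_space sc R L)"
  by (rule lin_mapD(1)[OF lin_map_\<gamma>])

lemma \<gamma>_TR: "q \<in> free.span TR \<Longrightarrow> \<gamma> q = \<zero>\<^bsub>A_space sc R L\<^esub>"
  using \<gamma>_eq_iff[of q 0] lin_map_Free_0[OF vspace_A lin_map_\<gamma>] span_TR_Free span_TR_KR by simp

lemma proj_\<tau>:
  assumes "p \<in> carrier (Free W)"
  shows "proj sc R L (\<tau> p) = \<gamma> p"
proof -
  let ?A = "A_space sc R L"
  have g: "\<gamma> (gen w) \<in> carrier ?A" if "w \<in> W" for w
    using that by (intro \<gamma>_closed) auto
  have L: "lincomb ?A (\<lambda>w. \<gamma> (gen w)) p = \<gamma> p" if "p \<in> carrier (Free W)" for p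
    using lincomb_lin_map[OF vspace_A lin_map_\<gamma> _ that, of gen] by simp
  have "lincomb ?A (\<lambda>w. \<gamma> (gen w)) q = \<zero>\<^bsub>?A\<^esub>" if "q \<in> TR" for q
    using that TR_Free \<gamma>_TR[OF free.span_base] by (auto simp: L subset_iff)
  then show ?thesis
    unfolding proj_def \<tau>_def \<gamma>_gen[symmetric]
    by (subst extend_coset[where S = W]) (use assms in \<open>auto simp: g L TR_Free\<close>)
qed

end

locale ring_letter_algebra = letter_algebra sc m t R L
  for sc :: "'k::field \<Rightarrow> 'a::ring_1 \<Rightarrow> 'a" and m :: "'a \<Rightarrow> 'a \<Rightarrow> 'a" and t :: 'a
    and R :: "int \<Rightarrow> 'a set" and L :: "'a set" +
  assumes m_eq: "m x y = x * y * ring_inverse t"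
begin

lemma quasi_shuffle_eq: "quasi_shuffle t u v = qs m t u v"
  unfolding quasi_shuffle_eq_qs by (rule arg_cong[where f = "\<lambda>m. qs m t u v"]) (simp add: m_eq fun_eq_iff)

lemma T_product_\<tau>:
  assumes "p \<in> carrier (Free W)" "q \<in> carrier (Free W)"
  shows "T_product sc R t (\<tau> p) (\<tau> q) = \<tau> (p \<star> q)"
proof -
  let ?T = "T_space sc V"
  note \<tau> = lin_mapD[OF lin_map_\<tau>]
  have zero: "\<tau> r = \<zero>\<^bsub>?T\<^esub>" if "r \<in> free.span TR" for r
    using that coset_eq_iff[of r TR 0] lin_map_Free_0[OF vspace_T lin_map_\<tau>] by (simp add: \<tau>_def)
  have inner: "extend ?T (\<lambda>v. \<tau> (qs m t u v)) (\<tau> q) = \<tau> (gen u \<star> q)" if u: "u \<in> W" for u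
  proof -
    have L: "lincomb ?T (\<lambda>v. \<tau> (qs m t u v)) r = \<tau> (gen u \<star> r)" if "r \<in> carrier (Free W)" for r
      using lincomb_lin_map[OF vspace_T lin_map_\<tau> _ that, of "qs m t u"] u
      by (simp add: qs_words qmul_def)
    have "lincomb ?T (\<lambda>v. \<tau> (qs m t u v)) r = \<zero>\<^bsub>?T\<^esub>" if "r \<in> TR" for r
      using that TR_Free u by (simp add: L subset_iff zero span_qmul_right free.span_base)
    then show ?thesis
      unfolding \<tau>_def[of q]
      by (subst extend_coset[where S = W]) (use assms(2) u in \<open>auto simp: \<tau> L TR_Free qs_words\<close>)
  qed
  let ?F = "\<lambda>u. extend ?T (\<lambda>v. \<tau> (qs m t u v)) (\<tau> q)"
  have L: "lincomb ?T ?F r = \<tau> (r \<star> q)" if r: "r \<in> carrier (Free W)" for r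
  proof -
    have "lincomb ?T ?F r = lincomb ?T (\<lambda>u. \<tau> (gen u \<star> q)) r"
      by (rule lincomb_cong[OF _ _ _ r]) (use assms in \<open>auto simp: inner \<tau> qmul_words\<close>)
    also have "\<dots> = \<tau> (lin (\<lambda>u. gen u \<star> q) r)"
      by (rule lincomb_lin_map[OF vspace_T lin_map_\<tau> _ r]) (use assms in \<open>auto simp: qmul_words\<close>)
    finally show ?thesis by (simp add: qmul_def)
  qed
  have "lincomb ?T ?F r = \<zero>\<^bsub>?T\<^esub>" if "r \<in> TR" for r
    using that TR_Free assms by (simp add: L subset_iff zero span_qmul_left free.span_base)
  then have "extend ?T ?F (\<tau> p) = \<tau> (p \<star> q)"
    unfolding \<tau>_def[of p]
    by (subst extend_coset[where S = W]) (use assms in \<open>auto simp: inner L \<tau> TR_Free qmul_words\<close>)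
  then show ?thesis
    by (simp add: T_product_def Let_def quasi_shuffle_eq \<tau>_def)
qed

text \<open>The subspace spanned by \<open>KR\<close> is an ideal, so all lifts give the same value.\<close>

lemma A_product_\<gamma>:
  assumes p: "p \<in> carrier (Free W)" and q: "q \<in> carrier (Free W)"
  shows "A_product sc R L t (\<gamma> p) (\<gamma> q) = \<gamma> (p \<star> q)"
  unfolding A_product_def
proof (rule the_equality)
  show "\<forall>X\<in>carrier (T_space sc V). \<forall>Y\<in>carrier (T_space sc V).
    proj sc R L X = \<gamma> p \<longrightarrow> proj sc R L Y = \<gamma> q \<longrightarrow> \<gamma> (p \<star> q) = proj sc R L (T_product sc R t X Y)"
  proof (intro ballI impI)
    fix X Y assume "X \<in> carrier (T_space sc V)" "Y \<in> carrier (T_space sc V)"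
    then obtain p' q' where X: "X = \<tau> p'" "p' \<in> carrier (Free W)" and Y: "Y = \<tau> q'" "q' \<in> carrier (Free W)"
      by (auto simp: T_space_def carrier_presented \<tau>_def)
    assume "proj sc R L X = \<gamma> p" "proj sc R L Y = \<gamma> q"
    then have "p - p' \<in> free.span KR" "q - q' \<in> free.span KR"
      using X Y p q \<gamma>_eq_iff[of p p'] \<gamma>_eq_iff[of q q'] by (auto simp: proj_\<tau>)
    then have "(p - p') \<star> q + p' \<star> (q - q') \<in> free.span KR"
      using X Y p q by (intro free.span_add KR_qmul_left KR_qmul_right)
    then have "\<gamma> (p \<star> q) = \<gamma> (p' \<star> q')"
      using X Y p q by (subst \<gamma>_eq_iff) (auto intro: qmul_words)
    then show "\<gamma> (p \<star> q) = proj sc R L (T_product sc R t X Y)"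
      using X Y by (simp add: T_product_\<tau> proj_\<tau> qmul_words)
  qed
  fix c assume c: "\<forall>X\<in>carrier (T_space sc V). \<forall>Y\<in>carrier (T_space sc V).
    proj sc R L X = \<gamma> p \<longrightarrow> proj sc R L Y = \<gamma> q \<longrightarrow> c = proj sc R L (T_product sc R t X Y)"
  have "c = proj sc R L (T_product sc R t (\<tau> p) (\<tau> q))"
    using c p q by (simp add: proj_\<tau> lin_mapD(1)[OF lin_map_\<tau>])
  then show "c = \<gamma> (p \<star> q)"
    using p q by (simp add: T_product_\<tau> proj_\<tau> qmul_words)
qed

end

section \<open>The algebra and its linear maps\<close>

(* Membership in lists V stays atomic from here on, so that closure lemmas apply to it. *)
declare in_lists_conv_set [simp del] in_listsD [rule del] in_listsI [rule del]

lemma take_drop_in_lists [simp]: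
  assumes "w \<in> lists V"
  shows "take i w \<in> lists V" "drop i w \<in> lists V"
  using assms by (auto simp: in_lists_conv_set dest: in_set_takeD in_set_dropD)

context ring_letter_algebra
begin

abbreviation H :: "('k, ('a bar_word \<Rightarrow>\<^sub>0 'k) set) module" where "H \<equiv> A_algebra sc R L t"
abbreviation HH where "HH \<equiv> tensor H H"
abbreviation pr where "pr \<equiv> pure_tensor H H"
abbreviation g :: "'a list \<Rightarrow> ('a bar_word \<Rightarrow>\<^sub>0 'k) set" where "g w \<equiv> \<gamma> (gen w)"
abbreviation \<Delta> where "\<Delta> \<equiv> A_coproduct sc R L"

lemma A_algebra_simps:
  "carrier H = carrier (A_space sc R L)" "x \<oplus>\<^bsub>H\<^esub> y = x \<oplus>\<^bsub>A_space sc R L\<^esub> y"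
  "\<zero>\<^bsub>H\<^esub> = \<zero>\<^bsub>A_space sc R L\<^esub>" "c \<odot>\<^bsub>H\<^esub> x = c \<odot>\<^bsub>A_space sc R L\<^esub> x"
  "x \<otimes>\<^bsub>H\<^esub> y = A_product sc R L t x y" "\<one>\<^bsub>H\<^esub> = g []"
  by (simp_all add: A_algebra_def \<gamma>_gen)

lemma vspace_H [simp]: "vspace H"
proof -
  interpret A: vspace "A_space sc R L" by simp
  show ?thesis
    by (rule vspaceI)
      (simp_all add: A_algebra_simps A.a_ac A.scale_add_left A.scale_add_right A.scale_scale
        A.scale_one A.scale_zero_left)
qed

lemma tensor_A_space:
  "tensor (A_space sc R L) (A_space sc R L) = HH"
  "pure_tensor (A_space sc R L) (A_space sc R L) = pr"
proof -
  have "tensor_rels (A_space sc R L) (A_space sc R L) = tensor_rels H H"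
    by (simp add: tensor_rels_def A_algebra_simps)
  then show "tensor (A_space sc R L) (A_space sc R L) = HH"
    "pure_tensor (A_space sc R L) (A_space sc R L) = pr"
    by (simp_all add: tensor_def pure_tensor_def A_algebra_simps fun_eq_iff)
qed

lemma lin_map_\<gamma>_H: "lin_map (Free W) H \<gamma>"
  using lin_map_\<gamma> by (simp add: lin_map_def A_algebra_simps)

lemma \<gamma>_H: "p \<in> carrier (Free W) \<Longrightarrow> \<gamma> p \<in> carrier H"
  by (rule lin_mapD(1)[OF lin_map_\<gamma>_H])

lemma g_closed [simp]: "w \<in> W \<Longrightarrow> g w \<in> carrier H"
  by (rule \<gamma>_H) simp

lemma \<gamma>_0 [simp]: "\<gamma> 0 = \<zero>\<^bsub>H\<^esub>"
  by (rule lin_map_Free_0[OF vspace_H lin_map_\<gamma>_H])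

lemma \<gamma>_KR: "q \<in> free.span KR \<Longrightarrow> \<gamma> q = \<zero>\<^bsub>H\<^esub>"
  using \<gamma>_eq_iff[of q 0] span_KR_Free by simp

lemma H_E:
  assumes "a \<in> carrier H"
  obtains p where "p \<in> carrier (Free W)" "a = \<gamma> p"
  using assms A_space_E by (auto simp: A_algebra_simps)

lemma mult_\<gamma>:
  "\<lbrakk>p \<in> carrier (Free W); q \<in> carrier (Free W)\<rbrakk> \<Longrightarrow> \<gamma> p \<otimes>\<^bsub>H\<^esub> \<gamma> q = \<gamma> (p \<star> q)"
  by (simp add: A_algebra_simps A_product_\<gamma>)

lemma lincomb_g: "\<lbrakk>\<And>s. s \<in> S \<Longrightarrow> F s \<in> carrier (Free W); p \<in> carrier (Free S)\<rbrakk>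
    \<Longrightarrow> lincomb H (\<lambda>s. \<gamma> (F s)) p = \<gamma> (lin F p)"
  by (rule lincomb_lin_map[OF vspace_H lin_map_\<gamma>_H])

lemma \<gamma>_lincomb: "p \<in> carrier (Free W) \<Longrightarrow> \<gamma> p = lincomb H g p"
  using lincomb_g[of W gen p] by simp

lemma lin_map_H_ext:
  assumes "vspace P" "lin_map H P \<phi>" "lin_map H P \<psi>" "\<And>w. w \<in> W \<Longrightarrow> \<phi> (g w) = \<psi> (g w)"
    "a \<in> carrier H"
  shows "\<phi> a = \<psi> a"
proof -
  obtain p where p: "p \<in> carrier (Free W)" "a = \<gamma> p" using assms(5) by (rule H_E)
  show ?thesis
    unfolding p(2)
    by (rule lin_map_Free_ext[OF assms(1) lin_map_comp[OF lin_map_\<gamma>_H assms(2)]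
          lin_map_comp[OF lin_map_\<gamma>_H assms(3)] assms(4) p(1)])
qed

lemma bilin_mult: "bilin_map H H H (\<lambda>x y. x \<otimes>\<^bsub>H\<^esub> y)"
proof -
  note \<gamma> = lin_mapD(2,3)[OF lin_map_\<gamma>_H, symmetric, unfolded Free_simps]
  show ?thesis
    unfolding bilin_map_def
    by (intro conjI ballI lin_mapI; elim H_E; hypsubst) (simp_all add: mult_\<gamma> \<gamma> qmul_words \<gamma>_H)
qed

text \<open>The map on \<open>A(R)\<close> induced by \<open>\<phi>\<close>, through a choice of representatives that is immaterial if \<open>\<phi>\<close>
  kills \<open>KR\<close>.\<close>

definition lift :: "(('a list \<Rightarrow>\<^sub>0 'k) \<Rightarrow> 'p) \<Rightarrow> ('a bar_word \<Rightarrow>\<^sub>0 'k) set \<Rightarrow> 'p"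
  where "lift \<phi> a = \<phi> (SOME p. p \<in> carrier (Free W) \<and> \<gamma> p = a)"

lemma lift:
  assumes "vspace P" "lin_map (Free W) P \<phi>" "\<And>q. q \<in> KR \<Longrightarrow> \<phi> q = \<zero>\<^bsub>P\<^esub>"
  shows lift_\<gamma>: "p \<in> carrier (Free W) \<Longrightarrow> lift \<phi> (\<gamma> p) = \<phi> p"
    and lin_map_lift: "lin_map H P (lift \<phi>)"
proof -
  show lift_\<gamma>: "lift \<phi> (\<gamma> p) = \<phi> p" if "p \<in> carrier (Free W)" for p
  proof -
    have "\<exists>q. q \<in> carrier (Free W) \<and> \<gamma> q = \<gamma> p" using that by blast
    from someI_ex[OF this] show ?thesis
      unfolding lift_def using that
      by (intro lin_map_eq_mod_span[OF assms(1,2) KR_Free assms(3)]) (auto simp: \<gamma>_eq_iff)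
  qed
  note \<gamma> = lin_mapD(2,3)[OF lin_map_\<gamma>_H, symmetric, unfolded Free_simps]
  show "lin_map H P (lift \<phi>)"
    by (rule lin_mapI; elim H_E; hypsubst)
      (simp_all add: \<gamma> lift_\<gamma> lin_mapD[OF assms(2), unfolded Free_simps])
qed

lemma zero_on_KR:
  assumes "\<And>u v x y c d. \<lbrakk>u \<in> W; v \<in> W; x \<in> V; y \<in> V\<rbrakk> \<Longrightarrow> \<phi> (mrel u v c x d y) = z"
    and "\<And>l w. \<lbrakk>l \<in> L; w \<in> W\<rbrakk> \<Longrightarrow> \<phi> (gen (l # w)) = z" and "q \<in> KR"
  shows "\<phi> q = z"
  using assms(3) unfolding KR_def by (elim UnE CollectE exE conjE TR_E) (simp_all add: assms(1,2))

section \<open>The coproduct\<close>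

abbreviation g2 where "g2 \<equiv> \<lambda>(a, b). pr (g a) (g b)"
abbreviation G2 where "G2 \<equiv> lincomb HH g2"

lemma bilin_pr: "bilin_map H H HH pr"
  by (rule bilin_pure_tensor) simp_all

lemma g2_closed: "s \<in> W \<times> W \<Longrightarrow> g2 s \<in> carrier HH"
  by (auto intro!: bilin_mapD(3)[OF bilin_pr])

lemma lin_map_G2: "lin_map (Free (W \<times> W)) HH G2"
  by (rule lin_map_lincomb') (rule vspace_tensor, rule g2_closed)

lemma pr_\<gamma>:
  "\<lbrakk>p \<in> carrier (Free W); q \<in> carrier (Free W)\<rbrakk> \<Longrightarrow> pr (\<gamma> p) (\<gamma> q) = G2 (pt p q)"
  unfolding \<gamma>_lincomb by (rule bilin_lincomb[OF _ _ _ bilin_pr]) auto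

lemma pr_zero:
  assumes "x \<in> carrier H"
  shows "pr \<zero>\<^bsub>H\<^esub> x = \<zero>\<^bsub>HH\<^esub>" "pr x \<zero>\<^bsub>H\<^esub> = \<zero>\<^bsub>HH\<^esub>"
  using lin_map_zero[OF vspace_H vspace_tensor bilin_mapD(1)[OF bilin_pr assms]]
    lin_map_zero[OF vspace_H vspace_tensor bilin_mapD(2)[OF bilin_pr assms]] by auto

text \<open>Cutting the three words of a relation at the same place gives a relation in one of the parts
  and the same word in the other part.\<close>

definition cut_mrel where
  "cut_mrel i u v c x d y = (let cut = (\<lambda>a. gen (take i (u @ a # v), drop i (u @ a # v)))
     in cut (sc c x + sc d y) - c *\<^sub>F cut x - d *\<^sub>F cut y)"

lemma cut_mrel_cases:
  assumes "u \<in> W" "v \<in> W"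
  obtains s s' where "s \<in> W" "s' \<in> W" "cut_mrel i u v c x d y = pt (gen s) (mrel s' v c x d y)"
    | s s' where "s \<in> W" "s' \<in> W" "length u + length s' < i"
      "cut_mrel i u v c x d y = pt (mrel u s' c x d y) (gen s)"
proof (cases "i \<le> length u")
  case True
  have "take i u \<in> W" "drop i u \<in> W" using assms by simp_all
  then show thesis
    using True by (intro that(1)[of "take i u" "drop i u"]) (simp_all add: cut_mrel_def mrel_def)
next
  case False
  then obtain j where i: "i = length u + Suc j"
    using less_imp_Suc_add[of "length u" i] by auto
  have "take j v \<in> W" "drop j v \<in> W" using assms by simp_all
  then show thesis
    using i by (intro that(2)[of "drop j v" "take j v"]) (simp_all add: cut_mrel_def mrel_def)
qed

lemma cut_mrel_Free:
  assumes "u \<in> W" "v \<in> W" "x \<in> V" "y \<in> V"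
  shows "cut_mrel i u v c x d y \<in> carrier (Free (W \<times> W))"
  by (rule cut_mrel_cases[OF assms(1,2), of i c x d y])
    (use assms in \<open>auto intro!: pt_closed Free_single span_TR_Free[OF mrel_in_span]\<close>)

lemma splits_mrel:
  "lin splits (mrel u v c x d y) = (\<Sum>i\<le>Suc (length u + length v). cut_mrel i u v c x d y)"
  by (simp add: mrel_def splits_def split_sum_def cut_mrel_def Let_def sum_subtractf
      free.scale_sum_right del: sum.atMost_Suc)

lemma G2_splits_mrel:
  assumes uv: "u \<in> W" "v \<in> W" "x \<in> V" "y \<in> V"
  shows "G2 (lin splits (mrel u v c x d y)) = \<zero>\<^bsub>HH\<^esub>"
proof -
  interpret HH: vspace HH by simp
  have rel: "\<gamma> (mrel s s' c x d y) = \<zero>\<^bsub>H\<^esub>" "mrel s s' c x d y \<in> carrier (Free W)"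
    if "s \<in> W" "s' \<in> W" for s s'
    using that uv by (auto intro!: \<gamma>_KR span_TR_KR span_TR_Free mrel_in_span)
  have "G2 (cut_mrel i u v c x d y) = \<zero>\<^bsub>HH\<^esub>" for i
    by (rule cut_mrel_cases[OF uv(1,2), of i c x d y])
      (use rel uv in \<open>auto simp: pr_zero simp flip: pr_\<gamma>\<close>)
  then show ?thesis
    unfolding splits_mrel
    by (subst lin_map_sum[OF _ lin_map_G2]) (use uv in \<open>auto intro!: cut_mrel_Free\<close>)
qed

lemma deconcat_bar:
  assumes w: "w \<in> W"
  shows "deconcat sc R L (bar L w) = G2 (splits w)"
proof (cases w)
  case Nil
  interpret HH: vspace HH by simp
  have "pr (g []) (g []) \<in> carrier HH" using g2_closed[of "([], [])"] by simp
  then show ?thesis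
    using Nil HH.lincomb_gen[of g2 "([], [])"]
    by (simp add: Let_def tensor_A_space \<gamma>_gen splits_simps)
next
  case (Cons x u)
  interpret HH: vspace HH by simp
  let ?f = "\<lambda>i. pr (g (take i w)) (g (drop i w))"
  have mem: "(take i w, drop i w) \<in> W \<times> W" for i
    using w by simp_all
  then have f: "?f i \<in> carrier HH" for i
    using g2_closed[of "(take i w, drop i w)"] by simp
  have "G2 (splits w) = (\<Oplus>\<^bsub>HH\<^esub>i\<in>{..length w}. G2 (gen (take i w, drop i w)))"
    unfolding splits_def split_sum_def
    by (rule lin_map_sum[OF _ lin_map_G2]) (use mem in \<open>auto intro!: Free_single\<close>)
  also have "\<dots> = (\<Oplus>\<^bsub>HH\<^esub>i\<in>{..Suc (length u)}. ?f i)"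
    using f by (intro HH.finsum_cong') (auto simp: Cons)
  also have "\<dots> = ?f 0 \<oplus>\<^bsub>HH\<^esub> (\<Oplus>\<^bsub>HH\<^esub>i\<in>{..length u}. ?f (Suc i))"
    by (subst HH.finsum_Suc2) (use f f[of 0] in \<open>auto intro!: HH.a_comm\<close>)
  also have "\<dots> = deconcat sc R L (bar L w)"
    by (simp add: Cons Let_def tensor_A_space \<gamma>_gen)
  finally show ?thesis ..
qed

lemma \<Delta>_\<gamma>_and_lin: "p \<in> carrier (Free W) \<Longrightarrow> \<Delta> (\<gamma> p) = G2 (lin splits p)" "lin_map H HH \<Delta>"
proof -
  let ?d = "deconcat sc R L"
  have d: "?d b \<in> carrier HH" if "b \<in> bar L ` W" for b
    using that deconcat_bar lin_mapD(1)[OF lin_map_G2 splits_closed] by auto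
  have L: "lincomb HH ?d (barred p) = G2 (lin splits p)" if p: "p \<in> carrier (Free W)" for p
  proof -
    have "lincomb HH ?d (barred p) = lincomb HH (\<lambda>w. lincomb HH ?d (gen (bar L w))) p"
      using d p by (intro lincomb_lin[where S = W and S' = "bar L ` W"]) auto
    also have "\<dots> = lincomb HH (\<lambda>w. G2 (splits w)) p"
      using d by (intro lincomb_cong[OF _ _ _ p] lin_mapD(1)[OF lin_map_G2] splits_closed)
        (simp_all add: vspace.lincomb_gen flip: deconcat_bar)
    also have "\<dots> = G2 (lin splits p)"
      by (rule lincomb_lin_map[OF _ lin_map_G2 splits_closed p]) auto
    finally show ?thesis .
  qed
  have rel: "lincomb HH ?d q = \<zero>\<^bsub>HH\<^esub>" if q: "q \<in> AR" for q
  proof -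
    obtain r where r: "r \<in> TR" "q = barred r" using q by (auto simp: AR_eq)
    obtain u v c x d y where uv: "u \<in> W" "v \<in> W" "x \<in> V" "y \<in> V" "r = mrel u v c x d y"
      using r(1) by (rule TR_E)
    have "r \<in> carrier (Free W)" using r TR_Free by blast
    from L[OF this] show ?thesis
      unfolding r(2) unfolding uv(5) G2_splits_mrel[OF uv(1-4)] .
  qed
  show "\<Delta> (\<gamma> p) = G2 (lin splits p)" if p: "p \<in> carrier (Free W)"
  proof -
    have "barred p \<in> carrier (Free (bar L ` W))" using p by (rule lin_closed[rotated]) auto
    from extend_coset[OF vspace_tensor d AR_Free rel this] show ?thesis
      unfolding A_coproduct_def tensor_A_space \<gamma>_def L[OF p] .
  qed
  have "lin_map (A_space sc R L) HH \<Delta>"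
    unfolding A_coproduct_def tensor_A_space unfolding A_space_def
    by (rule lin_map_extend[OF vspace_tensor d AR_Free rel])
  then show "lin_map H HH \<Delta>" by (simp add: lin_map_def A_algebra_simps)
qed

lemmas \<Delta>_\<gamma> = \<Delta>_\<gamma>_and_lin(1) and lin_map_\<Delta> = \<Delta>_\<gamma>_and_lin(2)

lemma \<Delta>_g: "w \<in> W \<Longrightarrow> \<Delta> (g w) = G2 (splits w)"
  by (simp add: \<Delta>_\<gamma>)

lemma lin_map_\<Delta>_g:
  assumes "vspace P" "lin_map HH P \<phi>" "w \<in> W"
  shows "\<phi> (\<Delta> (g w)) = lincomb P (\<lambda>(a, b). \<phi> (pr (g a) (g b))) (splits w)"
  unfolding \<Delta>_g[OF assms(3)]
  by (subst lin_map_comp_lincomb[OF _ assms(1,2) g2_closed splits_closed[OF assms(3)]])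
    (auto simp: case_prod_beta')

end

text \<open>The form in which \<open>split_sum_coassoc\<close> is applied to maps with values in a tensor product.\<close>

lemma lincomb_splits_coassoc:
  assumes P: "vspace P" and F: "\<And>a b c. \<lbrakk>a \<in> lists V; b \<in> lists V; c \<in> lists V\<rbrakk> \<Longrightarrow> F a b c \<in> carrier P"
    and w: "w \<in> lists V"
  shows "lincomb P (\<lambda>(a, b). lincomb P (\<lambda>(c, d). F c d b) (splits a)) (splits w) =
    lincomb P (\<lambda>(a, b). lincomb P (\<lambda>(c, d). F a c d) (splits b)) (splits w)"
proof -
  let ?W = "lists V"
  let ?F = "\<lambda>(a, b, c). F a b c"
  let ?D1 = "\<lambda>(a, b). lin (\<lambda>(c, d). gen (c, d, b)) (splits a)"
    and ?D2 = "\<lambda>(a, b). lin (\<lambda>(c, d). gen (a, c, d)) (splits b)"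
  have Lin: "lin_map (Free (?W \<times> ?W \<times> ?W)) P (lincomb P ?F)"
    by (rule lin_map_lincomb'[OF P]) (auto simp: F)
  have L: "lincomb P (\<lambda>s. lincomb P ?F (D s)) (splits w) = lincomb P ?F (lin D (splits w))"
    if "\<And>s. s \<in> ?W \<times> ?W \<Longrightarrow> D s \<in> carrier (Free (?W \<times> ?W \<times> ?W))" for D
    by (rule lincomb_lin_map[OF P Lin that splits_closed[OF w]])
  have D1: "?D1 s \<in> carrier (Free (?W \<times> ?W \<times> ?W))" and D2: "?D2 s \<in> carrier (Free (?W \<times> ?W \<times> ?W))"
    if "s \<in> ?W \<times> ?W" for s
    using that by (auto intro!: lin_closed[OF _ splits_closed])
  have i1: "lincomb P (\<lambda>(c, d). F c d b) (splits a) = lincomb P ?F (?D1 (a, b))"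
    and i2: "lincomb P (\<lambda>(c, d). F b c d) (splits a) = lincomb P ?F (?D2 (b, a))"
    if "a \<in> ?W" "b \<in> ?W" for a b
  proof -
    show "lincomb P (\<lambda>(c, d). F c d b) (splits a) = lincomb P ?F (?D1 (a, b))"
      using that unfolding prod.case
      by (subst lincomb_lin[OF P _ _ splits_closed[OF that(1)], where S' = "?W \<times> ?W \<times> ?W"])
        (auto intro!: lincomb_cong[OF P _ _ splits_closed[OF that(1)]] simp: F P vspace.lincomb_gen)
    show "lincomb P (\<lambda>(c, d). F b c d) (splits a) = lincomb P ?F (?D2 (b, a))"
      using that unfolding prod.case
      by (subst lincomb_lin[OF P _ _ splits_closed[OF that(1)], where S' = "?W \<times> ?W \<times> ?W"])
        (auto intro!: lincomb_cong[OF P _ _ splits_closed[OF that(1)]] simp: F P vspace.lincomb_gen)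
  qed
  have "lincomb P (\<lambda>(a, b). lincomb P (\<lambda>(c, d). F c d b) (splits a)) (splits w) =
      lincomb P (\<lambda>s. lincomb P ?F (?D1 s)) (splits w)"
    by (rule lincomb_cong[OF P _ _ splits_closed[OF w]])
      (use i1 lin_mapD(1)[OF Lin D1] in \<open>auto\<close>)
  also have "\<dots> = lincomb P ?F (lin ?D1 (splits w))" by (rule L[OF D1])
  also have "lin ?D1 (splits w) = lin ?D2 (splits w)"
    using split_sum_coassoc[of "\<lambda>a b c. gen (a, b, c)" w] by (simp add: lin_splits)
  also have "lincomb P ?F \<dots> = lincomb P (\<lambda>s. lincomb P ?F (?D2 s)) (splits w)" by (rule L[OF D2, symmetric])
  also have "\<dots> = lincomb P (\<lambda>(a, b). lincomb P (\<lambda>(c, d). F a c d) (splits b)) (splits w)"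
    by (rule lincomb_cong[OF P _ _ splits_closed[OF w]])
      (use i2 lin_mapD(1)[OF Lin D2] in \<open>auto\<close>)
  finally show ?thesis .
qed

section \<open>The bialgebra axioms\<close>

context ring_letter_algebra
begin

lemma Nil_unit: "g [] \<in> carrier H"
  by simp

lemma k_algebra_H: "k_algebra H"
proof (rule k_algebra.intro)
  show "Module.module ring_of_type_algebra H"
    using vspace_H by (simp add: vspace_def)
  interpret H: vspace H by simp
  note m = bilin_mapD[OF bilin_mult]
  show "Ring.ring H"
  proof (rule ringI[OF H.abelian_group_axioms monoidI])
    fix a b c
    assume abc: "a \<in> carrier H" "b \<in> carrier H" "c \<in> carrier H"
    show "(a \<oplus>\<^bsub>H\<^esub> b) \<otimes>\<^bsub>H\<^esub> c = a \<otimes>\<^bsub>H\<^esub> c \<oplus>\<^bsub>H\<^esub> b \<otimes>\<^bsub>H\<^esub> c"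
      "c \<otimes>\<^bsub>H\<^esub> (a \<oplus>\<^bsub>H\<^esub> b) = c \<otimes>\<^bsub>H\<^esub> a \<oplus>\<^bsub>H\<^esub> c \<otimes>\<^bsub>H\<^esub> b"
      by (rule lin_mapD(2)[OF m(1)[OF abc(3)] abc(1,2)], rule lin_mapD(2)[OF m(2)[OF abc(3)] abc(1,2)])
    show "a \<otimes>\<^bsub>H\<^esub> b \<otimes>\<^bsub>H\<^esub> c = a \<otimes>\<^bsub>H\<^esub> (b \<otimes>\<^bsub>H\<^esub> c)"
      using abc by (elim H_E) (simp add: mult_\<gamma> qmul_words qmul_assoc)
  next
    fix a b
    assume "a \<in> carrier H" "b \<in> carrier H"
    then show "a \<otimes>\<^bsub>H\<^esub> b \<in> carrier H" by (rule m(3))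
  next
    fix a
    assume "a \<in> carrier H"
    then show "\<one>\<^bsub>H\<^esub> \<otimes>\<^bsub>H\<^esub> a = a" "a \<otimes>\<^bsub>H\<^esub> \<one>\<^bsub>H\<^esub> = a"
      by (auto elim!: H_E simp: A_algebra_simps(6) mult_\<gamma>)
  qed (simp add: A_algebra_simps(6))
  fix x y c
  assume xy: "x \<in> carrier H" "y \<in> carrier H"
  show "(c \<odot>\<^bsub>H\<^esub> x) \<otimes>\<^bsub>H\<^esub> y = c \<odot>\<^bsub>H\<^esub> (x \<otimes>\<^bsub>H\<^esub> y)"
    "x \<otimes>\<^bsub>H\<^esub> (c \<odot>\<^bsub>H\<^esub> y) = c \<odot>\<^bsub>H\<^esub> (x \<otimes>\<^bsub>H\<^esub> y)"
    by (rule lin_mapD(3)[OF m(1)[OF xy(2)] xy(1)], rule lin_mapD(3)[OF m(2)[OF xy(1)] xy(2)])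
qed

text \<open>The coefficient of the empty word. It descends to \<open>A(R)\<close> because the empty word occurs in no
  relation.\<close>

definition counit :: "('a bar_word \<Rightarrow>\<^sub>0 'k) set \<Rightarrow> 'k"
  where "counit a = Poly_Mapping.lookup (lift (lin (\<lambda>w. if w = [] then gen [] else 0)) a) ([] :: 'a list)"

lemma counit_word:
  "Poly_Mapping.lookup (lin (\<lambda>w. if w = [] then gen [] else 0) p) [] = Poly_Mapping.lookup p []"
proof (induction p rule: free_induct[OF Free_UNIV])
  case (2 c s q)
  then show ?case by (simp add: lookup_add lookup_free_scale lookup_single when_def)
qed simp

lemma counit_lift:
  shows counit_\<gamma>: "p \<in> carrier (Free W) \<Longrightarrow> counit (\<gamma> p) = Poly_Mapping.lookup p []"
    and lin_map_counit: "lin_map H (Free UNIV) (lift (lin (\<lambda>w. if w = [] then gen ([] :: 'a list) else 0)))"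
proof -
  let ?\<phi> = "lin (\<lambda>w. if w = [] then gen ([] :: 'a list) else 0) :: ('a list \<Rightarrow>\<^sub>0 'k) \<Rightarrow> _"
  have lin: "lin_map (Free W) (Free UNIV) ?\<phi>" by (rule lin_map_lin_Free) simp
  have zero: "?\<phi> q = \<zero>\<^bsub>Free UNIV\<^esub>" if "q \<in> KR" for q
    by (rule zero_on_KR[OF _ _ that]) (simp_all add: mrel_def)
  show "p \<in> carrier (Free W) \<Longrightarrow> counit (\<gamma> p) = Poly_Mapping.lookup p []"
    by (simp add: counit_def lift_\<gamma>[OF vspace_Free lin zero] counit_word)
  show "lin_map H (Free UNIV) (lift ?\<phi>)" by (rule lin_map_lift[OF vspace_Free lin zero])
qed

lemma counit_g: "w \<in> W \<Longrightarrow> counit (g w) = (if w = [] then 1 else 0)"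
  by (simp add: counit_\<gamma> lookup_single)

lemma counit_linear:
  shows "\<lbrakk>x \<in> carrier H; y \<in> carrier H\<rbrakk> \<Longrightarrow> counit (x \<oplus>\<^bsub>H\<^esub> y) = counit x + counit y"
    and "x \<in> carrier H \<Longrightarrow> counit (c \<odot>\<^bsub>H\<^esub> x) = c * counit x"
  by (simp_all add: counit_def lin_mapD[OF lin_map_counit] lookup_add lookup_free_scale)

lemma bilin_counit:
  "bilin_map H H H (\<lambda>y z. counit y \<odot>\<^bsub>H\<^esub> z)"
proof -
  interpret H: vspace H by simp
  show ?thesis
    unfolding bilin_map_def
    by (intro conjI ballI lin_mapI)
      (simp_all add: counit_linear H.scale_add_left H.scale_add_right H.scale_scale mult.commute)
qed

lemma lincomb_splits_\<gamma>:
  assumes "w \<in> W" "\<And>a b. \<lbrakk>a \<in> W; b \<in> W\<rbrakk> \<Longrightarrow> f a b = \<gamma> (F a b)"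
    "\<And>a b. \<lbrakk>a \<in> W; b \<in> W\<rbrakk> \<Longrightarrow> F a b \<in> carrier (Free W)"
  shows "lincomb H (\<lambda>(a, b). f a b) (splits w) = \<gamma> (split_sum F w)"
proof -
  have "lincomb H (\<lambda>(a, b). f a b) (splits w) = lincomb H (\<lambda>s. \<gamma> (case s of (a, b) \<Rightarrow> F a b)) (splits w)"
    by (rule lincomb_cong[OF vspace_H _ _ splits_closed[OF assms(1)]])
      (use assms in \<open>auto intro!: \<gamma>_H\<close>)
  also have "\<dots> = \<gamma> (lin (\<lambda>(a, b). F a b) (splits w))"
    by (rule lincomb_g[OF _ splits_closed[OF assms(1)]]) (use assms in auto)
  finally show ?thesis by (simp add: lin_splits)
qed

lemma extend_\<Delta>:
  assumes b: "bilin_map H H H (\<lambda>x y. f (x, y))" and w: "w \<in> W"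
    and "\<And>u v. \<lbrakk>u \<in> W; v \<in> W\<rbrakk> \<Longrightarrow> f (g u, g v) = \<gamma> (F u v)"
    and "\<And>u v. \<lbrakk>u \<in> W; v \<in> W\<rbrakk> \<Longrightarrow> F u v \<in> carrier (Free W)"
  shows "extend H f (\<Delta> (g w)) = \<gamma> (split_sum F w)"
  unfolding lin_map_\<Delta>_g[OF vspace_H lin_map_extend_tensor[OF vspace_H vspace_H vspace_H b] w]
  by (rule lincomb_splits_\<gamma>[OF w]) (use assms in \<open>simp_all add: extend_pure[OF vspace_H vspace_H vspace_H b]\<close>)

lemma lin_map_extend_\<Delta>:
  "bilin_map H H H (\<lambda>x y. f (x, y)) \<Longrightarrow> lin_map H H (\<lambda>x. extend H f (\<Delta> x))"
  by (rule lin_map_comp[OF lin_map_\<Delta> lin_map_extend_tensor]) simp_all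

lemma coassoc:
  assumes "x \<in> carrier H"
  shows "tensor_assoc H H H (tensor_map HH H \<Delta> (\<lambda>y. y) (\<Delta> x)) = tensor_map H HH (\<lambda>y. y) \<Delta> (\<Delta> x)"
proof (rule lin_map_H_ext[OF _ _ _ _ assms])
  let ?P = "tensor H HH"
  show "vspace ?P" by simp
  note m1 = lin_map_tensor_map[OF vspace_H vspace_H vspace_tensor vspace_H lin_map_\<Delta> lin_map_id]
    and m2 = lin_map_tensor_map[OF vspace_H vspace_H vspace_H vspace_tensor lin_map_id lin_map_\<Delta>]
    and as = lin_map_tensor_assoc[OF vspace_H vspace_H vspace_H]
  note l1 = lin_map_comp[OF m1 as]
  show "lin_map H ?P (\<lambda>x. tensor_assoc H H H (tensor_map HH H \<Delta> (\<lambda>y. y) (\<Delta> x)))"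
    by (rule lin_map_comp[OF lin_map_\<Delta> l1])
  show "lin_map H ?P (\<lambda>x. tensor_map H HH (\<lambda>y. y) \<Delta> (\<Delta> x))"
    by (rule lin_map_comp[OF lin_map_\<Delta> m2])
  fix w assume w: "w \<in> W"
  let ?p1 = "pure_tensor HH H" and ?p2 = "pure_tensor H HH"
  note b1 = bilin_pure_tensor[OF vspace_tensor vspace_H, of H H]
    and b2 = bilin_pure_tensor[OF vspace_H vspace_tensor, of H H]
  let ?F = "\<lambda>a b c. ?p2 (g a) (pr (g b) (g c))"
  have F: "?F a b c \<in> carrier ?P" if "a \<in> W" "b \<in> W" "c \<in> W" for a b c
    using that by (intro bilin_mapD(3)[OF b2] bilin_mapD(3)[OF bilin_pr] g_closed)
  have left: "tensor_assoc H H H (tensor_map HH H \<Delta> (\<lambda>y. y) (pr (g a) (g b))) =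
      lincomb ?P (\<lambda>(c, d). ?F c d b) (splits a)" if a: "a \<in> W" "b \<in> W" for a b
  proof -
    note la = lin_map_comp[OF bilin_mapD(1)[OF b1 g_closed[OF a(2)]] as]
    have "tensor_assoc H H H (tensor_map HH H \<Delta> (\<lambda>y. y) (pr (g a) (g b))) =
      tensor_assoc H H H (?p1 (\<Delta> (g a)) (g b))"
      using a by (simp add: tensor_map_pure[OF vspace_H vspace_H vspace_tensor vspace_H lin_map_\<Delta> lin_map_id])
    also have "\<dots> = lincomb ?P (\<lambda>(c, d). tensor_assoc H H H (?p1 (pr (g c) (g d)) (g b))) (splits a)"
      by (rule lin_map_\<Delta>_g[OF vspace_tensor la a(1)])
    also have "\<dots> = lincomb ?P (\<lambda>(c, d). ?F c d b) (splits a)"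
      by (rule lincomb_cong[OF vspace_tensor _ _ splits_closed[OF a(1)]])
        (use a in \<open>auto simp: tensor_assoc_pure F\<close>)
    finally show ?thesis .
  qed
  have right: "tensor_map H HH (\<lambda>y. y) \<Delta> (pr (g a) (g b)) =
      lincomb ?P (\<lambda>(c, d). ?F a c d) (splits b)" if a: "a \<in> W" "b \<in> W" for a b
  proof -
    have "tensor_map H HH (\<lambda>y. y) \<Delta> (pr (g a) (g b)) = ?p2 (g a) (\<Delta> (g b))"
      using a by (simp add: tensor_map_pure[OF vspace_H vspace_H vspace_H vspace_tensor lin_map_id lin_map_\<Delta>])
    also have "\<dots> = lincomb ?P (\<lambda>(c, d). ?F a c d) (splits b)"
      by (rule lin_map_\<Delta>_g[OF vspace_tensor bilin_mapD(2)[OF b2 g_closed[OF a(1)]] a(2)])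
    finally show ?thesis .
  qed
  have closed: "lincomb ?P (\<lambda>(c, d). ?F c d b) (splits a) \<in> carrier ?P"
    "lincomb ?P (\<lambda>(c, d). ?F a c d) (splits b) \<in> carrier ?P" if "a \<in> W" "b \<in> W" for a b
    using that by (auto intro!: lin_mapD(1)[OF lin_map_lincomb' splits_closed] F)
  have "tensor_assoc H H H (tensor_map HH H \<Delta> (\<lambda>y. y) (\<Delta> (g w))) =
    lincomb ?P (\<lambda>(a, b). tensor_assoc H H H (tensor_map HH H \<Delta> (\<lambda>y. y) (pr (g a) (g b)))) (splits w)"
    by (rule lin_map_\<Delta>_g[OF vspace_tensor l1 w])
  also have "\<dots> = lincomb ?P (\<lambda>(a, b). lincomb ?P (\<lambda>(c, d). ?F c d b) (splits a)) (splits w)"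
    by (rule lincomb_cong[OF vspace_tensor _ _ splits_closed[OF w]]) (auto simp: left closed)
  also have "\<dots> = lincomb ?P (\<lambda>(a, b). lincomb ?P (\<lambda>(c, d). ?F a c d) (splits b)) (splits w)"
    by (rule lincomb_splits_coassoc[OF vspace_tensor F w])
  also have "\<dots> = lincomb ?P (\<lambda>(a, b). tensor_map H HH (\<lambda>y. y) \<Delta> (pr (g a) (g b))) (splits w)"
    by (rule lincomb_cong[OF vspace_tensor _ _ splits_closed[OF w]]) (auto simp: right closed)
  also have "\<dots> = tensor_map H HH (\<lambda>y. y) \<Delta> (\<Delta> (g w))"
    by (rule lin_map_\<Delta>_g[OF vspace_tensor m2 w, symmetric])
  finally show "tensor_assoc H H H (tensor_map HH H \<Delta> (\<lambda>y. y) (\<Delta> (g w))) = tensor_map H HH (\<lambda>y. y) \<Delta> (\<Delta> (g w))" .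
qed

lemma k_coalgebra_H: "k_coalgebra H \<Delta> counit"
proof (rule k_coalgebra.intro)
  show "Module.module ring_of_type_algebra H"
    using vspace_H by (simp add: vspace_def)
  show "lin_map H HH \<Delta>" by (rule lin_map_\<Delta>)
  interpret H: vspace H by simp
  fix x assume x: "x \<in> carrier H"
  show "counit (x \<oplus>\<^bsub>H\<^esub> y) = counit x + counit y" if "y \<in> carrier H" for y
    using x that by (rule counit_linear)
  show "counit (c \<odot>\<^bsub>H\<^esub> x) = c * counit x" for c using x by (rule counit_linear)
  show "tensor_assoc H H H (tensor_map HH H \<Delta> (\<lambda>y. y) (\<Delta> x)) = tensor_map H HH (\<lambda>y. y) \<Delta> (\<Delta> x)"
    using x by (rule coassoc)
  have b: "bilin_map H H H (\<lambda>y z. (\<lambda>(y, z). counit y \<odot>\<^bsub>H\<^esub> z) (y, z))"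
    using bilin_counit by simp
  have b': "bilin_map H H H (\<lambda>y z. (\<lambda>(y, z). counit z \<odot>\<^bsub>H\<^esub> y) (y, z))"
    using bilin_map_swap[OF bilin_counit] by simp
  have val: "counit (g u) \<odot>\<^bsub>H\<^esub> g v = \<gamma> (if u = [] then gen v else 0)" if "u \<in> W" "v \<in> W" for u v
    using that by (simp add: counit_g H.scale_one H.scale_zero_left)
  show "extend H (\<lambda>(y, z). counit y \<odot>\<^bsub>H\<^esub> z) (\<Delta> x) = x"
    by (rule lin_map_H_ext[OF vspace_H lin_map_extend_\<Delta>[OF b] lin_map_id _ x])
      (subst extend_\<Delta>[OF b, where F = "\<lambda>u v. if u = [] then gen v else 0"], auto simp: val)
  show "extend H (\<lambda>(y, z). counit z \<odot>\<^bsub>H\<^esub> y) (\<Delta> x) = x"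
    by (rule lin_map_H_ext[OF vspace_H lin_map_extend_\<Delta>[OF b'] lin_map_id _ x])
      (subst extend_\<Delta>[OF b', where F = "\<lambda>u v. if v = [] then gen u else 0"], auto simp: val)
qed

lemma drop_unit_closed: "P \<in> carrier (Free (W \<times> W)) \<Longrightarrow> drop_unit t P \<in> carrier (Free (W \<times> W))"
  by (rule lin_closed[of "W \<times> W"]) auto

lemma t_in_L: "t \<in> L"
  using rangeI[of "\<lambda>c. sc c t" 1] by (simp add: line_eq)

text \<open>A word that begins with \<open>t\<close> lies in \<open>KR\<close>, so the pairs that are dropped have class zero.\<close>

lemma G2_drop_unit:
  assumes "P \<in> carrier (Free (W \<times> W))"
  shows "G2 (drop_unit t P) = G2 P"
proof (rule lin_map_Free_ext[OF vspace_tensor lin_map_comp[OF _ lin_map_G2] lin_map_G2 _ assms])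
  show "lin_map (Free (W \<times> W)) (Free (W \<times> W)) (drop_unit t)"
    by (rule lin_mapI) (simp_all add: drop_unit_closed)
  fix s assume s: "s \<in> W \<times> W"
  interpret HH: vspace HH by simp
  obtain a b where ab: "s = (a, b)" "a \<in> W" "b \<in> W" using s by auto
  have "g2 s = \<zero>\<^bsub>HH\<^esub>" if "b \<noteq> [] \<and> hd b = t"
  proof -
    have "gen b \<in> free.span KR"
      using that ab gen_line[OF t_in_L, of "tl b"] by (cases b) auto
    then show ?thesis using ab by (simp add: \<gamma>_KR pr_zero)
  qed
  then show "G2 (drop_unit t (gen s)) = G2 (gen s)"
    using ab HH.lincomb_gen[of g2 s] g2_closed[OF s] lin_map_Free_0[OF _ lin_map_G2] by auto
qed

lemma splits_qmul:
  "drop_unit t (lin splits (p \<star> q)) = drop_unit t (qmul2 m t (lin splits p) (lin splits q))"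
proof (induction p rule: free_induct[OF Free_UNIV])
  case (2 c u p)
  have "drop_unit t (lin splits (gen u \<star> q)) = drop_unit t (qmul2 m t (splits u) (lin splits q))"
    by (induction q rule: free_induct[OF Free_UNIV]) (simp_all add: splits_qs)
  with 2 show ?case by simp
qed simp

lemma pt_qs_closed: "\<lbrakk>s \<in> W \<times> W; s' \<in> W \<times> W\<rbrakk> \<Longrightarrow>
    pt (qs m t (fst s) (fst s')) (qs m t (snd s) (snd s')) \<in> carrier (Free (W \<times> W))"
  by (auto intro!: pt_closed qs_words)

lemma tensor_mult_G2:
  assumes P: "P \<in> carrier (Free (W \<times> W))" and Q: "Q \<in> carrier (Free (W \<times> W))"
  shows "tensor_mult H (G2 P) (G2 Q) = G2 (qmul2 m t P Q)"
proof -
  let ?F = "\<lambda>s s'. pt (qs m t (fst s) (fst s')) (qs m t (snd s) (snd s'))"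
  have "tensor_mult H (G2 P) (G2 Q) = lincomb HH (\<lambda>(s, s'). tensor_mult H (g2 s) (g2 s')) (pt P Q)"
    by (rule bilin_lincomb[OF _ _ _ bilin_tensor_mult[OF vspace_H bilin_mult] _ _ P Q])
      (auto intro!: bilin_mapD(3)[OF bilin_pr])
  also have "\<dots> = lincomb HH (\<lambda>r. G2 (?F (fst r) (snd r))) (pt P Q)"
  proof (rule lincomb_cong[OF _ _ _ pt_closed[OF P Q]])
    fix r assume r: "r \<in> (W \<times> W) \<times> W \<times> W"
    show "(case r of (s, s') \<Rightarrow> tensor_mult H (g2 s) (g2 s')) = G2 (?F (fst r) (snd r))"
      using r by (auto simp: tensor_mult_pure[OF vspace_H bilin_mult] mult_\<gamma> pr_\<gamma>[OF qs_words qs_words])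
    show "G2 (?F (fst r) (snd r)) \<in> carrier HH"
      using r by (intro lin_mapD(1)[OF lin_map_G2] pt_qs_closed) auto
  qed simp
  also have "\<dots> = G2 (lin (\<lambda>r. ?F (fst r) (snd r)) (pt P Q))"
    by (rule lincomb_lin_map[OF _ lin_map_G2 _ pt_closed[OF P Q]]) (auto intro!: pt_closed qs_words)
  also have "lin (\<lambda>r. ?F (fst r) (snd r)) (pt P Q) = qmul2 m t P Q"
    by (simp add: pt_def qmul2_def lin_lin case_prod_beta')
  finally show ?thesis .
qed

lemma qmul2_closed:
  "\<lbrakk>P \<in> carrier (Free (W \<times> W)); Q \<in> carrier (Free (W \<times> W))\<rbrakk> \<Longrightarrow> qmul2 m t P Q \<in> carrier (Free (W \<times> W))"
  unfolding qmul2_def case_prod_beta'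
  by (rule lin_closed[of "W \<times> W"], rule lin_closed[of "W \<times> W"]) (auto intro!: pt_closed qs_words)

lemma lin_splits_closed: "p \<in> carrier (Free W) \<Longrightarrow> lin splits p \<in> carrier (Free (W \<times> W))"
  by (rule lin_closed[OF splits_closed])

lemma qs_coeff_Nil:
  assumes "u \<in> W" "v \<in> W"
  shows "Poly_Mapping.lookup (qs m t u v :: 'a list \<Rightarrow>\<^sub>0 'k) [] =
    Poly_Mapping.lookup (gen u) [] * Poly_Mapping.lookup (gen v) []"
proof (cases "u = [] \<and> v = []")
  case False
  have "[] \<notin> Poly_Mapping.keys (qs m t u v :: 'a list \<Rightarrow>\<^sub>0 'k)"
    using qs_degree[of V m t u v] assms False by (auto simp: m_closed t_letter carrier_Free)
  then show ?thesis
    using False by (auto simp: in_keys_iff lookup_single when_def)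
qed simp

lemma k_bialgebra_H: "k_bialgebra H \<Delta> counit"
proof -
  interpret A: k_algebra H by (rule k_algebra_H)
  interpret C: k_coalgebra H \<Delta> counit by (rule k_coalgebra_H)
  show ?thesis
  proof
    fix x y assume "x \<in> carrier H" "y \<in> carrier H"
    then obtain p q where p: "x = \<gamma> p" "p \<in> carrier (Free W)" and q: "y = \<gamma> q" "q \<in> carrier (Free W)"
      by (metis H_E)
    note closed = qmul_words[OF p(2) q(2)] lin_splits_closed[OF p(2)] lin_splits_closed[OF q(2)]
    have "\<Delta> (x \<otimes>\<^bsub>H\<^esub> y) = G2 (lin splits (p \<star> q))"
      using p q by (simp add: mult_\<gamma> \<Delta>_\<gamma> qmul_words)
    also have "\<dots> = G2 (drop_unit t (lin splits (p \<star> q)))"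
      by (rule G2_drop_unit[symmetric, OF lin_splits_closed[OF closed(1)]])
    also have "\<dots> = G2 (qmul2 m t (lin splits p) (lin splits q))"
      unfolding splits_qmul by (rule G2_drop_unit[OF qmul2_closed[OF closed(2,3)]])
    also have "\<dots> = tensor_mult H (\<Delta> x) (\<Delta> y)"
      using p q closed by (simp add: tensor_mult_G2 \<Delta>_\<gamma>)
    finally show "\<Delta> (x \<otimes>\<^bsub>H\<^esub> y) = tensor_mult H (\<Delta> x) (\<Delta> y)" .
    have "Poly_Mapping.lookup (p \<star> q) [] = Poly_Mapping.lookup p [] * Poly_Mapping.lookup q []"
      using p(2)
    proof (induction p rule: free_induct)
      case (step c u p)
      have "Poly_Mapping.lookup (gen u \<star> q) [] = Poly_Mapping.lookup (gen u) [] * Poly_Mapping.lookup q []"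
        using q(2) step(1) by (induction q rule: free_induct)
          (simp_all add: lookup_add lookup_free_scale qs_coeff_Nil algebra_simps)
      with step show ?case by (simp add: lookup_add lookup_free_scale algebra_simps)
    qed simp
    then show "counit (x \<otimes>\<^bsub>H\<^esub> y) = counit x * counit y"
      using p q by (simp add: mult_\<gamma> counit_\<gamma> qmul_words)
  next
    interpret HH: vspace HH by simp
    show "\<Delta> \<one>\<^bsub>H\<^esub> = pr \<one>\<^bsub>H\<^esub> \<one>\<^bsub>H\<^esub>"
      using HH.lincomb_gen[of g2 "([], [])"] g2_closed[of "([], [])"]
      by (simp add: A_algebra_simps(6) \<Delta>_g splits_simps)
    show "counit \<one>\<^bsub>H\<^esub> = 1" by (simp add: A_algebra_simps(6) counit_g)
  qed
qed

section \<open>The antipode\<close>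

abbreviation aw :: "'a list \<Rightarrow> ('a list \<Rightarrow>\<^sub>0 'k)" where "aw \<equiv> antipode_word m t"

lemma aw_closed: "w \<in> W \<Longrightarrow> aw w \<in> carrier (Free W)"
  using antipode_word_degree[of V m t w, where 'k = 'k]
  by (auto simp: m_closed t_letter carrier_Free)

lemma lin_pt_qmul: "lin (\<lambda>(a, b). aw a \<star> gen b) (pt p q) = lin aw p \<star> q"
proof (induction p rule: free_induct[OF Free_UNIV])
  case (2 c u p)
  have "lin (\<lambda>(a, b). aw a \<star> gen b) (pt (gen u) q) = aw u \<star> q"
    by (induction q rule: free_induct[OF Free_UNIV]) simp_all
  with 2 show ?case by simp
qed simp

text \<open>Every summand of the recursion is a relation times a word or a word times a relation, up to \<open>aw\<close>. In
  the first case the relation has been cut behind the varying letter, and the induction hypothesis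
  applies to it.\<close>

lemma aw_mrel:
  assumes "u \<in> W" "v \<in> W" "x \<in> V" "y \<in> V"
  shows "lin aw (mrel u v c x d y) \<in> free.span TR"
  using assms(2)
proof (induction "length v" arbitrary: v rule: less_induct)
  case less
  let ?n = "Suc (length u + length v)"
  have "lin aw (mrel u v c x d y) = - (\<Sum>i<?n. lin (\<lambda>(a, b). aw a \<star> gen b) (cut_mrel i u v c x d y))"
    unfolding mrel_def lin_diff lin_scale lin_gen
    by (subst (1 2 3) antipode_word.simps)
      (simp add: cut_mrel_def Let_def sum_subtractf free.scale_sum_right sum_negf del: sum.lessThan_Suc)
  also have "\<dots> \<in> free.span TR"
  proof (intro free.span_neg free.span_sum)
    fix i assume i: "i \<in> {..<?n}"
    show "lin (\<lambda>(a, b). aw a \<star> gen b) (cut_mrel i u v c x d y) \<in> free.span TR"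
    proof (rule cut_mrel_cases[OF assms(1) less(2), of i c x d y])
      fix s s' assume "s \<in> W" "s' \<in> W" "cut_mrel i u v c x d y = pt (gen s) (mrel s' v c x d y)"
      then show ?thesis
        using assms less(2) by (simp add: lin_pt_qmul span_qmul_right mrel_in_span aw_closed)
    next
      fix s s' assume "s \<in> W" "s' \<in> W" "length u + length s' < i"
        "cut_mrel i u v c x d y = pt (mrel u s' c x d y) (gen s)"
      then show ?thesis
        using less(1)[of s'] i by (simp add: lin_pt_qmul span_qmul_left)
    qed
  qed
  finally show ?case .
qed

text \<open>In all but the first summand the left factor is \<open>aw\<close> of a shorter word that begins with \<open>l\<close>.\<close>

lemma aw_line:
  assumes "l \<in> L" "w \<in> W"
  shows "aw (l # w) \<in> free.span KR"
  using assms(2)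
proof (induction "length w" arbitrary: w rule: less_induct)
  case less
  have "aw (take i (l # w)) \<star> gen (drop i (l # w)) \<in> free.span KR" if "i \<le> length w" for i
  proof (cases i)
    case 0
    then show ?thesis using assms less(2) by (simp add: antipode_word.simps gen_line)
  next
    case (Suc j)
    then show ?thesis
      using less that by (auto intro!: KR_qmul_left)
  qed
  then show ?case
    by (subst antipode_word.simps) (auto intro!: free.span_neg free.span_sum simp del: sum.lessThan_Suc)
qed

definition antipode :: "('a bar_word \<Rightarrow>\<^sub>0 'k) set \<Rightarrow> ('a bar_word \<Rightarrow>\<^sub>0 'k) set"
  where "antipode = lift (\<lambda>p. \<gamma> (lin aw p))"

lemma antipode_lift:
  shows antipode_\<gamma>: "p \<in> carrier (Free W) \<Longrightarrow> antipode (\<gamma> p) = \<gamma> (lin aw p)"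
    and lin_map_antipode: "lin_map H H antipode"
proof -
  have lin: "lin_map (Free W) H (\<lambda>p. \<gamma> (lin aw p))"
    by (rule lin_map_comp[OF lin_map_lin_Free[OF aw_closed] lin_map_\<gamma>_H])
  have zero: "\<gamma> (lin aw q) = \<zero>\<^bsub>H\<^esub>" if "q \<in> KR" for q
    by (rule zero_on_KR[OF _ _ that])
      (auto intro!: \<gamma>_KR span_TR_KR[OF aw_mrel] aw_line)
  show "p \<in> carrier (Free W) \<Longrightarrow> antipode (\<gamma> p) = \<gamma> (lin aw p)"
    unfolding antipode_def by (rule lift_\<gamma>[OF vspace_H lin zero])
  show "lin_map H H antipode"
    unfolding antipode_def by (rule lin_map_lift[OF vspace_H lin zero])
qed

lemma hopf_algebra_H: "hopf_algebra H \<Delta> counit antipode"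
proof -
  interpret B: k_bialgebra H \<Delta> counit by (rule k_bialgebra_H)
  interpret H: vspace H by simp
  have b: "bilin_map H H H (\<lambda>y z. (\<lambda>(y, z). antipode y \<otimes>\<^bsub>H\<^esub> z) (y, z))"
    and b': "bilin_map H H H (\<lambda>y z. (\<lambda>(y, z). y \<otimes>\<^bsub>H\<^esub> antipode z) (y, z))"
    using bilin_map_comp[OF bilin_mult lin_map_antipode lin_map_id]
      bilin_map_comp[OF bilin_mult lin_map_id lin_map_antipode] by simp_all
  have unit: "lin_map H H (\<lambda>x. counit x \<odot>\<^bsub>H\<^esub> \<one>\<^bsub>H\<^esub>)"
    using bilin_mapD(1)[OF bilin_counit Nil_unit] by (simp add: A_algebra_simps(6))
  have val: "counit (g w) \<odot>\<^bsub>H\<^esub> \<one>\<^bsub>H\<^esub> = \<gamma> (if w = [] then gen [] else 0)" if "w \<in> W" for w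
    using that by (simp add: counit_g A_algebra_simps(6) H.scale_one H.scale_zero_left)
  show ?thesis
  proof
    show "lin_map H H antipode" by (rule lin_map_antipode)
    fix x assume x: "x \<in> carrier H"
    show "extend H (\<lambda>(y, z). antipode y \<otimes>\<^bsub>H\<^esub> z) (\<Delta> x) = counit x \<odot>\<^bsub>H\<^esub> \<one>\<^bsub>H\<^esub>"
      by (rule lin_map_H_ext[OF vspace_H lin_map_extend_\<Delta>[OF b] unit _ x])
        (subst extend_\<Delta>[OF b, where F = "\<lambda>u v. aw u \<star> gen v"],
          auto simp: val antipode_\<gamma> mult_\<gamma> aw_closed qmul_words antipode_word_left)
    show "extend H (\<lambda>(y, z). y \<otimes>\<^bsub>H\<^esub> antipode z) (\<Delta> x) = counit x \<odot>\<^bsub>H\<^esub> \<one>\<^bsub>H\<^esub>"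
      by (rule lin_map_H_ext[OF vspace_H lin_map_extend_\<Delta>[OF b'] unit _ x])
        (subst extend_\<Delta>[OF b', where F = "\<lambda>u v. gen u \<star> aw v"],
          auto simp: val antipode_\<gamma> mult_\<gamma> aw_closed qmul_words antipode_word_right)
  qed
qed

end

section \<open>The grading\<close>

context ring_letter_algebra
begin

abbreviation Wn :: "nat \<Rightarrow> 'a list set" where "Wn n \<equiv> {w \<in> W. length w = n}"

lemma Wn_Free: "p \<in> carrier (Free (Wn n)) \<Longrightarrow> p \<in> carrier (Free W)"
  by (rule Free_mono) auto

lemma A_degree_eq: "A_degree sc R L n = \<gamma> ` carrier (Free (Wn n))"
proof -
  have "X \<in> A_degree sc R L n \<longleftrightarrow> X \<in> \<gamma> ` carrier (Free (Wn n))" for X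
  proof
    assume "X \<in> A_degree sc R L n"
    then obtain p where "p \<in> carrier (Free (bar L ` Wn n))" "X = p +o free.span AR"
      by (auto simp: A_degree_def carrier_Free)
    then show "X \<in> \<gamma> ` carrier (Free (Wn n))"
      using Free_image_lin[of p "bar L" "Wn n"] by (auto simp: \<gamma>_def)
  next
    assume "X \<in> \<gamma> ` carrier (Free (Wn n))"
    then obtain p where p: "p \<in> carrier (Free (Wn n))" "X = \<gamma> p" by blast
    have "barred p \<in> carrier (Free (bar L ` Wn n))"
      using p(1) by (rule lin_closed[rotated]) (auto intro!: Free_single)
    then show "X \<in> A_degree sc R L n"
      unfolding A_degree_def p(2) \<gamma>_def carrier_Free by blast
  qed
  then show ?thesis by blast
qed

abbreviation homog :: "nat \<Rightarrow> ('a list \<Rightarrow>\<^sub>0 'k) \<Rightarrow> ('a list \<Rightarrow>\<^sub>0 'k)"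
  where "homog n \<equiv> lin (\<lambda>w. if length w = n then gen w else 0)"

lemma homog_closed: "p \<in> carrier (Free W) \<Longrightarrow> homog n p \<in> carrier (Free (Wn n))"
  by (rule lin_closed[of W]) auto

lemma homog_eq:
  assumes "p \<in> carrier (Free (Wn k))"
  shows "homog n p = (if k = n then p else 0)"
proof -
  have "homog n p = lin (\<lambda>w. if k = n then gen w else 0) p"
    by (rule lin_cong[OF _ assms]) auto
  then show ?thesis by simp
qed

text \<open>Descends to \<open>A(R)\<close> because the relations are homogeneous.\<close>

definition component :: "nat \<Rightarrow> ('a bar_word \<Rightarrow>\<^sub>0 'k) set \<Rightarrow> ('a bar_word \<Rightarrow>\<^sub>0 'k) set"
  where "component n = lift (\<lambda>p. \<gamma> (homog n p))"

lemma component_lift: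
  shows component_\<gamma>: "p \<in> carrier (Free W) \<Longrightarrow> component n (\<gamma> p) = \<gamma> (homog n p)"
    and lin_map_component: "lin_map H H (component n)"
proof -
  have lin: "lin_map (Free W) H (\<lambda>p. \<gamma> (homog n p))"
    by (rule lin_map_comp[OF lin_map_lin_Free lin_map_\<gamma>_H]) auto
  have zero: "\<gamma> (homog n q) = \<zero>\<^bsub>H\<^esub>" if q: "q \<in> KR" for q
  proof (rule zero_on_KR[OF _ _ q])
    fix u v x y c d assume uv: "u \<in> W" "v \<in> W" "x \<in> V" "y \<in> V"
    have "homog n (mrel u v c x d y) = (if Suc (length u + length v) = n then mrel u v c x d y else 0)"
      by (simp add: mrel_def)
    then show "\<gamma> (homog n (mrel u v c x d y)) = \<zero>\<^bsub>H\<^esub>"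
      using \<gamma>_KR[OF span_TR_KR[OF mrel_in_span[OF uv]]] by simp
  next
    fix l w assume "l \<in> L" "w \<in> W"
    then show "\<gamma> (homog n (gen (l # w))) = \<zero>\<^bsub>H\<^esub>"
      using \<gamma>_KR[OF gen_line] by simp
  qed
  show "p \<in> carrier (Free W) \<Longrightarrow> component n (\<gamma> p) = \<gamma> (homog n p)"
    unfolding component_def by (rule lift_\<gamma>[OF vspace_H lin zero])
  show "lin_map H H (component n)"
    unfolding component_def by (rule lin_map_lift[OF vspace_H lin zero])
qed

lemma component_degree:
  assumes "a \<in> A_degree sc R L k"
  shows "component n a = (if k = n then a else \<zero>\<^bsub>H\<^esub>)"
proof -
  obtain p where p: "p \<in> carrier (Free (Wn k))" "a = \<gamma> p" using assms by (auto simp: A_degree_eq)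
  then show ?thesis by (simp add: component_\<gamma>[OF Wn_Free] homog_eq)
qed

lemma A_degree_H: "a \<in> A_degree sc R L n \<Longrightarrow> a \<in> carrier H"
  by (auto simp: A_degree_eq intro!: \<gamma>_H Wn_Free)

text \<open>The projections \<open>component n\<close> recover the summands of every homogeneous decomposition, which gives
  uniqueness.\<close>

lemma homogeneous_decomposition:
  assumes x: "x \<in> carrier H"
  shows "\<exists>!f. (\<forall>n. f n \<in> A_degree sc R L n) \<and> finite {n. f n \<noteq> \<zero>\<^bsub>H\<^esub>} \<and>
    x = (\<Oplus>\<^bsub>H\<^esub>n\<in>{n. f n \<noteq> \<zero>\<^bsub>H\<^esub>}. f n)"
proof (rule ex1I[of _ "\<lambda>n. component n x"])
  interpret H: vspace H by simp
  obtain p where p: "p \<in> carrier (Free W)" "x = \<gamma> p" using x by (rule H_E)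
  let ?N = "length ` Poly_Mapping.keys p"
  let ?f = "\<lambda>n. component n x"
  have f: "?f n = \<gamma> (homog n p)" for n using p by (simp add: component_\<gamma>)
  have keys: "p \<in> carrier (Free (Poly_Mapping.keys p))" by (simp add: carrier_Free)
  have "homog n p = 0" if n: "n \<notin> ?N" for n
  proof -
    have "homog n p = lin (\<lambda>_. 0) p" by (rule lin_cong[OF _ keys]) (use n in auto)
    then show ?thesis by simp
  qed
  then have outside: "?f n = \<zero>\<^bsub>H\<^esub>" if "n \<notin> ?N" for n using that by (simp add: f)
  then have sub: "{n. ?f n \<noteq> \<zero>\<^bsub>H\<^esub>} \<subseteq> ?N" by blast
  have closed: "?f n \<in> carrier H" for n
    unfolding f by (rule \<gamma>_H[OF Wn_Free[OF homog_closed[OF p(1)]]])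
  have lin_sum_fun: "(\<Sum>n\<in>N. lin (F n) p) = lin (\<lambda>w. \<Sum>n\<in>N. F n w) p"
    for N and F :: "nat \<Rightarrow> 'a list \<Rightarrow> _"
    by (induction p rule: free_induct[OF Free_UNIV])
      (simp_all add: sum.distrib free.scale_sum_right)
  have "(\<Sum>n\<in>?N. homog n p) = p"
    using lin_cong[OF _ keys, of "\<lambda>w. \<Sum>n\<in>?N. if length w = n then gen w else 0" gen]
    by (simp add: lin_sum_fun)
  then have "x = \<gamma> (\<Sum>n\<in>?N. homog n p)" using p by simp
  also have "\<dots> = (\<Oplus>\<^bsub>H\<^esub>n\<in>?N. ?f n)"
    unfolding f by (rule lin_map_sum[OF vspace_H lin_map_\<gamma>_H]) (use p in \<open>auto intro!: Wn_Free homog_closed\<close>)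
  also have "\<dots> = (\<Oplus>\<^bsub>H\<^esub>n\<in>{n. ?f n \<noteq> \<zero>\<^bsub>H\<^esub>}. ?f n)"
    by (rule H.add.finprod_mono_neutral_cong_right) (use sub closed in auto)
  finally have sum: "x = (\<Oplus>\<^bsub>H\<^esub>n\<in>{n. ?f n \<noteq> \<zero>\<^bsub>H\<^esub>}. ?f n)" .
  have "\<forall>n. ?f n \<in> A_degree sc R L n"
    unfolding f A_degree_eq using homog_closed[OF p(1)] by blast
  with sum show "(\<forall>n. ?f n \<in> A_degree sc R L n) \<and> finite {n. ?f n \<noteq> \<zero>\<^bsub>H\<^esub>} \<and>
      x = (\<Oplus>\<^bsub>H\<^esub>n\<in>{n. ?f n \<noteq> \<zero>\<^bsub>H\<^esub>}. ?f n)"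
    using finite_subset[OF sub finite_imageI[OF finite_keys]] by blast
  fix h
  assume h: "(\<forall>n. h n \<in> A_degree sc R L n) \<and> finite {n. h n \<noteq> \<zero>\<^bsub>H\<^esub>} \<and>
    x = (\<Oplus>\<^bsub>H\<^esub>n\<in>{n. h n \<noteq> \<zero>\<^bsub>H\<^esub>}. h n)"
  let ?I = "{n. h n \<noteq> \<zero>\<^bsub>H\<^esub>}"
  have hc: "h n \<in> carrier H" for n using h A_degree_H by blast
  show "h = (\<lambda>n. component n x)"
  proof
    fix n
    have comp: "component n (h k) = (if n = k then h k else \<zero>\<^bsub>H\<^esub>)" for k
      using component_degree[of "h k" k n] h by simp
    have "component n x = (\<Oplus>\<^bsub>H\<^esub>k\<in>?I. component n (h k))"
      using h lin_map_finsum[OF vspace_H vspace_H lin_map_component, of h ?I n] hc by auto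
    also have "\<dots> = (\<Oplus>\<^bsub>H\<^esub>k\<in>?I. if n = k then h k else \<zero>\<^bsub>H\<^esub>)"
      unfolding comp ..
    also have "\<dots> = h n"
    proof (cases "n \<in> ?I")
      case True
      then show ?thesis using h hc by (intro H.finsum_singleton) auto
    next
      case False
      then have "(\<Oplus>\<^bsub>H\<^esub>k\<in>?I. if n = k then h k else \<zero>\<^bsub>H\<^esub>) = (\<Oplus>\<^bsub>H\<^esub>k\<in>?I. \<zero>\<^bsub>H\<^esub>)"
        by (intro H.finsum_cong') auto
      then show ?thesis using False by simp
    qed
    finally show "h n = component n x" ..
  qed
qed

lemma lincomb_gen_class:
  assumes "\<And>s. s \<in> S \<Longrightarrow> h s \<in> S'" "p \<in> carrier (Free S)"
  shows "lincomb (presented S' Q) (\<lambda>s. gen_class Q (h s)) p = lin (\<lambda>s. gen (h s)) p +o free.span Q"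
  unfolding gen_class_def by (rule lincomb_lin_map[OF vspace_presented lin_map_coset _ assms(2)]) (use assms(1) in auto)

lemma coproduct_degree_H:
  assumes "x \<in> A_degree sc R L n"
  shows "\<Delta> x \<in> tensor_degree H (A_degree sc R L) n"
proof -
  obtain p where p: "p \<in> carrier (Free (Wn n))" "x = \<gamma> p" using assms by (auto simp: A_degree_eq)
  let ?P = "lin splits p"
  let ?S = "\<Union>k\<in>{..n}. Wn k \<times> Wn (n - k)"
  let ?U = "\<Union>k\<in>{..n}. A_degree sc R L k \<times> A_degree sc R L (n - k)"
  have "?P \<in> carrier (Free ?S)"
  proof (rule lin_closed[OF _ p(1)])
    fix w assume w: "w \<in> Wn n"
    show "splits w \<in> carrier (Free ?S)"
      unfolding splits_def split_sum_def using w by (intro Free_sum Free_single) auto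
  qed
  then have "lin (\<lambda>(a, b). gen (g a, g b)) ?P \<in> carrier (Free ?U)"
    by (rule lin_closed[rotated]) (force intro!: Free_single simp: A_degree_eq)
  moreover have "\<Delta> x = lin (\<lambda>(a, b). gen (g a, g b)) ?P +o free.span (tensor_rels H H)"
  proof -
    have "\<Delta> x = lincomb (tensor H H) (\<lambda>(a, b). pr (g a) (g b)) ?P"
      using p Wn_Free[OF p(1)] by (simp add: \<Delta>_\<gamma>)
    also have "\<dots> = lincomb (presented (carrier H \<times> carrier H) (tensor_rels H H))
        (\<lambda>r. gen_class (tensor_rels H H) (case r of (a, b) \<Rightarrow> (g a, g b))) ?P"
      by (simp add: pure_tensor_def tensor_def case_prod_beta')
    also have "\<dots> = lin (\<lambda>r. gen (case r of (a, b) \<Rightarrow> (g a, g b))) ?P +o free.span (tensor_rels H H)"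
      by (rule lincomb_gen_class[OF _ lin_splits_closed[OF Wn_Free[OF p(1)]]]) auto
    finally show ?thesis by (simp add: case_prod_beta')
  qed
  ultimately show ?thesis
    unfolding tensor_degree_def carrier_Free by blast
qed

lemma graded_hopf_algebra_H: "graded_hopf_algebra H \<Delta> counit antipode (A_degree sc R L)"
proof -
  interpret H: vspace H by simp
  note \<gamma> = lin_mapD(2,3)[OF lin_map_\<gamma>_H, symmetric, unfolded Free_simps]
  show ?thesis
  proof (intro graded_hopf_algebra.intro graded_hopf_algebra_axioms.intro)
    show "hopf_algebra H \<Delta> counit antipode" by (rule hopf_algebra_H)
    fix n
    show "submodule (A_degree sc R L n) ring_of_type_algebra H"
    proof (rule H.submoduleI)
      show "A_degree sc R L n \<subseteq> carrier H" using A_degree_H by blast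
      show "\<zero>\<^bsub>H\<^esub> \<in> A_degree sc R L n"
        unfolding A_degree_eq by (rule image_eqI[of _ _ 0]) simp_all
      fix a assume "a \<in> A_degree sc R L n"
      then obtain p where p: "a = \<gamma> p" "p \<in> carrier (Free (Wn n))" by (auto simp: A_degree_eq)
      have "\<gamma> (- p) \<oplus>\<^bsub>H\<^esub> \<gamma> p = \<zero>\<^bsub>H\<^esub>"
        using p Wn_Free[OF p(2)] by (simp add: \<gamma>)
      then have "\<ominus>\<^bsub>H\<^esub> a = \<gamma> (- p)"
        using p Wn_Free[OF p(2)] by (intro H.minus_equality) (auto intro!: \<gamma>_H)
      then show "\<ominus>\<^bsub>H\<^esub> a \<in> A_degree sc R L n" using p by (auto simp: A_degree_eq)
      show "c \<odot>\<^bsub>H\<^esub> a \<in> A_degree sc R L n" for c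
        using p Wn_Free[OF p(2)] by (auto simp: A_degree_eq \<gamma>)
      fix b assume "b \<in> A_degree sc R L n"
      then show "a \<oplus>\<^bsub>H\<^esub> b \<in> A_degree sc R L n"
        using p Wn_Free[OF p(2)] by (auto simp: A_degree_eq \<gamma> Wn_Free)
    qed
    fix x assume "x \<in> A_degree sc R L n"
    then show "\<Delta> x \<in> tensor_degree H (A_degree sc R L) n" by (rule coproduct_degree_H)
  next
    fix x assume "x \<in> carrier H"
    then show "\<exists>!f. (\<forall>n. f n \<in> A_degree sc R L n) \<and> finite {n. f n \<noteq> \<zero>\<^bsub>H\<^esub>} \<and>
      x = (\<Oplus>\<^bsub>H\<^esub>n\<in>{n. f n \<noteq> \<zero>\<^bsub>H\<^esub>}. f n)"
      by (rule homogeneous_decomposition)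
  next
    fix x y p q assume "x \<in> A_degree sc R L p" "y \<in> A_degree sc R L q"
    then obtain a b where a: "x = \<gamma> a" "a \<in> carrier (Free (Wn p))"
      and b: "y = \<gamma> b" "b \<in> carrier (Free (Wn q))" by (auto simp: A_degree_eq)
    have "a \<star> b \<in> carrier (Free (Wn (p + q)))"
      unfolding qmul_def
    proof (intro lin_closed[OF lin_closed])
      fix u v assume "u \<in> Wn p" "v \<in> Wn q"
      then show "qs m t u v \<in> carrier (Free (Wn (p + q)))"
        using qs_degree[of V m t u v] by (auto simp: m_closed t_letter)
    qed (use a b in auto)
    then show "x \<otimes>\<^bsub>H\<^esub> y \<in> A_degree sc R L (p + q)"
      using a b by (auto simp: mult_\<gamma> Wn_Free A_degree_eq)
  next
    show "\<one>\<^bsub>H\<^esub> \<in> A_degree sc R L 0"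
      unfolding A_degree_eq A_algebra_simps(6) by (intro imageI Free_single) simp
  next
    fix x n assume x: "x \<in> A_degree sc R L n"
    then obtain p where p: "x = \<gamma> p" "p \<in> carrier (Free (Wn n))" by (auto simp: A_degree_eq)
    show "counit x = 0" if "n > 0"
    proof -
      have "[] \<notin> Poly_Mapping.keys p" using p(2) that by (auto simp: carrier_Free)
      then show ?thesis using p by (simp add: counit_\<gamma> Wn_Free in_keys_iff)
    qed
    have "lin aw p \<in> carrier (Free (Wn n))"
    proof (rule lin_closed[OF _ p(2)])
      fix w assume "w \<in> Wn n"
      then show "aw w \<in> carrier (Free (Wn n))"
        using antipode_word_degree[of V m t w] by (auto simp: m_closed t_letter)
    qed
    then show "antipode x \<in> A_degree sc R L n"
      using p by (auto simp: antipode_\<gamma> Wn_Free A_degree_eq)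
  qed
qed

section \<open>Commutativity\<close>

lemma qs_commute:
  assumes "\<And>x y. \<lbrakk>x \<in> V; y \<in> V\<rbrakk> \<Longrightarrow> m x y = m y x" "u \<in> W" "v \<in> W"
  shows "qs m t u v = qs m t v u"
proof -
  have "qs n s u v = qs n s v u" if "\<And>x y. \<lbrakk>x \<in> V; y \<in> V\<rbrakk> \<Longrightarrow> n x y = n y x" "u \<in> W" "v \<in> W" for n s u v
    using that
  proof (induction n s u v rule: qs.induct)
    case (3 n s x u y v)
    then show ?case by simp
  qed simp_all
  from this[OF assms] show ?thesis .
qed

lemma commutative_H:
  assumes "\<And>x y. \<lbrakk>x \<in> V; y \<in> V\<rbrakk> \<Longrightarrow> m x y = m y x" "a \<in> carrier H" "b \<in> carrier H"
  shows "a \<otimes>\<^bsub>H\<^esub> b = b \<otimes>\<^bsub>H\<^esub> a"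
proof -
  obtain p where p: "p \<in> carrier (Free W)" "a = \<gamma> p" using assms(2) by (rule H_E)
  obtain q where q: "q \<in> carrier (Free W)" "b = \<gamma> q" using assms(3) by (rule H_E)
  have "p \<star> q = q \<star> p"
    using p(1)
  proof (induction p rule: free_induct)
    case (step c u p)
    have "gen u \<star> q = q \<star> gen u"
      using q(1) by (induction q rule: free_induct) (simp_all add: qs_commute[OF assms(1)] step)
    with step show ?case by simp
  qed simp
  with p q show ?thesis by (simp add: mult_\<gamma>)
qed

text \<open>If \<open>a\<close> is not on the line, there are linear functionals with \<open>f t = 0\<close>, \<open>f a = 1\<close> and \<open>h t = 1\<close>.
  Then \<open>f \<otimes> h\<close>, on words of length two, kills \<open>KR\<close> but not \<open>a \<otimes> t\<close>.\<close>

lemma gen_pair_unit: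
  assumes t0: "t \<noteq> 0" and a: "a \<in> V" and z: "gen [a, t] \<in> free.span KR"
  shows "a \<in> L"
proof (rule ccontr)
  assume "a \<notin> L"
  interpret pair: vector_space_pair sc "(*) :: 'k \<Rightarrow> 'k \<Rightarrow> 'k"
    by unfold_locales (simp_all add: algebra_simps)
  have L: "L = span {t}" by (simp add: line_eq span_singleton)
  have ind: "independent {t}" using t0 by simp
  have "independent {a, t}" using \<open>a \<notin> L\<close> ind L t0 by (simp add: independent_insert)
  from pair.linear_independent_extend[OF this, of "\<lambda>x. if x = t then 0 else 1"]
  obtain f where f: "Vector_Spaces.linear sc (*) f" "\<forall>x\<in>{a, t}. f x = (if x = t then 0 else 1)" by blast
  have "a \<noteq> t" using \<open>a \<notin> L\<close> t_in_L by blast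
  with f have ft: "f t = 0" "f a = 1" by auto
  from pair.linear_independent_extend[OF ind, of "\<lambda>x. 1"]
  obtain h where h: "Vector_Spaces.linear sc (*) h" "h t = 1" by auto
  have lin: "f (sc c x + sc d y) = c * f x + d * f y" "h (sc c x + sc d y) = c * h x + d * h y" for c d x y
    using f(1) h(1) by (simp_all add: pair.linear_add pair.linear_scale)
  define F where "F w = (case w of [x, y] \<Rightarrow> (f x * h y) *\<^sub>F gen () | _ \<Rightarrow> 0)" for w
  have F2: "F [x, y] = (f x * h y) *\<^sub>F gen ()" for x y by (simp add: F_def)
  have F0: "F w = 0" if "length w \<noteq> 2" for w
    using that by (auto simp: F_def split: list.splits)
  have "lin F q = 0" if q: "q \<in> KR" for q
  proof (rule zero_on_KR[OF _ _ q])
    fix u v x y c d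
    show "lin F (mrel u v c x d y) = 0"
    proof (cases "length u + length v = 1")
      case True
      have comb: "e *\<^sub>F gen () - c *\<^sub>F (a *\<^sub>F gen ()) - d *\<^sub>F (b *\<^sub>F gen ()) = (0 :: unit \<Rightarrow>\<^sub>0 'k)"
        if "e = c * a + d * b" for e a b
        unfolding that by (simp add: free.scale_left_distrib)
      from True consider y' where "u = []" "v = [y']" | x' where "u = [x']" "v = []"
        by (cases u; cases v) auto
      then show ?thesis
      proof cases
        case 1
        show ?thesis
          unfolding mrel_def 1 append_Nil lin_diff lin_scale lin_gen F2
          by (rule comb) (simp only: lin distrib_left distrib_right ac_simps)
      next
        case 2
        show ?thesis
          unfolding mrel_def 2 append_Cons append_Nil lin_diff lin_scale lin_gen F2
          by (rule comb) (simp only: lin distrib_left distrib_right ac_simps)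
      qed
    next
      case False
      then show ?thesis by (simp add: mrel_def F0)
    qed
  next
    fix l w assume "l \<in> L" "w \<in> W"
    then obtain c where l: "l = sc c t" by (auto simp: line_eq)
    have fl: "f l = 0" using f(1) ft by (simp add: l pair.linear_scale)
    show "lin F (gen (l # w)) = 0"
    proof (cases w)
      case (Cons y w')
      then show ?thesis by (cases w') (simp_all add: F2 F0 fl)
    qed (simp add: F0)
  qed
  then have "lin F (gen [a, t]) \<in> free.span {}"
    by (intro span_lin_image[OF _ z]) simp
  then have "gen () = (0 :: unit \<Rightarrow>\<^sub>0 'k)" by (simp add: F2 ft h)
  then show False by (metis lookup_single_eq lookup_zero zero_neq_one)
qed

text \<open>In the commutator of two words of length one only the third terms of the recursion survive, and
  their difference is \<open>(m y x - m x y) \<otimes> t\<close>.\<close>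

lemma commutator_in_line:
  assumes t0: "t \<noteq> 0"
    and comm: "\<And>a b. \<lbrakk>a \<in> carrier H; b \<in> carrier H\<rbrakk> \<Longrightarrow> a \<otimes>\<^bsub>H\<^esub> b = b \<otimes>\<^bsub>H\<^esub> a"
    and x: "x \<in> V" and y: "y \<in> V"
  shows "m x y - m y x \<in> L"
proof (rule gen_pair_unit[OF t0])
  have eq: "\<gamma> (gen [x] \<star> gen [y]) = \<gamma> (gen [y] \<star> gen [x])"
    using comm[of "g [x]" "g [y]"] x y by (simp add: mult_\<gamma> del: qmul_simps)
  have mem: "m x y \<in> V" "m y x \<in> V" using x y by (auto intro: m_closed)
  have 1: "gen [m x y, t] - gen [m y x, t] \<in> free.span KR"
  proof -
    have "gen [y] \<star> gen [x] - gen [x] \<star> gen [y] \<in> free.span KR"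
      using eq x y by (subst \<gamma>_eq_iff[symmetric]) (auto intro!: qmul_words simp del: qmul_simps)
    then show ?thesis by simp
  qed
  show "m x y - m y x \<in> V" using mem letters_subspace by (simp add: subspace_diff)
  have "mrel [] [t] 1 (m x y) (- 1) (m y x) \<in> free.span KR"
    using mem t_letter by (intro span_TR_KR mrel_in_span) auto
  from free.span_add[OF this 1] show "gen [m x y - m y x, t] \<in> free.span KR"
    by (simp add: mrel_def)
qed

text \<open>If \<open>[x, y] = c t\<close> for the product with unit \<open>t\<close>, then \<open>[x, y x] = [x, y] x = c x\<close> also lies on
  the line. So \<open>c \<noteq> 0\<close> would make \<open>x\<close> a multiple of the unit, hence central.\<close>

lemma commutative_letters:
  assumes line: "\<And>x y. \<lbrakk>x \<in> V; y \<in> V\<rbrakk> \<Longrightarrow> m x y - m y x \<in> L" and x: "x \<in> V" and y: "y \<in> V"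
  shows "m x y = m y x"
proof (rule ccontr)
  assume ne: "m x y \<noteq> m y x"
  obtain c where c: "m x y - m y x = sc c t" using line[OF x y] by (auto simp: line_eq)
  have m_diff: "m (a - b) z = m a z - m b z" for a b z
    using m_add(1)[of "a - b" b z] by (simp add: eq_diff_eq)
  have "m x (m y x) - m (m y x) x = m (m x y - m y x) x"
    by (simp add: m_diff assoc)
  then have "m x (m y x) - m (m y x) x = sc c x" by (simp add: c m_scale)
  then have "sc c x \<in> L" using line[OF x m_closed[OF y x]] by simp
  moreover have "c \<noteq> 0" using c ne by auto
  ultimately have "sc (inverse c) (sc c x) \<in> L"
    using subspace_scale[OF line_subspace] by blast
  with \<open>c \<noteq> 0\<close> obtain e where "x = sc e t" by (auto simp: line_eq)
  then show False using ne by (simp add: m_scale)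
qed

end

section \<open>Letters of a Tate algebra\<close>

locale tate_unit = tate_phi_algebra sc R L
  for sc :: "'k::field \<Rightarrow> 'a::ring_1 \<Rightarrow> 'a" and R L +
  fixes t :: 'a
  assumes t_line: "t \<in> L" and t_nonzero: "t \<noteq> 0"
begin

abbreviation s :: 'a where "s \<equiv> ring_inverse t"

lemma inverse_t [simp]: "t * s = 1" "s * t = 1"
proof -
  obtain r where r: "t * r = 1" "r * t = 1" using line_invertible[OF t_line t_nonzero] by blast
  have "s = r"
    unfolding ring_inverse_def
  proof (rule the_equality)
    fix r' assume "t * r' = 1 \<and> r' * t = 1"
    have "r' = r * t * r'" using r by simp
    also have "\<dots> = r * (t * r')" by (rule mult.assoc)
    also have "\<dots> = r" using \<open>t * r' = 1 \<and> r' * t = 1\<close> by simp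
    finally show "r' = r" .
  qed (use r in blast)
  then show "t * s = 1" "s * t = 1" using r by simp_all
qed

lemma t_commute: "t * x = x * t"
  by (rule line_central[OF t_line])

lemma s_commute: "s * x = x * s"
proof -
  have "s * x = s * x * (t * s)" by simp
  also have "\<dots> = s * (x * t) * s" by (simp add: mult.assoc)
  also have "\<dots> = s * (t * x) * s" by (simp only: t_commute)
  also have "\<dots> = x * s" by (simp flip: mult.assoc)
  finally show ?thesis .
qed

text \<open>Multiplying the homogeneous components of \<open>t\<^sup>-\<^sup>1\<close> by \<open>t\<close> gives a homogeneous decomposition of \<open>1\<close>, so
  that only the component of degree \<open>-1\<close> is nonzero.\<close>

lemma s_degree: "s \<in> R (- 1)"
proof -
  obtain f where f: "\<forall>n. f n \<in> R n" "finite {n. f n \<noteq> 0}" "s = (\<Sum>n | f n \<noteq> 0. f n)"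
    using homogeneous_direct_sum[of s] by blast
  let ?g = "\<lambda>n. t * f (n - 1)" and ?h = "\<lambda>n::int. if n = 0 then 1 else 0 :: 'a"
  have zero: "t * x = 0 \<longleftrightarrow> x = 0" for x
    using mult.assoc[of s t x] by auto
  have t1: "t \<in> R 1" using t_line line_degree by blast
  have "?g n \<in> R n" for n using homogeneous_mult[OF t1, of "f (n - 1)" "n - 1"] f by simp
  moreover have g_set: "{n. ?g n \<noteq> 0} = (\<lambda>n. n + 1) ` {n. f n \<noteq> 0}"
    by (auto simp: zero image_iff) (metis diff_add_cancel)
  moreover have "1 = (\<Sum>n | ?g n \<noteq> 0. ?g n)"
  proof -
    have "1 = t * (\<Sum>n | f n \<noteq> 0. f n)" by (simp flip: f(3))
    also have "\<dots> = (\<Sum>n | ?g n \<noteq> 0. ?g n)"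
      unfolding g_set by (subst sum.reindex) (auto simp: sum_distrib_left inj_on_def)
    finally show ?thesis .
  qed
  ultimately have g: "(\<forall>n. ?g n \<in> R n) \<and> finite {n. ?g n \<noteq> 0} \<and> 1 = (\<Sum>n | ?g n \<noteq> 0. ?g n)"
    using f(2) by auto
  have h_set: "{n. ?h n \<noteq> 0} = {0}" using t_nonzero zero[of 1] by auto
  have "\<forall>n. ?h n \<in> R n" by (simp add: homogeneous_one subspace_0[OF homogeneous_subspace])
  then have h: "(\<forall>n. ?h n \<in> R n) \<and> finite {n. ?h n \<noteq> 0} \<and> 1 = (\<Sum>n | ?h n \<noteq> 0. ?h n)"
    unfolding h_set by simp
  have gh: "?g = ?h"
    by (rule Uniq_D[OF homogeneous_direct_sum[of 1, unfolded ex1_iff_ex_Uniq, THEN conjunct2], OF g h])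
  have "f n = 0" if "n \<noteq> - 1" for n
    using fun_cong[OF gh, of "n + 1"] that by (simp add: zero split: if_splits)
  then have "s = (\<Sum>n\<in>{- 1}. f n)"
    unfolding f(3) by (intro sum.mono_neutral_left) auto
  then show ?thesis using f(1) by simp
qed

lemma line_eq_multiples: "L = range (\<lambda>c. sc c t)"
proof -
  obtain B where B: "B \<subseteq> L" "independent B" "L \<subseteq> span B" "card B = dim L"
    by (rule basis_exists)
  then obtain b where b: "B = {b}" using line_dim by (auto simp: card_1_singleton_iff)
  then obtain c where c: "t = sc c b" using t_line B(3) by (auto simp: span_singleton)
  then have "c \<noteq> 0" using t_nonzero by auto
  then have "b = sc (inverse c) t" by (simp add: c)
  have "L \<subseteq> range (\<lambda>c. sc c t)"
  proof
    fix x assume "x \<in> L"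
    then obtain d where "x = sc d b" using B(3) b by (auto simp: span_singleton)
    then have "x = sc (d * inverse c) t" by (simp add: \<open>b = sc (inverse c) t\<close>)
    then show "x \<in> range (\<lambda>c. sc c t)" by blast
  qed
  moreover have "range (\<lambda>c. sc c t) \<subseteq> L" using line_subspace t_line by (auto simp: subspace_scale)
  ultimately show ?thesis by blast
qed

sublocale letters: ring_letter_algebra sc "\<lambda>x y. x * y * s" t R L
proof
  fix x y z c
  have "x * y * s * z * s = x * y * (s * z) * s" by (simp add: mult.assoc)
  also have "\<dots> = x * (y * z * s) * s" unfolding s_commute[of z] by (simp add: mult.assoc)
  finally show "x * y * s * z * s = x * (y * z * s) * s" .
  show "t * x * s = x" unfolding t_commute[of x] by (simp add: mult.assoc)
  show "x * t * s = x" by (simp add: mult.assoc)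
  show "subspace (R 1)" by (rule homogeneous_subspace)
  show "(x + y) * z * s = x * z * s + y * z * s" "z * (x + y) * s = z * x * s + z * y * s"
    by (simp_all add: algebra_simps)
  show "sc c x * y * s = sc c (x * y * s)" "x * sc c y * s = sc c (x * y * s)"
    by (simp_all add: scale_mult_left scale_mult_right)
  show "t \<in> R 1" using t_line line_degree by blast
  show "L = range (\<lambda>c. sc c t)" by (rule line_eq_multiples)
  assume "x \<in> R 1" "y \<in> R 1"
  then show "x * y * s \<in> R 1" using homogeneous_mult[OF homogeneous_mult s_degree, of x 1 y 1] by simp
qed simp

text \<open>Multiplication by a power of \<open>t\<close> identifies every homogeneous part with \<open>R 1\<close>.\<close>

lemma shift_to_degree_1:
  assumes "a \<in> R n"
  obtains c c' where "c * c' = 1" "\<And>x. c * x = x * c" "a * c \<in> R 1"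
proof -
  have pow: "t ^ k \<in> R (int k)" "s ^ k \<in> R (- int k)" for k
  proof (induction k)
    case (Suc k)
    show "t ^ Suc k \<in> R (int (Suc k))"
      using homogeneous_mult[OF letters.t_letter Suc(1)] by (simp add: add.commute)
    show "s ^ Suc k \<in> R (- int (Suc k))"
      using homogeneous_mult[OF s_degree Suc(2)] by simp
  qed (simp_all add: homogeneous_one)
  have inv: "t ^ k * s ^ k = 1" "s ^ k * t ^ k = 1" for k
    by (simp_all add: left_right_inverse_power)
  have central: "t ^ k * x = x * t ^ k" "s ^ k * x = x * s ^ k" for k x
    by (rule power_commuting_commutes, simp add: t_commute s_commute)+
  show thesis
  proof (cases "n \<ge> 1")
    case True
    have "a * s ^ nat (n - 1) \<in> R 1"
      using homogeneous_mult[OF assms pow(2)[of "nat (n - 1)"]] True by simp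
    then show thesis by (intro that[OF inv(2) central(2)])
  next
    case False
    have "a * t ^ nat (1 - n) \<in> R 1"
      using homogeneous_mult[OF assms pow(1)[of "nat (1 - n)"]] False by simp
    then show thesis by (intro that[OF inv(1) central(1)])
  qed
qed

text \<open>The powers of \<open>t\<close> that shift homogeneous elements to degree \<open>1\<close> are central units, so commutativity
  in degree \<open>1\<close> implies commutativity of homogeneous elements and, by linearity, of \<open>R\<close>.\<close>

lemma commutative_iff:
  "(\<forall>x\<in>R 1. \<forall>y\<in>R 1. x * y * s = y * x * s) \<longleftrightarrow> (\<forall>x y :: 'a. x * y = y * x)"
proof
  assume comm: "\<forall>x\<in>R 1. \<forall>y\<in>R 1. x * y * s = y * x * s"
  have R1: "x * y = y * x" if "x \<in> R 1" "y \<in> R 1" for x y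
  proof -
    have "x * y * s * t = y * x * s * t" using comm that by simp
    then show ?thesis by (simp add: mult.assoc)
  qed
  have homogeneous: "a * b = b * a" if a: "a \<in> R n" and b: "b \<in> R k" for a b n k
  proof -
    obtain c c' where c: "c * c' = 1" "\<And>x. c * x = x * c" "a * c \<in> R 1"
      using shift_to_degree_1[OF a] by blast
    obtain d d' where d: "d * d' = 1" "\<And>x. d * x = x * d" "b * d \<in> R 1"
      using shift_to_degree_1[OF b] by blast
    have eq: "a * b * (c * d) = b * a * (c * d)"
    proof -
      have "a * b * (c * d) = a * c * (b * d)" by (metis c(2) mult.assoc)
      also have "\<dots> = b * d * (a * c)" by (rule R1[OF c(3) d(3)])
      also have "\<dots> = b * a * (c * d)" by (metis d(2) mult.assoc)
      finally show ?thesis .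
    qed
    have "c * d * (d' * c') = 1" using c(1) d(1) by (metis mult.assoc mult.right_neutral)
    then show ?thesis using arg_cong[OF eq, of "\<lambda>x. x * (d' * c')"] by (simp add: mult.assoc)
  qed
  show "\<forall>x y :: 'a. x * y = y * x"
  proof (intro allI)
    fix x y :: 'a
    obtain f where f: "\<forall>n. f n \<in> R n" "x = (\<Sum>n | f n \<noteq> 0. f n)" using homogeneous_direct_sum[of x] by blast
    obtain h where h: "\<forall>n. h n \<in> R n" "y = (\<Sum>n | h n \<noteq> 0. h n)" using homogeneous_direct_sum[of y] by blast
    have "x * y = (\<Sum>n | f n \<noteq> 0. \<Sum>k | h k \<noteq> 0. f n * h k)" unfolding f(2) h(2) by (rule sum_product)
    also have "\<dots> = (\<Sum>n | f n \<noteq> 0. \<Sum>k | h k \<noteq> 0. h k * f n)"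
      using f(1) h(1) homogeneous by (intro sum.cong refl) blast
    also have "\<dots> = (\<Sum>k | h k \<noteq> 0. \<Sum>n | f n \<noteq> 0. h k * f n)" by (rule sum.swap)
    also have "\<dots> = y * x" unfolding f(2) h(2) by (rule sum_product[symmetric])
    finally show "x * y = y * x" .
  qed
qed simp

end

theorem theorem5p2:
  fixes sc :: "'k::field \<Rightarrow> 'a::ring_1 \<Rightarrow> 'a"
    and R :: "int \<Rightarrow> 'a set"
    and L :: "'a set"
    and t :: 'a
  assumes "tate_phi_algebra sc R L"
    and "t \<in> L" and "t \<noteq> 0"
  shows "(\<exists>\<epsilon> S. graded_hopf_algebra (A_algebra sc R L t) (A_coproduct sc R L) \<epsilon> S (A_degree sc R L)) \<and>
    ((\<forall>a\<in>carrier (A_algebra sc R L t). \<forall>b\<in>carrier (A_algebra sc R L t).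
        a \<otimes>\<^bsub>A_algebra sc R L t\<^esub> b = b \<otimes>\<^bsub>A_algebra sc R L t\<^esub> a) \<longleftrightarrow>
     (\<forall>x y :: 'a. x * y = y * x))"
proof -
  interpret tate_phi_algebra sc R L by fact
  interpret tate_unit sc R L t by unfold_locales (fact assms)+
  show ?thesis
  proof (intro conjI exI)
    show "graded_hopf_algebra (A_algebra sc R L t) (A_coproduct sc R L) letters.counit letters.antipode
        (A_degree sc R L)"
      by (rule letters.graded_hopf_algebra_H)
    show "(\<forall>a\<in>carrier (A_algebra sc R L t). \<forall>b\<in>carrier (A_algebra sc R L t).
        a \<otimes>\<^bsub>A_algebra sc R L t\<^esub> b = b \<otimes>\<^bsub>A_algebra sc R L t\<^esub> a) \<longleftrightarrow>
      (\<forall>x y :: 'a. x * y = y * x)"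
      unfolding commutative_iff[symmetric]
    proof (intro iffI ballI)
      fix x y
      assume comm: "\<forall>a\<in>carrier (A_algebra sc R L t). \<forall>b\<in>carrier (A_algebra sc R L t).
          a \<otimes>\<^bsub>A_algebra sc R L t\<^esub> b = b \<otimes>\<^bsub>A_algebra sc R L t\<^esub> a"
        and xy: "x \<in> R 1" "y \<in> R 1"
      show "x * y * s = y * x * s"
        by (rule letters.commutative_letters[OF letters.commutator_in_line[OF t_nonzero] xy])
          (use comm in blast)+
    next
      fix a b
      assume "\<forall>x\<in>R 1. \<forall>y\<in>R 1. x * y * s = y * x * s"
        "a \<in> carrier (A_algebra sc R L t)" "b \<in> carrier (A_algebra sc R L t)"
      then show "a \<otimes>\<^bsub>A_algebra sc R L t\<^esub> b = b \<otimes>\<^bsub>A_algebra sc R L t\<^esub> a"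
        by (intro letters.commutative_H) blast+
    qed
  qed
qed


end
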